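(* Let $\mathcal{F}$ be a germ of holomorphic foliation defined in a neighborhood of $0$ in $\mathbb{C}^2$. Let $\Gamma$ be a germ of singular $\mathcal{F}$-invariant curve at $0$. Then $$\nu_0(\mathcal{F}) \geq \max\left(\mu_T(\Gamma), \frac{\mu_D(\Gamma)}{2}\right).$$
   Context: A germ of holomorphic foliation $\mathcal{F}$ at $0\in\mathbb{C}^2$ is induced by a holomorphic vector field $X=a(x,y)\partial_x+b(x,y)\partial_y$ with $\mathrm{Sing}(X)\subset\{0\}$; its multiplicity is $\nu_0(\mathcal{F})=\min(\nu_0(a),\nu_0(b))$, where $\nu_0$ of a power series is its vanishing order at $0$. Germs of curves are reduced; the multiplicity $\nu_0(\Gamma)$ is the vanishing order of a reduced equation; $\Gamma$ is singular if $\nu_0(\Gamma)\ge 2$. The pull-back of a foliation is taken saturated (common factors of the coefficients are divided out). $\mathcal{F}$ is called $1$-dicritical if the exceptional divisor of the blow-up $\pi_1$ of $0$ is not invariant by the pull-back $\mathcal{F}_1=\pi_1^*\mathcal{F}$. Ramification. Let $\Gamma=\gamma^1\cup\dots\cup\gamma^q$ be the decomposition into irreducible components, $n_j=\nu_0(\gamma^j)$, $n=\mathrm{lcm}(n_1,\dots,n_q)$. Coordinates $(x,y)$ are chosen such that: if $\mathcal{F}$ is not $1$-dicritical, $x=0$ is not one of the lines of the tangent cone of $\mathcal{F}$; if $\mathcal{F}$ is $1$-dicritical, $x=0$ is not the tangent cone of any $\gamma^j$, $x=0$ is $\mathcal{F}$-invariant, and the point of $\pi_1^{-1}(0)$ defined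 by $x=0$ is a regular point of $\mathcal{F}_1$. Put $\tau(x,y)=(x^n,y)$. Then $\tau^{-1}(\Gamma)$ is a union of $\nu_0(\Gamma)$ smooth branches. Let $\pi_\tau=\pi_1^\tau\circ\dots\circ\pi_r^\tau$ be its minimal desingularization, i.e. the minimal sequence of point blow-ups after which the strict transforms of the branches of $\tau^{-1}(\Gamma)$ are smooth, pairwise disjoint and transverse to the exceptional divisor $E_\tau=\pi_\tau^{-1}(0)$ at points that are nonsingular in $E_\tau$. Virtual multiplicities. An irreducible component $D$ of $E_\tau$ is terminal if, after its creation, no point of $D$ is the center of a later blow-up of the sequence (equivalently, $D$ has self-intersection $-1$). The terminal virtual multiplicity $\mu_T(\Gamma)$ is the number of terminal irreducible components of $E_\tau$. The divisorial virtual multiplicity $\mu_D(\Gamma)$ is the number of irreducible components of $E_\tau$ meeting the strict transform of $\tau^{-1}(\Gamma)$. *)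

theory Defs
  imports
    "HOL-Analysis.Infinite_Sum"
    "HOL-Library.Extended_Nat"
    "HOL-Computational_Algebra.Computational_Algebra"
begin

unbundle Formal_Power_Series.fps_syntax

section \<open>Convergent power series in two variables\<close>

text \<open>
  A series in \<open>x, y\<close> is represented by a series in \<open>y\<close> with coefficients in the series in \<open>x\<close>:
  the coefficient of \<open>x^i * y^j\<close> in \<open>F\<close> is \<open>F $ j $ i\<close>.
\<close>

definition convergent2 :: "complex fps fps \<Rightarrow> bool" where
  "convergent2 F \<longleftrightarrow>
     (\<exists>r>0. (\<lambda>(i,j). F $ j $ i * of_real r ^ i * of_real r ^ j) abs_summable_on UNIV)"

definition wsum1 :: "real \<Rightarrow> nat \<Rightarrow> complex fps \<Rightarrow> real" where
  "wsum1 r m F = (\<Sum>i\<le>m. norm (F $ i) * r ^ i)"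

definition wsum :: "real \<Rightarrow> nat \<Rightarrow> complex fps fps \<Rightarrow> real" where
  "wsum r m F = (\<Sum>j\<le>m. wsum1 r m (F $ j) * r ^ j)"

lemma wsum_altdef: "wsum r m F = (\<Sum>(i,j)\<in>{..m}\<times>{..m}. norm (F $ j $ i) * r ^ i * r ^ j)"
  unfolding wsum_def wsum1_def sum_distrib_right
  by (subst sum.swap) (simp add: sum.cartesian_product)

lemma wsum1_nonneg: "r \<ge> 0 \<Longrightarrow> wsum1 r m F \<ge> 0"
  unfolding wsum1_def by (intro sum_nonneg) auto

lemma wsum_nonneg: "r \<ge> 0 \<Longrightarrow> wsum r m F \<ge> 0"
  unfolding wsum_def by (intro sum_nonneg mult_nonneg_nonneg wsum1_nonneg) auto

lemma convergent2_iff: "convergent2 F \<longleftrightarrow> (\<exists>r>0. \<exists>C. \<forall>m. wsum r m F \<le> C)"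
proof -
  have "((\<lambda>(i,j). F $ j $ i * of_real r ^ i * of_real r ^ j) abs_summable_on UNIV) \<longleftrightarrow>
          (\<exists>C. \<forall>m. wsum r m F \<le> C)" (is "?L \<longleftrightarrow> ?R") if "r > 0" for r :: real
  proof -
    define g where "g = (\<lambda>(i,j). F $ j $ i * of_real r ^ i * of_real r ^ j)"
    have ng: "norm (g p) = (case p of (i,j) \<Rightarrow> norm (F $ j $ i) * r ^ i * r ^ j)" for p
      using that by (simp add: g_def norm_mult norm_power split: prod.splits)
    have ws: "wsum r m F = (\<Sum>p\<in>{..m}\<times>{..m}. norm (g p))" for m
      by (simp add: wsum_altdef ng)
    show ?thesis unfolding g_def[symmetric] abs_summable_iff_bdd_above
    proof
      assume "bdd_above (sum (\<lambda>x. norm (g x)) ` {F. F \<subseteq> UNIV \<and> finite F})"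
      then obtain C where C: "\<And>G. finite G \<Longrightarrow> (\<Sum>p\<in>G. norm (g p)) \<le> C"
        by (auto simp: bdd_above_def)
      show ?R by (rule exI[of _ C]) (simp add: ws C)
    next
      assume ?R
      then obtain C where C: "\<And>m. wsum r m F \<le> C" by blast
      show "bdd_above (sum (\<lambda>x. norm (g x)) ` {F. F \<subseteq> UNIV \<and> finite F})"
      proof (rule bdd_aboveI2[where M = C])
        fix G :: "(nat \<times> nat) set"
        assume "G \<in> {F. F \<subseteq> UNIV \<and> finite F}"
        then have fin: "finite G" by simp
        obtain m1 where m1: "fst ` G \<subseteq> {..m1}"
          using finite_nat_iff_bounded_le[of "fst ` G"] fin by auto
        obtain m2 where m2: "snd ` G \<subseteq> {..m2}"
          using finite_nat_iff_bounded_le[of "snd ` G"] fin by auto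
        have "G \<subseteq> {..max m1 m2} \<times> {..max m1 m2}"
        proof
          fix p assume "p \<in> G"
          then have "fst p \<le> m1" "snd p \<le> m2" using m1 m2 by auto
          then show "p \<in> {..max m1 m2} \<times> {..max m1 m2}" by (cases p) auto
        qed
        then have "(\<Sum>p\<in>G. norm (g p)) \<le> (\<Sum>p\<in>{..max m1 m2}\<times>{..max m1 m2}. norm (g p))"
          by (intro sum_mono2) auto
        then show "(\<Sum>p\<in>G. norm (g p)) \<le> C"
          using C[of "max m1 m2"] by (simp add: ws)
      qed
    qed
  qed
  then show ?thesis unfolding convergent2_def by blast
qed

lemma convolution_le:
  fixes a b :: "nat \<Rightarrow> real"
  assumes "\<And>i. a i \<ge> 0" "\<And>i. b i \<ge> 0"
  shows "(\<Sum>j\<le>m. \<Sum>l\<le>j. a l * b (j - l)) \<le> (\<Sum>l\<le>m. a l) * (\<Sum>l\<le>m. b l)"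
proof -
  have "(\<Sum>j\<le>m. \<Sum>l\<le>j. a l * b (j - l)) = (\<Sum>(l,k)\<in>{(i,j). i + j \<le> m}. a l * b k)"
    by (rule sum.triangle_reindex_eq[symmetric])
  also have "\<dots> \<le> (\<Sum>(l,k)\<in>{..m}\<times>{..m}. a l * b k)"
    by (intro sum_mono2) (auto simp: assms)
  also have "\<dots> = (\<Sum>l\<le>m. a l) * (\<Sum>l\<le>m. b l)"
    by (simp add: sum_product sum.cartesian_product)
  finally show ?thesis .
qed

lemma wsum1_mult:
  assumes "r \<ge> 0"
  shows "wsum1 r m (F * G) \<le> wsum1 r m F * wsum1 r m G"
proof -
  have "wsum1 r m (F * G) \<le>
          (\<Sum>j\<le>m. \<Sum>l\<le>j. (norm (F $ l) * r ^ l) * (norm (G $ (j - l)) * r ^ (j - l)))"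
    unfolding wsum1_def
  proof (rule sum_mono)
    fix j
    have "norm ((F * G) $ j) \<le> (\<Sum>l\<le>j. norm (F $ l) * norm (G $ (j - l)))"
      unfolding fps_mult_nth atLeast0AtMost
      by (rule order_trans[OF norm_sum]) (simp add: norm_mult)
    then have "norm ((F * G) $ j) * r ^ j \<le> (\<Sum>l\<le>j. norm (F $ l) * norm (G $ (j - l))) * r ^ j"
      using assms by (intro mult_right_mono) auto
    also have "\<dots> = (\<Sum>l\<le>j. (norm (F $ l) * r ^ l) * (norm (G $ (j - l)) * r ^ (j - l)))"
      unfolding sum_distrib_right
    proof (rule sum.cong[OF refl])
      fix l assume "l \<in> {..j}"
      then have "r ^ j = r ^ l * r ^ (j - l)" by (simp add: power_add[symmetric])
      then show "norm (F $ l) * norm (G $ (j - l)) * r ^ j =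
          norm (F $ l) * r ^ l * (norm (G $ (j - l)) * r ^ (j - l))" by simp
    qed
    finally show "norm ((F * G) $ j) * r ^ j \<le>
      (\<Sum>l\<le>j. (norm (F $ l) * r ^ l) * (norm (G $ (j - l)) * r ^ (j - l)))" .
  qed
  also have "\<dots> \<le> wsum1 r m F * wsum1 r m G"
    unfolding wsum1_def using assms by (intro convolution_le) auto
  finally show ?thesis .
qed

lemma wsum1_add: "r \<ge> 0 \<Longrightarrow> wsum1 r m (F + G) \<le> wsum1 r m F + wsum1 r m G"
  unfolding wsum1_def sum.distrib[symmetric]
  by (intro sum_mono) (simp add: ring_distribs(2)[symmetric] mult_right_mono norm_triangle_ineq)

lemma wsum1_sum: "finite A \<Longrightarrow> r \<ge> 0 \<Longrightarrow> wsum1 r m (\<Sum>a\<in>A. F a) \<le> (\<Sum>a\<in>A. wsum1 r m (F a))"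
proof (induction A rule: finite_induct)
  case empty
  then show ?case by (simp add: wsum1_def)
next
  case (insert a A)
  then show ?case using wsum1_add[of r m "F a" "\<Sum>a\<in>A. F a"] by simp
qed

lemma wsum_add: "r \<ge> 0 \<Longrightarrow> wsum r m (F + G) \<le> wsum r m F + wsum r m G"
  unfolding wsum_def sum.distrib[symmetric]
  by (intro sum_mono) (simp add: ring_distribs(2)[symmetric] mult_right_mono wsum1_add)

lemma wsum_uminus [simp]: "wsum r m (- F) = wsum r m F"
  by (simp add: wsum_def wsum1_def)

lemma wsum_mult:
  assumes "r \<ge> 0"
  shows "wsum r m (F * G) \<le> wsum r m F * wsum r m G"
proof -
  have "wsum r m (F * G) \<le>
          (\<Sum>j\<le>m. \<Sum>l\<le>j. (wsum1 r m (F $ l) * r ^ l) * (wsum1 r m (G $ (j - l)) * r ^ (j - l)))"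
    unfolding wsum_def
  proof (rule sum_mono)
    fix j
    have "wsum1 r m ((F * G) $ j) \<le> (\<Sum>l\<le>j. wsum1 r m (F $ l) * wsum1 r m (G $ (j - l)))"
      unfolding fps_mult_nth atLeast0AtMost
      by (rule order_trans[OF wsum1_sum]) (auto intro!: sum_mono wsum1_mult assms)
    then have "wsum1 r m ((F * G) $ j) * r ^ j \<le>
        (\<Sum>l\<le>j. wsum1 r m (F $ l) * wsum1 r m (G $ (j - l))) * r ^ j"
      using assms by (intro mult_right_mono) auto
    also have "\<dots> = (\<Sum>l\<le>j. (wsum1 r m (F $ l) * r ^ l) * (wsum1 r m (G $ (j - l)) * r ^ (j - l)))"
      unfolding sum_distrib_right
    proof (rule sum.cong[OF refl])
      fix l assume "l \<in> {..j}"
      then have "r ^ j = r ^ l * r ^ (j - l)" by (simp add: power_add[symmetric])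
      then show "wsum1 r m (F $ l) * wsum1 r m (G $ (j - l)) * r ^ j =
          wsum1 r m (F $ l) * r ^ l * (wsum1 r m (G $ (j - l)) * r ^ (j - l))" by simp
    qed
    finally show "wsum1 r m ((F * G) $ j) * r ^ j \<le>
      (\<Sum>l\<le>j. (wsum1 r m (F $ l) * r ^ l) * (wsum1 r m (G $ (j - l)) * r ^ (j - l)))" .
  qed
  also have "\<dots> \<le> wsum r m F * wsum r m G"
    unfolding wsum_def using assms
    by (intro convolution_le mult_nonneg_nonneg wsum1_nonneg) auto
  finally show ?thesis .
qed

lemma wsum_radius_mono: "0 \<le> s \<Longrightarrow> s \<le> r \<Longrightarrow> wsum s m F \<le> wsum r m F"
  unfolding wsum_altdef
  by (intro sum_mono) (auto intro!: mult_mono power_mono)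

lemma wsum_mono_m: "0 \<le> r \<Longrightarrow> m \<le> k \<Longrightarrow> wsum r m F \<le> wsum r k F"
  unfolding wsum_altdef by (intro sum_mono2) auto

lemma convergent2_add: "convergent2 F \<Longrightarrow> convergent2 G \<Longrightarrow> convergent2 (F + G)"
proof -
  assume "convergent2 F" "convergent2 G"
  then obtain r s C D where *: "r > 0" "s > 0" "\<And>m. wsum r m F \<le> C" "\<And>m. wsum s m G \<le> D"
    unfolding convergent2_iff by blast
  have "wsum (min r s) m (F + G) \<le> C + D" for m
    using wsum_add[of "min r s" m F G] *(1,2) *(3)[of m] *(4)[of m]
      wsum_radius_mono[of "min r s" r m F] wsum_radius_mono[of "min r s" s m G] by simp
  then show ?thesis unfolding convergent2_iff using *(1,2)
    by (intro exI[of _ "min r s"]) auto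
qed

lemma convergent2_uminus: "convergent2 F \<Longrightarrow> convergent2 (- F)"
  by (simp add: convergent2_iff)

lemma convergent2_mult: "convergent2 F \<Longrightarrow> convergent2 G \<Longrightarrow> convergent2 (F * G)"
proof -
  assume "convergent2 F" "convergent2 G"
  then obtain r s C D where *: "r > 0" "s > 0" "\<And>m. wsum r m F \<le> C" "\<And>m. wsum s m G \<le> D"
    unfolding convergent2_iff by blast
  define t where "t = min r s"
  have t: "t > 0" "t \<le> r" "t \<le> s" using * by (auto simp: t_def)
  have "wsum t m (F * G) \<le> C * D" for m
  proof -
    have a: "wsum t m F \<le> C" "wsum t m G \<le> D" "0 \<le> wsum t m F" "0 \<le> wsum t m G"
      using t *(3)[of m] *(4)[of m] wsum_radius_mono[of t r m F] wsum_radius_mono[of t s m G]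
      by (auto simp: wsum_nonneg)
    have "wsum t m (F * G) \<le> wsum t m F * wsum t m G" using t by (intro wsum_mult) simp
    also have "\<dots> \<le> C * D" using a by (intro mult_mono) auto
    finally show ?thesis .
  qed
  then show ?thesis unfolding convergent2_iff using t by blast
qed

lemma convergent2_finite:
  assumes "\<And>i j. i > N \<or> j > N \<Longrightarrow> F $ j $ i = 0"
  shows "convergent2 F"
proof -
  have z: "i \<le> N" "j \<le> N" if "F $ j $ i \<noteq> 0" for i j
    using assms that by (meson not_le)+
  have "wsum 1 m F \<le> wsum 1 N F" for m
  proof -
    have "wsum 1 m F \<le> wsum 1 (max m N) F" by (intro wsum_mono_m) auto
    also have "\<dots> = wsum 1 N F" unfolding wsum_altdef
      by (rule sum.mono_neutral_right) (auto dest: z)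
    finally show ?thesis .
  qed
  then show ?thesis unfolding convergent2_iff by (intro exI[of _ 1]) auto
qed

text \<open>The ring \<open>\<complex>{x,y}\<close> of germs at the origin of holomorphic functions of two variables.\<close>

typedef germ = "{F. convergent2 F}"
  by (rule exI[of _ 0]) (auto intro: convergent2_finite[of 0])

setup_lifting type_definition_germ

instantiation germ :: comm_ring_1
begin
lift_definition zero_germ :: germ is 0 by (rule convergent2_finite[of 0]) simp
lift_definition one_germ :: germ is 1
  by (rule convergent2_finite[of 0]) (auto simp: fps_one_nth)
lift_definition plus_germ :: "germ \<Rightarrow> germ \<Rightarrow> germ" is "(+)" by (rule convergent2_add)
lift_definition uminus_germ :: "germ \<Rightarrow> germ" is "uminus" by (rule convergent2_uminus)
lift_definition minus_germ :: "germ \<Rightarrow> germ \<Rightarrow> germ" is "(-)"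
  using convergent2_add[OF _ convergent2_uminus] by simp
lift_definition times_germ :: "germ \<Rightarrow> germ \<Rightarrow> germ" is "(*)" by (rule convergent2_mult)
instance by standard (transfer; simp add: algebra_simps)+
end

instance germ :: idom
  by standard (transfer; simp)

text \<open>Division is only meaningful, and only used, when it is exact.\<close>

instantiation germ :: semidom_divide
begin
definition divide_germ :: "germ \<Rightarrow> germ \<Rightarrow> germ" where
  "divide_germ f g = (if g = 0 then 0 else SOME h. f = h * g)"
instance
proof
  fix a b :: germ
  assume "b \<noteq> 0"
  moreover from this have "(SOME h. a * b = h * b) = a"
    by (intro some_equality) auto
  ultimately show "a * b div b = a" by (simp add: divide_germ_def)
qed (simp add: divide_germ_def)
end

instance germ :: algebraic_semidom ..

lift_definition gcoeff :: "germ \<Rightarrow> nat \<Rightarrow> nat \<Rightarrow> complex" is "\<lambda>F i j. F $ j $ i" .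

definition geval :: "germ \<Rightarrow> complex \<Rightarrow> complex \<Rightarrow> complex" where
  "geval f x y = (\<Sum>\<^sub>\<infinity>(i,j). gcoeff f i j * x ^ i * y ^ j)"

lift_definition gconst :: "complex \<Rightarrow> germ" is "\<lambda>c. fps_const (fps_const c)"
  by (rule convergent2_finite[of 0]) auto

lift_definition gX :: germ is "fps_const fps_X"
  by (rule convergent2_finite[of 1]) (auto simp: fps_X_def)

lift_definition gY :: germ is "fps_X"
  by (rule convergent2_finite[of 1]) (auto simp: fps_X_def)

lemma convergent2_deriv_bound:
  assumes "convergent2 F"
    and "\<And>i j. norm (G $ j $ i) \<le> real (Suc i) * real (Suc j) * norm (F $ (j + b) $ (i + a))"
    and "a \<le> 1" "b \<le> 1"
  shows "convergent2 G"
proof -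
  obtain r C where r: "r > 0" and C: "\<And>m. wsum r m F \<le> C"
    using assms(1) unfolding convergent2_iff by blast
  define s where "s = r / 2"
  have s: "s > 0" "r = 2 * s" using r by (auto simp: s_def)
  have pow: "real (Suc i) \<le> 2 ^ i" for i
  proof -
    have "Suc i \<le> 2 ^ i" by (rule Suc_leI[OF less_exp])
    then have "real (Suc i) \<le> real (2 ^ i)" by (rule of_nat_mono)
    then show ?thesis by simp
  qed
  have "wsum s m G \<le> C / (r ^ a * r ^ b)" for m
  proof -
    have "wsum s m G * (r ^ a * r ^ b) =
        (\<Sum>(i,j)\<in>{..m}\<times>{..m}. norm (G $ j $ i) * s ^ i * s ^ j * (r ^ a * r ^ b))"
      unfolding wsum_altdef sum_distrib_right by (simp add: case_prod_unfold)
    also have "\<dots> \<le> (\<Sum>(i,j)\<in>{..m}\<times>{..m}. norm (F $ (j+b) $ (i+a)) * r ^ (i+a) * r ^ (j+b))"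
    proof (intro sum_mono, clarify)
      fix i j
      have "norm (G $ j $ i) \<le> 2 ^ i * 2 ^ j * norm (F $ (j + b) $ (i + a))"
        by (rule order_trans[OF assms(2)], intro mult_right_mono mult_mono pow) auto
      then have "norm (G $ j $ i) * (s ^ i * s ^ j * (r ^ a * r ^ b)) \<le>
          (2 ^ i * 2 ^ j * norm (F $ (j + b) $ (i + a))) * (s ^ i * s ^ j * (r ^ a * r ^ b))"
        using r s by (intro mult_right_mono) auto
      also have "\<dots> = norm (F $ (j+b) $ (i+a)) * r ^ (i+a) * r ^ (j+b)"
        by (simp add: s(2) power_add power_mult_distrib)
      finally show "norm (G $ j $ i) * s ^ i * s ^ j * (r ^ a * r ^ b) \<le>
          norm (F $ (j+b) $ (i+a)) * r ^ (i+a) * r ^ (j+b)" by (simp add: mult.assoc)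
    qed
    also have "\<dots> = (\<Sum>(i,j)\<in>(\<lambda>(i,j). (i+a,j+b)) ` ({..m}\<times>{..m}). norm (F $ j $ i) * r ^ i * r ^ j)"
      by (subst sum.reindex) (auto simp: inj_on_def case_prod_unfold)
    also have "\<dots> \<le> wsum r (Suc m) F"
      unfolding wsum_altdef using assms(3,4) r by (intro sum_mono2) auto
    also have "\<dots> \<le> C" by (rule C)
    finally show ?thesis using r by (simp add: pos_le_divide_eq)
  qed
  then show ?thesis unfolding convergent2_iff using s by blast
qed

lift_definition dX :: "germ \<Rightarrow> germ" is "\<lambda>F. Abs_fps (\<lambda>j. fps_deriv (F $ j))"
proof (rule convergent2_deriv_bound[where a = 1 and b = 0], assumption)
  fix F :: "complex fps fps" and i j
  have "norm (Abs_fps (\<lambda>j. fps_deriv (F $ j)) $ j $ i) = real (Suc i) * 1 * norm (F $ j $ Suc i)"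
    by (simp add: norm_mult del: of_nat_Suc)
  also have "\<dots> \<le> real (Suc i) * real (Suc j) * norm (F $ (j + 0) $ (i + 1))"
    unfolding add_0_right Suc_eq_plus1[symmetric] by (intro mult_right_mono mult_left_mono) auto
  finally show "norm (Abs_fps (\<lambda>j. fps_deriv (F $ j)) $ j $ i) \<le>
    real (Suc i) * real (Suc j) * norm (F $ (j + 0) $ (i + 1))" .
qed auto

lift_definition dY :: "germ \<Rightarrow> germ" is fps_deriv
proof (rule convergent2_deriv_bound[where a = 0 and b = 1], assumption)
  fix F :: "complex fps fps" and i j
  have "fps_deriv F $ j $ i = of_nat (Suc j) * F $ Suc j $ i"
    by (simp add: fps_of_nat[symmetric] del: of_nat_Suc)
  then have "norm (fps_deriv F $ j $ i) = 1 * real (Suc j) * norm (F $ Suc j $ i)"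
    by (simp add: norm_mult del: of_nat_Suc)
  also have "\<dots> \<le> real (Suc i) * real (Suc j) * norm (F $ (j + 1) $ (i + 0))"
    unfolding add_0_right Suc_eq_plus1[symmetric] by (intro mult_right_mono) auto
  finally show "norm (fps_deriv F $ j $ i) \<le> real (Suc i) * real (Suc j) * norm (F $ (j + 1) $ (i + 0))" .
qed auto

text \<open>
  The composite \<open>F(G(x,y), H(x,y))\<close>. As \<open>G\<close> and \<open>H\<close> vanish at the origin, \<open>G^k * H^l\<close> only
  contributes to the coefficient of \<open>x^i * y^j\<close> when \<open>k + l \<le> i + j\<close>, so the sums below are the
  full ones. Composition is only used with \<open>G(0,0) = H(0,0) = 0\<close>; elsewhere it is set to \<open>0\<close>.
\<close>

definition fps_subst2 :: "complex fps fps \<Rightarrow> complex fps fps \<Rightarrow> complex fps fps \<Rightarrow> complex fps fps" where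
  "fps_subst2 F G H =
     (if G $ 0 $ 0 = 0 \<and> H $ 0 $ 0 = 0
      then Abs_fps (\<lambda>j. Abs_fps (\<lambda>i. \<Sum>k\<le>i+j. \<Sum>l\<le>i+j. F $ l $ k * (G ^ k * H ^ l) $ j $ i))
      else 0)"

lemma wsum_one: "wsum r m 1 = 1"
proof -
  have "wsum r m 1 = (\<Sum>p\<in>{(0,0)}. case p of (i,j) \<Rightarrow> norm ((1::complex fps fps) $ j $ i) * r ^ i * r ^ j)"
    unfolding wsum_altdef by (rule sum.mono_neutral_right) (auto simp: fps_one_nth split: if_splits)
  then show ?thesis by simp
qed

lemma wsum_power: "r \<ge> 0 \<Longrightarrow> wsum r m (G ^ k) \<le> wsum r m G ^ k"
proof (induction k)
  case 0
  then show ?case by (simp add: wsum_one)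
next
  case (Suc k)
  have "wsum r m (G ^ Suc k) \<le> wsum r m G * wsum r m (G ^ k)"
    using wsum_mult[of r m G "G ^ k"] Suc.prems by simp
  also have "\<dots> \<le> wsum r m G * wsum r m G ^ k"
    using Suc by (intro mult_left_mono wsum_nonneg) auto
  finally show ?case by simp
qed

lemma wsum_shrink:
  assumes "G $ 0 $ 0 = 0" "0 \<le> s" "s \<le> 1" "0 \<le> r"
  shows "wsum (s * r) m G \<le> s * wsum r m G"
  unfolding wsum_altdef sum_distrib_left
proof (intro sum_mono, clarify)
  fix i j
  show "norm (G $ j $ i) * (s * r) ^ i * (s * r) ^ j \<le> s * (norm (G $ j $ i) * r ^ i * r ^ j)"
  proof (cases "i + j = 0")
    case True
    then show ?thesis using assms by simp
  next
    case False
    have "s ^ (i + j) \<le> s ^ 1" using assms False by (intro power_decreasing) auto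
    then have "s ^ (i + j) * (norm (G $ j $ i) * r ^ i * r ^ j) \<le> s * (norm (G $ j $ i) * r ^ i * r ^ j)"
      using assms by (intro mult_right_mono) auto
    then show ?thesis by (simp add: power_mult_distrib power_add mult_ac)
  qed
qed

lemma convergent2_subst2:
  assumes "convergent2 F" "convergent2 G" "convergent2 H"
  shows "convergent2 (fps_subst2 F G H)"
proof (cases "G $ 0 $ 0 = 0 \<and> H $ 0 $ 0 = 0")
  case False
  then have "fps_subst2 F G H = 0" by (auto simp: fps_subst2_def)
  then show ?thesis by (auto intro!: convergent2_finite[of 0])
next
  case True
  obtain R C where R: "R > 0" and C: "\<And>m. wsum R m F \<le> C"
    using assms(1) unfolding convergent2_iff by blast
  obtain rg Cg where rg: "rg > 0" and Cg: "\<And>m. wsum rg m G \<le> Cg"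
    using assms(2) unfolding convergent2_iff by blast
  obtain rh Ch where rh: "rh > 0" and Ch: "\<And>m. wsum rh m H \<le> Ch"
    using assms(3) unfolding convergent2_iff by blast
  define r where "r = min rg rh"
  define B where "B = 1 + max Cg Ch"
  define s where "s = min 1 (R / B)"
  have r: "r > 0" "r \<le> rg" "r \<le> rh" using rg rh by (auto simp: r_def)
  have "Cg \<ge> 0" using Cg[of 0] wsum_nonneg[of rg 0 G] rg by simp
  then have B: "B > 0" by (simp add: B_def)
  have s: "s > 0" "s \<le> 1" "s * B \<le> R"
    using B R by (auto simp: s_def min_def field_simps)
  define t where "t = s * r"
  have t: "t > 0" using s r by (simp add: t_def)
  have G: "wsum t m G \<le> R" for m
  proof -
    have "wsum t m G \<le> s * wsum r m G"
      unfolding t_def using True s r by (intro wsum_shrink) auto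
    also have "\<dots> \<le> s * B"
      using wsum_radius_mono[of r rg m G] Cg[of m] r s by (intro mult_left_mono) (auto simp: B_def)
    finally show ?thesis using s by simp
  qed
  have H: "wsum t m H \<le> R" for m
  proof -
    have "wsum t m H \<le> s * wsum r m H"
      unfolding t_def using True s r by (intro wsum_shrink) auto
    also have "\<dots> \<le> s * B"
      using wsum_radius_mono[of r rh m H] Ch[of m] r s by (intro mult_left_mono) (auto simp: B_def)
    finally show ?thesis using s by simp
  qed
  have GH: "wsum t m (G ^ k * H ^ l) \<le> R ^ k * R ^ l" for m k l
  proof -
    have "wsum t m (G ^ k * H ^ l) \<le> wsum t m (G ^ k) * wsum t m (H ^ l)"
      using t by (intro wsum_mult) simp
    also have "\<dots> \<le> wsum t m G ^ k * wsum t m H ^ l"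
      using t by (intro mult_mono wsum_power wsum_nonneg zero_le_power) auto
    also have "\<dots> \<le> R ^ k * R ^ l"
      using t R by (intro mult_mono power_mono G H wsum_nonneg zero_le_power) auto
    finally show ?thesis .
  qed
  have "wsum t m (fps_subst2 F G H) \<le> C" for m
  proof -
    define c where "c = (\<lambda>k l i j. norm (F $ l $ k) * (norm ((G ^ k * H ^ l) $ j $ i) * t ^ i * t ^ j))"
    have c0: "c k l i j \<ge> 0" for k l i j using t by (simp add: c_def)
    have "wsum t m (fps_subst2 F G H) \<le>
        (\<Sum>(i,j)\<in>{..m}\<times>{..m}. \<Sum>k\<le>2*m. \<Sum>l\<le>2*m. c k l i j)"
      unfolding wsum_altdef
    proof (intro sum_mono, clarify)
      fix i j assume ij: "i \<le> m" "j \<le> m"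
      have "norm (fps_subst2 F G H $ j $ i) \<le>
          (\<Sum>k\<le>i+j. \<Sum>l\<le>i+j. norm (F $ l $ k) * norm ((G ^ k * H ^ l) $ j $ i))"
        using True
        by (auto simp: fps_subst2_def norm_mult[symmetric] intro!: order_trans[OF norm_sum] sum_mono)
      then have "norm (fps_subst2 F G H $ j $ i) * (t ^ i * t ^ j) \<le>
          (\<Sum>k\<le>i+j. \<Sum>l\<le>i+j. norm (F $ l $ k) * norm ((G ^ k * H ^ l) $ j $ i)) * (t ^ i * t ^ j)"
        using t by (intro mult_right_mono) auto
      also have "\<dots> = (\<Sum>k\<le>i+j. \<Sum>l\<le>i+j. c k l i j)"
        unfolding sum_distrib_right c_def by (simp only: mult.assoc)
      also have "\<dots> \<le> (\<Sum>k\<le>i+j. \<Sum>l\<le>2*m. c k l i j)"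
        using ij by (intro sum_mono sum_mono2) (auto simp: c0)
      also have "\<dots> \<le> (\<Sum>k\<le>2*m. \<Sum>l\<le>2*m. c k l i j)"
        using ij by (intro sum_mono2) (auto simp: c0 intro!: sum_nonneg)
      finally show "norm (fps_subst2 F G H $ j $ i) * t ^ i * t ^ j \<le>
          (\<Sum>k\<le>2*m. \<Sum>l\<le>2*m. c k l i j)" by (simp add: mult.assoc)
    qed
    also have "\<dots> = (\<Sum>k\<le>2*m. \<Sum>p\<in>{..m}\<times>{..m}. \<Sum>l\<le>2*m. case p of (i,j) \<Rightarrow> c k l i j)"
      by (subst sum.swap) (simp add: case_prod_unfold)
    also have "\<dots> = (\<Sum>k\<le>2*m. \<Sum>l\<le>2*m. \<Sum>p\<in>{..m}\<times>{..m}. case p of (i,j) \<Rightarrow> c k l i j)"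
      by (intro sum.cong refl, subst sum.swap) simp
    also have "\<dots> = (\<Sum>k\<le>2*m. \<Sum>l\<le>2*m. norm (F $ l $ k) * wsum t m (G ^ k * H ^ l))"
      by (simp add: wsum_altdef c_def sum_distrib_left case_prod_unfold)
    also have "\<dots> \<le> (\<Sum>k\<le>2*m. \<Sum>l\<le>2*m. norm (F $ l $ k) * (R ^ k * R ^ l))"
      by (intro sum_mono mult_left_mono GH) auto
    also have "\<dots> = wsum R (2*m) F"
      by (simp add: wsum_altdef sum.cartesian_product mult.assoc)
    also have "\<dots> \<le> C" by (rule C)
    finally show ?thesis .
  qed
  then show ?thesis unfolding convergent2_iff using t by blast
qed

lift_definition gsubst :: "germ \<Rightarrow> germ \<Rightarrow> germ \<Rightarrow> germ" is fps_subst2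
  by (rule convergent2_subst2)

definition gorder :: "germ \<Rightarrow> enat" where
  "gorder f = (INF (i,j)\<in>{(i,j). gcoeff f i j \<noteq> 0}. enat (i + j))"

text \<open>The order as a natural number, for \<open>f \<noteq> 0\<close>.\<close>

definition gmult :: "germ \<Rightarrow> nat" where
  "gmult f = the_enat (gorder f)"

definition vanishes :: "germ \<Rightarrow> bool" where
  "vanishes f \<longleftrightarrow> gcoeff f 0 0 = 0"

definition homog_part :: "nat \<Rightarrow> germ \<Rightarrow> complex \<Rightarrow> complex \<Rightarrow> complex" where
  "homog_part k f x y = (\<Sum>i\<le>k. gcoeff f i (k - i) * x ^ i * y ^ (k - i))"

definition jacobian :: "germ \<Rightarrow> germ \<Rightarrow> germ" where
  "jacobian f g = dX f * dY g - dY f * dX g"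

section \<open>Germs of foliations and of curves\<close>

text \<open>The pair \<open>(a, b)\<close> is the vector field \<open>a(x,y) \<partial>/\<partial>x + b(x,y) \<partial>/\<partial>y\<close>.\<close>

type_synonym vfield = "germ \<times> germ"

definition defines_foliation :: "vfield \<Rightarrow> bool" where
  "defines_foliation V \<longleftrightarrow>
     (\<exists>\<epsilon>>0. \<forall>x y. norm x < \<epsilon> \<and> norm y < \<epsilon> \<and> geval (fst V) x y = 0 \<and> geval (snd V) x y = 0
        \<longrightarrow> x = 0 \<and> y = 0)"

definition fol_mult :: "vfield \<Rightarrow> nat" where
  "fol_mult V = the_enat (min (gorder (fst V)) (gorder (snd V)))"

text \<open>A germ of curve is given by a reduced equation \<open>f\<close>; its irreducible components are given by
  the irreducible factors of \<open>f\<close>, which matter up to units only.\<close>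

definition curve_equation :: "germ \<Rightarrow> bool" where
  "curve_equation f \<longleftrightarrow> squarefree f \<and> vanishes f"

definition component :: "germ \<Rightarrow> germ \<Rightarrow> bool" where
  "component g f \<longleftrightarrow> irreducible g \<and> g dvd f"

definition invariant_curve :: "vfield \<Rightarrow> germ \<Rightarrow> bool" where
  "invariant_curve V f \<longleftrightarrow> f dvd fst V * dX f + snd V * dY f"

definition tangent_cone :: "germ \<Rightarrow> (complex \<times> complex) set" where
  "tangent_cone f = {(x,y). homog_part (gmult f) f x y = 0}"

definition fol_tangent_cone :: "vfield \<Rightarrow> (complex \<times> complex) set" where
  "fol_tangent_cone V =
     {(x,y). x * homog_part (fol_mult V) (snd V) x y - y * homog_part (fol_mult V) (fst V) x y = 0}"

text \<open>
  Pull-back under the map \<open>\<phi> = (p, q)\<close>, before saturation: the foliation of \<open>(a, b)\<close> is also given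
  by the form \<open>a dy - b dx\<close>, and the pull-back of this form under \<open>\<phi>\<close> is \<open>a' dy - b' dx\<close> for the
  field \<open>(a', b')\<close> below.
\<close>

definition pullback_field :: "germ \<times> germ \<Rightarrow> vfield \<Rightarrow> vfield" where
  "pullback_field \<phi> V =
     (let (p, q) = \<phi>; a = gsubst (fst V) p q; b = gsubst (snd V) p q
      in (a * dY q - b * dY p, b * dX p - a * dX q))"

definition saturate :: "vfield \<Rightarrow> vfield" where
  "saturate V =
     (SOME W. coprime (fst W) (snd W) \<and> (\<exists>h. h \<noteq> 0 \<and> fst V = h * fst W \<and> snd V = h * snd W))"

section \<open>Blow-ups and infinitely near points\<close>

text \<open>
  The points of the exceptional divisor of the blow-up of a point are the lines through this
  point: \<open>Slope c\<close> is the line \<open>y = c * x\<close> and \<open>Vertical\<close> is the line \<open>x = 0\<close>. The blow-up is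
  written as follows in coordinates centered at such a point, the divisor being \<open>exc_eq d = 0\<close>.
\<close>

datatype direction = Slope complex | Vertical

fun blowup_chart :: "direction \<Rightarrow> germ \<times> germ" where
  "blowup_chart (Slope c) = (gX, gX * (gY + gconst c))"
| "blowup_chart Vertical = (gX * gY, gY)"

fun exc_eq :: "direction \<Rightarrow> germ" where
  "exc_eq (Slope c) = gX"
| "exc_eq Vertical = gY"

definition strict_transform :: "direction \<Rightarrow> germ \<Rightarrow> germ" where
  "strict_transform d f =
     gsubst f (fst (blowup_chart d)) (snd (blowup_chart d)) div exc_eq d ^ gmult f"

definition fol_transform :: "direction \<Rightarrow> vfield \<Rightarrow> vfield" where
  "fol_transform d V = saturate (pullback_field (blowup_chart d) V)"

definition dicritical1 :: "vfield \<Rightarrow> bool" where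
  "dicritical1 V \<longleftrightarrow> \<not> (\<forall>d. invariant_curve (fol_transform d V) (exc_eq d))"

definition regular :: "vfield \<Rightarrow> bool" where
  "regular V \<longleftrightarrow> \<not> (vanishes (fst V) \<and> vanishes (snd V))"

text \<open>
  A point infinitely near to the origin is given by the list of the successive directions leading
  to it: \<open>[]\<close> is the origin, and \<open>p @ [d]\<close> is the point \<open>d\<close> of the divisor of the blow-up of \<open>p\<close>.
\<close>

type_synonym near_point = "direction list"

definition strict_at :: "near_point \<Rightarrow> germ \<Rightarrow> germ" where
  "strict_at p f = fold strict_transform p f"

text \<open>The points over the origin of the surface obtained by blowing up the points of \<open>C\<close>.\<close>

definition points_over :: "near_point set \<Rightarrow> near_point set" where
  "points_over C = {p. p \<notin> C \<and> (p = [] \<or> butlast p \<in> C)}"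

definition blowup_seq :: "near_point list \<Rightarrow> bool" where
  "blowup_seq cs \<longleftrightarrow> (\<forall>i<length cs. cs ! i \<in> points_over (set (take i cs)))"

text \<open>
  For a point \<open>p\<close> over the origin, \<open>e\<close> is a local equation at \<open>p\<close> of (the strict transform of)
  the component of the exceptional divisor created by the blow-up of \<open>q\<close>, which contains \<open>p\<close>.
\<close>

definition divisor_at :: "near_point \<Rightarrow> near_point \<Rightarrow> germ \<Rightarrow> bool" where
  "divisor_at q p e \<longleftrightarrow> (\<exists>d r. p = q @ d # r \<and> e = strict_at r (exc_eq d) \<and> vanishes e)"

definition on_divisor :: "near_point \<Rightarrow> near_point \<Rightarrow> bool" where
  "on_divisor q p \<longleftrightarrow> (\<exists>e. divisor_at q p e)"

definition desingularizes :: "near_point list \<Rightarrow> germ \<Rightarrow> bool" where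
  "desingularizes cs f \<longleftrightarrow>
     (\<forall>p \<in> points_over (set cs). \<forall>g. component g f \<and> vanishes (strict_at p g) \<longrightarrow>
        gmult (strict_at p g) = 1 \<and>
        (\<forall>g'. component g' f \<and> vanishes (strict_at p g') \<longrightarrow> g' dvd g) \<and>
        (\<exists>!q. q \<in> set cs \<and> on_divisor q p) \<and>
        (\<forall>q \<in> set cs. \<forall>e. divisor_at q p e \<longrightarrow> \<not> vanishes (jacobian e (strict_at p g))))"

definition minimal_desing :: "near_point list \<Rightarrow> germ \<Rightarrow> bool" where
  "minimal_desing cs f \<longleftrightarrow>
     blowup_seq cs \<and> desingularizes cs f \<and>
     (\<forall>cs'. blowup_seq cs' \<and> desingularizes cs' f \<longrightarrow> length cs \<le> length cs')"

text \<open>Two minimal sequences only differ by the order of the blow-ups.\<close>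

definition desing_centers :: "germ \<Rightarrow> near_point list" where
  "desing_centers f = (SOME cs. minimal_desing cs f)"

section \<open>Ramification and virtual multiplicities\<close>

definition coordinate_change :: "germ \<times> germ \<Rightarrow> bool" where
  "coordinate_change \<phi> \<longleftrightarrow>
     vanishes (fst \<phi>) \<and> vanishes (snd \<phi>) \<and> \<not> vanishes (jacobian (fst \<phi>) (snd \<phi>))"

text \<open>The conditions on the coordinates in which the foliation is given by \<open>V\<close> and the curve
  by \<open>f\<close>.\<close>

definition adapted_coordinates :: "vfield \<Rightarrow> germ \<Rightarrow> bool" where
  "adapted_coordinates V f \<longleftrightarrow>
     (if \<not> dicritical1 V
      then \<not> {(x,y). x = 0} \<subseteq> fol_tangent_cone V
      else (\<forall>g. component g f \<longrightarrow> tangent_cone g \<noteq> {(x,y). x = 0}) \<and>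
           invariant_curve V gX \<and>
           regular (fol_transform Vertical V))"

definition ramification_index :: "germ \<Rightarrow> nat" where
  "ramification_index f = Lcm {gmult g | g. component g f}"

definition ramified_curve :: "germ \<Rightarrow> germ" where
  "ramified_curve f = gsubst f (gX ^ ramification_index f) gY"

definition terminal :: "near_point list \<Rightarrow> nat \<Rightarrow> bool" where
  "terminal cs i \<longleftrightarrow> (\<forall>j. i < j \<and> j < length cs \<longrightarrow> \<not> on_divisor (cs ! i) (cs ! j))"

text \<open>The virtual multiplicities of the curve given by \<open>f\<close> in adapted coordinates.\<close>

definition mu_T :: "germ \<Rightarrow> nat" where
  "mu_T f = (let cs = desing_centers (ramified_curve f)
             in card {i. i < length cs \<and> terminal cs i})"

definition mu_D :: "germ \<Rightarrow> nat" where
  "mu_D f = (let F = ramified_curve f; cs = desing_centers F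
             in card {i. i < length cs \<and>
                  (\<exists>p \<in> points_over (set cs). on_divisor (cs ! i) p \<and> vanishes (strict_at p F))})"

end

theory Submission
  imports Defs "HOL-Computational_Algebra.Field_as_Ring"
begin

text \<open>
  After the ramification \<open>x = t^n\<close> the curve is a union of graphs \<open>y = s(t)\<close>, with
  \<open>s\<close> divisible by \<open>t^n\<close> because the coordinates are adapted. The infinitely near points of such a
  graph are given by the coefficients of \<open>s\<close>, and a point other than the origin is blown up in the minimal
  desingularization exactly when two of the graphs pass through it. The two virtual multiplicities
  are thus numbers of vertices of the finite tree of common beginnings of the series \<open>s\<close>:
  those without successor for \<open>\<mu>\<^sub>T\<close>, and those at which some series leaves the tree for
  \<open>\<mu>\<^sub>D\<close> (\<open>virtual_multiplicities_nodes\<close>).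

  Invariance of the curve means that each \<open>z = s / t^n\<close> solves a differential equation
  \<open>t A(t,z) z' = R(t,z)\<close>, where \<open>A\<close> and \<open>R\<close> are series in \<open>t\<close> with polynomial coefficients
  in \<open>z\<close> (\<open>ramified_solution\<close>). The substitution \<open>z = c + t z\<close>, which is the blow-up of the point \<open>c\<close>,
  leads to an equation of the same kind (\<open>solution_child\<close>). The coordinate \<open>z\<close> is a coordinate on the
  component of the divisor, and the lowest coefficients of \<open>A\<close> and \<open>R\<close> in \<open>t\<close> are polynomials on it.
  If \<open>R\<close> has the larger order the component is not invariant. Otherwise all graphs
  meet it at zeros of the lowest coefficient of \<open>R\<close> (\<open>solution_zero\<close>).

  Let \<open>q\<close> be the number of vertices of the second kind, or twice the number of those of
  the first kind, in the part of the tree over a component. The heart of the proof is a bound for \<open>q\<close>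
  in terms of the degrees of the two lowest coefficients (\<open>state_bound\<close>, \<open>tree_bound\<close>), by
  induction from the leaves of the tree to its root. Two facts make the induction work. At a point \<open>c\<close>,
  the bound after the blow-up can be expressed by the orders of the zero \<open>c\<close> of the two polynomials
  (\<open>state_bound_child\<close>), and over all \<open>c\<close> these orders add up to at most the degrees. An excess can only come from
  points where the linear part of the equation has a positive eigenvalue ratio, the only ones over which a component
  that is not invariant arises without loss. By the residue theorem, which plays the part of the
  Camacho-Sad formula, all the points to be counted can be of this type only if the leading coefficients of \<open>R\<close>
  and \<open>A\<close> have a positive ratio (\<open>positive_residues\<close>, \<open>count_regular\<close>), and then the component itself lies over such
  a point of the previous one, unless degrees have dropped, which leaves room in the bound.

  On the first component, adapted coordinates exclude a positive ratio when the foliation is not dicritical: there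
  \<open>A\<close> has degree \<open>\<nu>\<close> and \<open>R = - n z A + \<dots>\<close>, so that \<open>q \<le> 2 \<nu>\<close>. In the dicritical case \<open>R\<close> vanishes on
  it, \<open>A\<close> has degree at most \<open>\<nu> - 1\<close>, and \<open>q \<le> 2 (\<nu> - 1) + 2\<close> (\<open>tree_count_le\<close>). If there is
  a single graph, both multiplicities are at most \<open>1\<close>, and \<open>\<nu> \<ge> 1\<close> because a regular foliation has no singular
  invariant curve (\<open>fol_mult_pos\<close>).
\<close>

section \<open>Germs: coefficients, order and substitution\<close>

lemma germ_eqI: "(\<And>i j. gcoeff f i j = gcoeff g i j) \<Longrightarrow> f = g"
  by transfer (auto intro!: fps_ext)

lemma gcoeff_0 [simp]: "gcoeff 0 i j = 0"
  by transfer simp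

lemma gcoeff_1: "gcoeff 1 i j = (if i = 0 \<and> j = 0 then 1 else 0)"
  by transfer (auto simp: fps_one_nth)

lemma gcoeff_add [simp]: "gcoeff (f + g) i j = gcoeff f i j + gcoeff g i j"
  by transfer simp

lemma gcoeff_minus [simp]: "gcoeff (- f) i j = - gcoeff f i j"
  by transfer simp

lemma gcoeff_diff [simp]: "gcoeff (f - g) i j = gcoeff f i j - gcoeff g i j"
  by transfer simp

lemma gcoeff_sum [simp]: "gcoeff (\<Sum>a\<in>A. F a) i j = (\<Sum>a\<in>A. gcoeff (F a) i j)"
  by (induction A rule: infinite_finite_induct) auto

lemma gcoeff_mult: "gcoeff (f * g) i j = (\<Sum>l\<le>j. \<Sum>k\<le>i. gcoeff f k l * gcoeff g (i - k) (j - l))"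
  by transfer (simp add: fps_mult_nth fps_sum_nth atLeast0AtMost)

lemma gcoeff_gconst: "gcoeff (gconst c) i j = (if i = 0 \<and> j = 0 then c else 0)"
  by transfer auto

lemma gcoeff_gconst_mult [simp]: "gcoeff (gconst c * f) i j = c * gcoeff f i j"
  by transfer (simp add: fps_mult_left_const_nth)

lemma gcoeff_gX_mult: "gcoeff (gX * f) i j = (if i = 0 then 0 else gcoeff f (i - 1) j)"
  by transfer simp

lemma gcoeff_gY_mult: "gcoeff (gY * f) i j = (if j = 0 then 0 else gcoeff f i (j - 1))"
  by transfer simp

lemma gcoeff_gX_power_mult: "gcoeff (gX ^ n * f) i j = (if i < n then 0 else gcoeff f (i - n) j)"
  by (induction n arbitrary: i) (auto simp: gcoeff_gX_mult mult.assoc)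

lemma gcoeff_gY_power_mult: "gcoeff (gY ^ n * f) i j = (if j < n then 0 else gcoeff f i (j - n))"
  by (induction n arbitrary: j) (auto simp: gcoeff_gY_mult mult.assoc)

lemma gcoeff_gX: "gcoeff gX i j = (if i = 1 \<and> j = 0 then 1 else 0)"
  using gcoeff_gX_mult[of 1 i j] by (auto simp: gcoeff_1)

lemma gcoeff_gY: "gcoeff gY i j = (if i = 0 \<and> j = 1 then 1 else 0)"
  using gcoeff_gY_mult[of 1 i j] by (auto simp: gcoeff_1)

lemma gcoeff_monom: "gcoeff (gX ^ k * gY ^ l) i j = (if i = k \<and> j = l then 1 else 0)"
  using gcoeff_gX_power_mult[of k "gY ^ l * 1"] gcoeff_gY_power_mult[of l 1]
  by (auto simp: gcoeff_1)

lemma gcoeff_dX: "gcoeff (dX f) i j = of_nat (Suc i) * gcoeff f (Suc i) j"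
  by transfer simp

lemma gcoeff_dY: "gcoeff (dY f) i j = of_nat (Suc j) * gcoeff f i (Suc j)"
  by transfer (simp add: fps_of_nat[symmetric] del: of_nat_Suc)

lemma gconst_simps [simp]: "gconst 0 = 0" "gconst 1 = 1" "gconst (a + b) = gconst a + gconst b"
  "gconst (a - b) = gconst a - gconst b" "gconst (- a) = - gconst a"
  by (rule germ_eqI; simp add: gcoeff_gconst gcoeff_1)+

lemma gconst_mult: "gconst (a * b) = gconst a * gconst b"
  by (rule germ_eqI) (simp add: gcoeff_gconst)

lemma gconst_power: "gconst (a ^ n) = gconst a ^ n"
  by (induction n) (simp_all add: gconst_mult)

lemma gconst_eq_0_iff [simp]: "gconst c = 0 \<longleftrightarrow> c = 0"
  using gcoeff_gconst[of c 0 0] by auto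

lemma gX_neq_0 [simp]: "gX \<noteq> 0" and gY_neq_0 [simp]: "gY \<noteq> 0"
  using gcoeff_gX[of 1 0] gcoeff_gY[of 0 1] by auto

lemma dX_add: "dX (f + g) = dX f + dX g" and dY_add: "dY (f + g) = dY f + dY g"
  by (rule germ_eqI; simp add: gcoeff_dX gcoeff_dY algebra_simps)+

lemma dX_mult: "dX (f * g) = dX f * g + f * dX g"
  by transfer (auto intro!: fps_ext simp: fps_mult_nth sum.distrib fps_deriv_sum fps_sum_nth
      simp del: fps_deriv_nth)

lemma dY_mult: "dY (f * g) = dY f * g + f * dY g"
  by transfer simp

lemma d_simps [simp]: "dX 0 = 0" "dY 0 = 0" "dX 1 = 0" "dY 1 = 0" "dX (gconst c) = 0" "dY (gconst c) = 0"
  "dX gX = 1" "dY gX = 0" "dX gY = 0" "dY gY = 1"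
  by (rule germ_eqI; auto simp: gcoeff_dX gcoeff_dY gcoeff_1 gcoeff_gconst gcoeff_gX gcoeff_gY)+

lemma dY_minus: "dY (- f) = - dY f"
  by (rule germ_eqI) (simp add: gcoeff_dY algebra_simps)

lemma dX_diff: "dX (f - g) = dX f - dX g" and dY_diff: "dY (f - g) = dY f - dY g"
  by (rule germ_eqI; simp add: gcoeff_dX gcoeff_dY algebra_simps)+

lemma dX_power: "dX (f ^ n) = of_nat n * f ^ (n - 1) * dX f"
proof (induction n)
  case (Suc n)
  then show ?case by (cases n) (simp_all add: dX_mult algebra_simps)
qed simp

lemma dY_power: "dY (f ^ n) = of_nat n * f ^ (n - 1) * dY f"
proof (induction n)
  case (Suc n)
  then show ?case by (cases n) (simp_all add: dY_mult algebra_simps)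
qed simp

text \<open>A predicate instead of the order itself: the zero germ is not an exception.\<close>

definition ord_ge :: "germ \<Rightarrow> nat \<Rightarrow> bool" where
  "ord_ge f d \<longleftrightarrow> (\<forall>i j. i + j < d \<longrightarrow> gcoeff f i j = 0)"

lemma ord_geD: "ord_ge f d \<Longrightarrow> i + j < d \<Longrightarrow> gcoeff f i j = 0"
  by (simp add: ord_ge_def)

lemma ord_ge_0 [simp]: "ord_ge f 0" and ord_ge_zero [simp]: "ord_ge 0 d"
  by (auto simp: ord_ge_def)

lemma ord_ge_mono: "ord_ge f d \<Longrightarrow> e \<le> d \<Longrightarrow> ord_ge f e"
  by (auto simp: ord_ge_def)

lemma ord_ge_add: "ord_ge f d \<Longrightarrow> ord_ge g d \<Longrightarrow> ord_ge (f + g) d"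
  and ord_ge_diff: "ord_ge f d \<Longrightarrow> ord_ge g d \<Longrightarrow> ord_ge (f - g) d"
  by (auto simp: ord_ge_def)

lemma ord_ge_mult: 
  assumes "ord_ge f d" "ord_ge g e" shows "ord_ge (f * g) (d + e)"
  unfolding ord_ge_def
proof (intro allI impI)
  fix i j :: nat assume ij: "i + j < d + e"
  have *: "gcoeff f k l * gcoeff g (i - k) (j - l) = 0" if "k \<le> i" "l \<le> j" for k l
  proof -
    have "k + l < d \<or> (i - k) + (j - l) < e" using ij that by linarith
    then show ?thesis using assms by (auto simp: ord_ge_def)
  qed
  show "gcoeff (f * g) i j = 0" unfolding gcoeff_mult
    by (intro sum.neutral ballI *) auto
qed

lemma ord_ge_mult_left: "ord_ge f d \<Longrightarrow> ord_ge (f * g) d"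
  using ord_ge_mult[of f d g 0] by simp

lemma ord_ge_power: "ord_ge f d \<Longrightarrow> ord_ge (f ^ n) (n * d)"
  by (induction n) (auto intro: ord_ge_mult)

lemma vanishes_iff_ord_ge: "vanishes f \<longleftrightarrow> ord_ge f 1"
  by (auto simp: vanishes_def ord_ge_def)

lemma ord_ge_power_vanishes: "vanishes f \<Longrightarrow> ord_ge (f ^ n) n"
  using ord_ge_power[of f 1 n] by (simp add: vanishes_iff_ord_ge)

lemma eq_0_if_ord_ge: "(\<And>d. ord_ge f d) \<Longrightarrow> f = 0"
  by (rule germ_eqI) (metis gcoeff_0 ord_ge_def less_Suc_eq)

text \<open>
  Polynomials are dense for the topology of the order: an additive map that lowers the order by a
  bounded amount is determined by its values on monomials.
\<close>

lemma germ_density: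
  assumes add: "\<And>f g. L (f + g) = L f + L g"
    and mono: "\<And>c k l. L (gconst c * (gX ^ k * gY ^ l)) = 0"
    and ord: "\<And>f d. ord_ge f (d + K) \<Longrightarrow> ord_ge (L f :: germ) d"
  shows "L f = 0"
proof (rule eq_0_if_ord_ge)
  fix d
  define P where "P = (\<Sum>k<d + K. \<Sum>l<d + K. gconst (gcoeff f k l) * (gX ^ k * gY ^ l))"
  have L0: "L 0 = 0" using mono[of 0 0 0] by simp
  have Lsum: "L (\<Sum>a\<in>A. F a) = (\<Sum>a\<in>A. L (F a))" for A :: "nat set" and F
    by (induction A rule: infinite_finite_induct) (auto simp: L0 add)
  have "L P = 0" unfolding P_def Lsum mono by simp
  have "gcoeff P i j = (\<Sum>k<d + K. \<Sum>l<d + K. if i = k \<and> j = l then gcoeff f k l else 0)" for i j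
    by (simp add: P_def gcoeff_monom if_distrib cong: if_cong)
  also have "\<dots> i j = (\<Sum>k<d + K. if i = k then \<Sum>l<d + K. if j = l then gcoeff f k l else 0 else 0)" for i j
    by (intro sum.cong) auto
  finally have P: "gcoeff P i j = (if i < d + K \<and> j < d + K then gcoeff f i j else 0)" for i j
    by simp
  have "ord_ge (f - P) (d + K)" by (auto simp: ord_ge_def P)
  then have "ord_ge (L (f - P)) d" by (rule ord)
  then show "ord_ge (L f) d" using add[of "f - P" P] \<open>L P = 0\<close> by simp
qed

lemma Rep_germ_power: "Rep_germ (f ^ n) = Rep_germ f ^ n"
  by (induction n) (auto simp: one_germ.rep_eq times_germ.rep_eq)

lemma gcoeff_gsubst:
  assumes "vanishes p" "vanishes q"
  shows "gcoeff (gsubst f p q) i j = 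
    (\<Sum>k\<le>i+j. \<Sum>l\<le>i+j. gcoeff f k l * gcoeff (p ^ k * q ^ l) i j)"
  using assms unfolding vanishes_def
  by (simp add: gcoeff.rep_eq gsubst.rep_eq fps_subst2_def times_germ.rep_eq Rep_germ_power)

lemma gcoeff_powers_eq_0:
  assumes "vanishes p" "vanishes q" "i + j < k + l"
  shows "gcoeff (p ^ k * q ^ l) i j = 0"
  using ord_ge_mult[OF ord_ge_power_vanishes[OF assms(1), of k] ord_ge_power_vanishes[OF assms(2), of l]]
    assms(3) by (simp add: ord_ge_def)

text \<open>
  Any larger range of summation will do, so that several coefficients can be computed over one range.
\<close>

lemma gcoeff_gsubst_ge:
  assumes "vanishes p" "vanishes q" "i + j \<le> M" "i + j \<le> M'"
  shows "gcoeff (gsubst f p q) i j = 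
    (\<Sum>k\<le>M. \<Sum>l\<le>M'. gcoeff f k l * gcoeff (p ^ k * q ^ l) i j)"
proof -
  have "(\<Sum>l\<le>i+j. gcoeff f k l * gcoeff (p ^ k * q ^ l) i j) =
    (\<Sum>l\<le>M'. gcoeff f k l * gcoeff (p ^ k * q ^ l) i j)" for k
    using assms by (intro sum.mono_neutral_left) (auto simp: gcoeff_powers_eq_0)
  moreover have "(\<Sum>k\<le>i+j. \<Sum>l\<le>M'. gcoeff f k l * gcoeff (p ^ k * q ^ l) i j) =
    (\<Sum>k\<le>M. \<Sum>l\<le>M'. gcoeff f k l * gcoeff (p ^ k * q ^ l) i j)"
    using assms by (intro sum.mono_neutral_left) (auto simp: gcoeff_powers_eq_0)
  ultimately show ?thesis using assms by (simp add: gcoeff_gsubst)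
qed

context
  fixes p q :: germ
  assumes p: "vanishes p" and q: "vanishes q"
begin

lemma gsubst_add: "gsubst (f + g) p q = gsubst f p q + gsubst g p q"
  by (rule germ_eqI) (simp add: gcoeff_gsubst p q sum.distrib distrib_right)

lemma ord_ge_gsubst: "ord_ge f d \<Longrightarrow> ord_ge (gsubst f p q) d"
proof -
  assume f: "ord_ge f d"
  have *: "gcoeff f k l * gcoeff (p ^ k * q ^ l) i j = 0" if "i + j < d" for i j k l
    using f that gcoeff_powers_eq_0[OF p q, of i j k l]
    by (cases "k + l < d") (auto simp: ord_ge_def)
  show ?thesis unfolding ord_ge_def gcoeff_gsubst[OF p q]
    by (intro allI impI sum.neutral ballI *)
qed

lemma gsubst_monom: "gsubst (gconst c * (gX ^ k * gY ^ l)) p q = gconst c * (p ^ k * q ^ l)"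
proof (rule germ_eqI)
  fix i j
  define M where "M = i + j + k + l"
  have "gcoeff (gsubst (gconst c * (gX ^ k * gY ^ l)) p q) i j =
    (\<Sum>k'\<le>M. \<Sum>l'\<le>M. if k' = k then if l' = l then c * gcoeff (p ^ k * q ^ l) i j else 0 else 0)"
    by (subst gcoeff_gsubst_ge[OF p q, where M = M and M' = M])
       (auto simp: M_def gcoeff_monom intro!: sum.cong)
  also have "\<dots> = (\<Sum>k'\<le>M. if k' = k then c * gcoeff (p ^ k * q ^ l) i j else 0)"
    by (intro sum.cong) (auto simp: M_def)
  also have "\<dots> = c * gcoeff (p ^ k * q ^ l) i j" by (simp add: M_def)
  finally show "gcoeff (gsubst (gconst c * (gX ^ k * gY ^ l)) p q) i j =
    gcoeff (gconst c * (p ^ k * q ^ l)) i j" by simp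
qed

text \<open>The identity is clear for monomials, and extends to each factor in turn by density.\<close>

lemma gsubst_mult: "gsubst (f * g) p q = gsubst f p q * gsubst g p q"
proof -
  have *: "gsubst (gconst c * (gX ^ k * gY ^ l) * g) p q - gsubst (gconst c * (gX ^ k * gY ^ l)) p q * gsubst g p q = 0"
    for c k l
  proof (rule germ_density[where K = 0 and
        L = "\<lambda>g. gsubst (gconst c * (gX ^ k * gY ^ l) * g) p q - gsubst (gconst c * (gX ^ k * gY ^ l)) p q * gsubst g p q"])
    fix c' k' l'
    have "gconst c * (gX ^ k * gY ^ l) * (gconst c' * (gX ^ k' * gY ^ l')) =
      gconst (c * c') * (gX ^ (k + k') * gY ^ (l + l'))"
      by (simp add: gconst_mult power_add mult_ac)
    then show "gsubst (gconst c * (gX ^ k * gY ^ l) * (gconst c' * (gX ^ k' * gY ^ l'))) p q -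
       gsubst (gconst c * (gX ^ k * gY ^ l)) p q * gsubst (gconst c' * (gX ^ k' * gY ^ l')) p q = 0"
      by (simp only: gsubst_monom) (simp add: gconst_mult power_add mult_ac)
  next
    fix f d assume "ord_ge f (d + 0)"
    then show "ord_ge (gsubst (gconst c * (gX ^ k * gY ^ l) * f) p q -
       gsubst (gconst c * (gX ^ k * gY ^ l)) p q * gsubst f p q) d"
      by (metis add_0_right mult.commute ord_ge_diff ord_ge_gsubst ord_ge_mult_left)
  qed (simp add: gsubst_add algebra_simps)
  have "gsubst (f * g) p q - gsubst f p q * gsubst g p q = 0"
  proof (rule germ_density[where K = 0 and L = "\<lambda>f. gsubst (f * g) p q - gsubst f p q * gsubst g p q"])
    fix f d assume "ord_ge f (d + 0)"
    then show "ord_ge (gsubst (f * g) p q - gsubst f p q * gsubst g p q) d"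
      by (metis add_0_right ord_ge_diff ord_ge_gsubst ord_ge_mult_left)
  qed (simp_all add: gsubst_add algebra_simps *[simplified algebra_simps])
  then show ?thesis by simp
qed

lemma gsubst_gconst [simp]: "gsubst (gconst c) p q = gconst c"
  using gsubst_monom[of c 0 0] by simp

lemma gsubst_gX [simp]: "gsubst gX p q = p"
  using gsubst_monom[of 1 1 0] by simp

lemma gsubst_gY [simp]: "gsubst gY p q = q"
  using gsubst_monom[of 1 0 1] by simp

lemma gsubst_0 [simp]: "gsubst 0 p q = 0"
  using gsubst_gconst[of 0] by simp

lemma gsubst_1 [simp]: "gsubst 1 p q = 1"
  using gsubst_gconst[of 1] by simp

lemma gsubst_minus: "gsubst (- f) p q = - gsubst f p q"
  using gsubst_add[of f "- f"] by (simp add: add_eq_0_iff)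

lemma gsubst_diff: "gsubst (f - g) p q = gsubst f p q - gsubst g p q"
  using gsubst_add[of f "- g"] by (simp add: gsubst_minus)

lemma gsubst_power: "gsubst (f ^ n) p q = gsubst f p q ^ n"
  by (induction n) (auto simp: gsubst_mult)

lemma gsubst_sum: "gsubst (\<Sum>a\<in>A. F a) p q = (\<Sum>a\<in>A. gsubst (F a) p q)"
  by (induction A rule: infinite_finite_induct) (auto simp: gsubst_add)

lemma gsubst_prod: "gsubst (\<Prod>a\<in>A. F a) p q = (\<Prod>a\<in>A. gsubst (F a) p q)"
  by (induction A rule: infinite_finite_induct) (auto simp: gsubst_mult)

lemma gsubst_of_nat: "gsubst (of_nat n) p q = of_nat n"
  by (induction n) (auto simp: gsubst_add)

lemma gsubst_dvd: "f dvd g \<Longrightarrow> gsubst f p q dvd gsubst g p q"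
  by (auto simp: dvd_def gsubst_mult)

lemma vanishes_gsubst [simp]: "vanishes (gsubst f p q) \<longleftrightarrow> vanishes f"
  by (simp add: vanishes_def gcoeff_gsubst[OF p q] gcoeff_1)

text \<open>
  The chain rule, again by density. Differentiation lowers the order by one, hence \<open>K = 1\<close>.
\<close>

lemma dX_gsubst: "dX (gsubst f p q) = gsubst (dX f) p q * dX p + gsubst (dY f) p q * dX q"
  and dY_gsubst: "dY (gsubst f p q) = gsubst (dX f) p q * dY p + gsubst (dY f) p q * dY q"
proof -
  have mono: "dX (gconst c * (gX ^ k * gY ^ l)) = gconst c * (of_nat k * gX ^ (k - 1) * gY ^ l)"
       "dY (gconst c * (gX ^ k * gY ^ l)) = gconst c * (gX ^ k * (of_nat l * gY ^ (l - 1)))" for c k l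
    by (simp_all add: dX_mult dY_mult dX_power dY_power)
  have ord: "ord_ge (dX f) d" "ord_ge (dY f) d" if "ord_ge f (d + 1)" for f d
    using that by (auto simp: ord_ge_def gcoeff_dX gcoeff_dY)
  have "dX (gsubst f p q) - (gsubst (dX f) p q * dX p + gsubst (dY f) p q * dX q) = 0"
  proof (rule germ_density[where K = 1 and L = "\<lambda>f. dX (gsubst f p q) - (gsubst (dX f) p q * dX p + gsubst (dY f) p q * dX q)"])
    fix c k l
    show "dX (gsubst (gconst c * (gX ^ k * gY ^ l)) p q) - (gsubst (dX (gconst c * (gX ^ k * gY ^ l))) p q * dX p +
      gsubst (dY (gconst c * (gX ^ k * gY ^ l))) p q * dX q) = 0"
      unfolding mono gsubst_monom by (simp add: gsubst_mult gsubst_power gsubst_of_nat dX_mult dX_power algebra_simps)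
  qed (auto intro!: ord_ge_diff ord_ge_add ord_ge_mult_left[OF ord_ge_gsubst] ord ord_ge_gsubst 
        simp: dX_add dY_add gsubst_add distrib_right)
  then show "dX (gsubst f p q) = gsubst (dX f) p q * dX p + gsubst (dY f) p q * dX q" by simp
  have "dY (gsubst f p q) - (gsubst (dX f) p q * dY p + gsubst (dY f) p q * dY q) = 0"
  proof (rule germ_density[where K = 1 and L = "\<lambda>f. dY (gsubst f p q) - (gsubst (dX f) p q * dY p + gsubst (dY f) p q * dY q)"])
    fix c k l
    show "dY (gsubst (gconst c * (gX ^ k * gY ^ l)) p q) - (gsubst (dX (gconst c * (gX ^ k * gY ^ l))) p q * dY p +
      gsubst (dY (gconst c * (gX ^ k * gY ^ l))) p q * dY q) = 0"
      unfolding mono gsubst_monom by (simp add: gsubst_mult gsubst_power gsubst_of_nat dY_mult dY_power algebra_simps)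
  qed (auto intro!: ord_ge_diff ord_ge_add ord_ge_mult_left[OF ord_ge_gsubst] ord ord_ge_gsubst 
        simp: dX_add dY_add gsubst_add distrib_right)
  then show "dY (gsubst f p q) = gsubst (dX f) p q * dY p + gsubst (dY f) p q * dY q" by simp
qed

end

lemma gsubst_gsubst:
  assumes "vanishes p" "vanishes q" "vanishes p'" "vanishes q'"
  shows "gsubst (gsubst f p q) p' q' = gsubst f (gsubst p p' q') (gsubst q p' q')"
proof -
  have "gsubst (gsubst f p q) p' q' - gsubst f (gsubst p p' q') (gsubst q p' q') = 0"
    by (rule germ_density[where K = 0 and
        L = "\<lambda>f. gsubst (gsubst f p q) p' q' - gsubst f (gsubst p p' q') (gsubst q p' q')"])
       (auto simp: assms gsubst_add gsubst_monom gsubst_mult gsubst_power intro!: ord_ge_diff ord_ge_gsubst)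
  then show ?thesis by simp
qed

lemma ord_ge_iff_gorder: "ord_ge f d \<longleftrightarrow> enat d \<le> gorder f"
  unfolding ord_ge_def gorder_def le_INF_iff by (auto simp: not_less[symmetric])

lemma gorder_eq_enat: "ord_ge f d \<Longrightarrow> \<not> ord_ge f (Suc d) \<Longrightarrow> gorder f = enat d"
  unfolding ord_ge_iff_gorder
  by (metis Suc_ile_eq antisym_conv2)

lemma gmult_eqI: "ord_ge f d \<Longrightarrow> \<not> ord_ge f (Suc d) \<Longrightarrow> gmult f = d"
  by (simp add: gmult_def gorder_eq_enat)

lemma exists_order:
  assumes "f \<noteq> 0" obtains d where "ord_ge f d" "\<not> ord_ge f (Suc d)"
proof -
  obtain d where d: "\<not> ord_ge f d" using eq_0_if_ord_ge assms by blast
  define m where "m = (LEAST d. \<not> ord_ge f d)"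
  have m: "\<not> ord_ge f m" unfolding m_def by (rule LeastI[of _ d]) (rule d)
  then obtain k where k: "m = Suc k" by (cases m) auto
  have "ord_ge f k" using not_less_Least[of k "\<lambda>d. \<not> ord_ge f d"] k by (simp add: m_def)
  then show ?thesis using that m k by blast
qed

lemma ord_ge_gmult: "f \<noteq> 0 \<Longrightarrow> ord_ge f (gmult f)"
  and not_ord_ge_Suc_gmult: "f \<noteq> 0 \<Longrightarrow> \<not> ord_ge f (Suc (gmult f))"
  by (metis exists_order gmult_eqI)+

lemma ord_ge_le_gmult: "f \<noteq> 0 \<Longrightarrow> ord_ge f d \<longleftrightarrow> d \<le> gmult f"
  by (meson not_less_eq_eq not_ord_ge_Suc_gmult ord_ge_gmult ord_ge_mono)

lemma gcoeff_bottom: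
  assumes "ord_ge f d" "\<not> ord_ge f (Suc d)"
  obtains m where "m \<le> d" "gcoeff f m (d - m) \<noteq> 0" "\<And>i. i < m \<Longrightarrow> gcoeff f i (d - i) = 0"
proof -
  obtain i j where "i + j = d" "gcoeff f i j \<noteq> 0"
    using assms unfolding ord_ge_def by (metis less_Suc_eq)
  then have ex: "\<exists>i. i \<le> d \<and> gcoeff f i (d - i) \<noteq> 0" by (intro exI[of _ i]) auto
  define m where "m = (LEAST i. i \<le> d \<and> gcoeff f i (d - i) \<noteq> 0)"
  have m: "m \<le> d" "gcoeff f m (d - m) \<noteq> 0"
    using LeastI_ex[OF ex] by (simp_all add: m_def)
  have "gcoeff f i (d - i) = 0" if "i < m" for i
    using not_less_Least[of i "\<lambda>i. i \<le> d \<and> gcoeff f i (d - i) \<noteq> 0"] that m by (auto simp: m_def)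
  from that[OF m this] show ?thesis .
qed

text \<open>
  Orders add up: the product of the lowest terms of two germs, for the total degree and then for the degree
  in \<open>x\<close>, is not cancelled by any other product of terms.
\<close>

lemma not_ord_ge_mult:
  assumes f: "ord_ge f d" "\<not> ord_ge f (Suc d)" and g: "ord_ge g e" "\<not> ord_ge g (Suc e)"
  shows "\<not> ord_ge (f * g) (Suc (d + e))"
proof -
  obtain m where m: "m \<le> d" "gcoeff f m (d - m) \<noteq> 0" "\<And>i. i < m \<Longrightarrow> gcoeff f i (d - i) = 0"
    by (rule gcoeff_bottom[OF f]) blast
  obtain n where n: "n \<le> e" "gcoeff g n (e - n) \<noteq> 0" "\<And>i. i < n \<Longrightarrow> gcoeff g i (e - i) = 0"
    by (rule gcoeff_bottom[OF g]) blast
  have *: "gcoeff f k l * gcoeff g (m + n - k) (d + e - m - n - l) =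
      (if l = d - m then if k = m then gcoeff f m (d - m) * gcoeff g n (e - n) else 0 else 0)"
    if kl: "k \<le> m + n" "l \<le> d + e - m - n" for k l
  proof (cases "k + l = d")
    case False
    then have "k + l < d \<or> (m + n - k) + (d + e - m - n - l) < e" using kl m n by linarith
    then show ?thesis using f(1) g(1) m n False by (auto simp: ord_ge_def)
  next
    case True
    then have l: "l = d - k" "k \<le> d" by auto
    consider "k < m" | "k > m" | "k = m" by linarith
    then show ?thesis
    proof cases
      case 1
      then show ?thesis using m(3)[of k] l by simp
    next
      case 2
      then have "m + n - k < n" "d + e - m - n - l = e - (m + n - k)" using kl l m n by auto
      then show ?thesis using n(3)[of "m + n - k"] 2 by simp
    next
      case 3
      moreover have "d + e - m - n - (d - m) = e - n" using m n by simp
      ultimately show ?thesis using l by simp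
    qed
  qed
  have "gcoeff (f * g) (m + n) (d + e - m - n) =
     (\<Sum>l\<le>d + e - m - n. \<Sum>k\<le>m + n. if l = d - m then if k = m then gcoeff f m (d - m) * gcoeff g n (e - n) else 0 else 0)"
    unfolding gcoeff_mult by (intro sum.cong refl *) auto
  also have "\<dots> = (\<Sum>l\<le>d + e - m - n. if l = d - m then gcoeff f m (d - m) * gcoeff g n (e - n) else 0)"
    by (intro sum.cong refl) auto
  also have "\<dots> = gcoeff f m (d - m) * gcoeff g n (e - n)" using m n by simp
  finally have "gcoeff (f * g) (m + n) (d + e - m - n) \<noteq> 0" using m n by simp
  moreover have "(m + n) + (d + e - m - n) < Suc (d + e)" using m n by simp
  ultimately show ?thesis by (auto simp: ord_ge_def)
qed

lemma gmult_mult: "f \<noteq> 0 \<Longrightarrow> g \<noteq> 0 \<Longrightarrow> gmult (f * g) = gmult f + gmult g"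
  by (simp add: gmult_eqI not_ord_ge_mult ord_ge_gmult not_ord_ge_Suc_gmult ord_ge_mult)

lemma gmult_gX [simp]: "gmult gX = 1"
  by (rule gmult_eqI) (auto simp: ord_ge_def gcoeff_gX intro!: exI[of _ 1] exI[of _ 0])

lemma vanishes_iff_gmult: "f \<noteq> 0 \<Longrightarrow> vanishes f \<longleftrightarrow> gmult f \<ge> 1"
  using ord_ge_le_gmult[of f 1] by (simp add: vanishes_iff_ord_ge)

lemma vanishes_simps [simp]: "vanishes gX" "vanishes gY" "vanishes 0" "\<not> vanishes 1"
  "vanishes (gconst c) \<longleftrightarrow> c = 0" "vanishes (- f) \<longleftrightarrow> vanishes f"
  by (auto simp: vanishes_def gcoeff_gX gcoeff_gY gcoeff_1 gcoeff_gconst)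

lemma vanishes_add: "vanishes f \<Longrightarrow> vanishes g \<Longrightarrow> vanishes (f + g)"
  and vanishes_diff: "vanishes f \<Longrightarrow> vanishes g \<Longrightarrow> vanishes (f - g)"
  by (auto simp: vanishes_def)

lemma vanishes_mult_iff [simp]: "vanishes (f * g) \<longleftrightarrow> vanishes f \<or> vanishes g"
  by (simp add: vanishes_def gcoeff_mult)

lemma vanishes_power_iff [simp]: "vanishes (f ^ n) \<longleftrightarrow> n > 0 \<and> vanishes f"
  by (induction n) auto

lemma vanishes_dvd: "f dvd g \<Longrightarrow> vanishes f \<Longrightarrow> vanishes g"
  by (auto simp: dvd_def)

lemma gsubst_id [simp]: "gsubst f gX gY = f"
proof -
  have "gsubst f gX gY - f = 0"
    by (rule germ_density[where K = 0 and L = "\<lambda>f. gsubst f gX gY - f"])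
       (auto simp: gsubst_add gsubst_monom intro!: ord_ge_diff ord_ge_gsubst)
  then show ?thesis by simp
qed

subsection \<open>Units and divisibility\<close>

text \<open>
  The inverse of \<open>1 - u\<close> is the composite of the geometric series with \<open>u\<close>, and composites converge.
\<close>

lift_definition geometric :: germ is "fps_const (Abs_fps (\<lambda>_. 1))"
proof -
  have "wsum (1/2) m (fps_const (Abs_fps (\<lambda>_. 1))) \<le> 2" for m
  proof -
    have "wsum (1/2) m (fps_const (Abs_fps (\<lambda>_. 1))) = wsum1 (1/2) m (Abs_fps (\<lambda>_. 1))"
      unfolding wsum_def by (subst sum.mono_neutral_right[where S = "{0}"]) (auto simp: wsum1_def)
    also have "\<dots> = (\<Sum>i\<le>m. (1/2) ^ i)" by (simp add: wsum1_def)
    also have "\<dots> \<le> 2" 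
      using sum_gp_basic[of "1/2::real" m] by simp
    finally show ?thesis .
  qed
  then show "convergent2 (fps_const (Abs_fps (\<lambda>_. 1)))" unfolding convergent2_iff by (intro exI[of _ "1/2"]) auto
qed

lemma geometric: "(1 - gX) * geometric = 1"
proof (rule germ_eqI)
  fix i j
  have "gcoeff geometric i j = (if j = 0 then 1 else 0)" for i j
    by (simp add: gcoeff.rep_eq geometric.rep_eq)
  note this [simp]
  have "(1 - gX) * geometric = geometric - gX * geometric" by (simp add: left_diff_distrib)
  then show "gcoeff ((1 - gX) * geometric) i j = gcoeff 1 i j"
    by (simp add: gcoeff_gX_mult gcoeff_1)
qed

lemma is_unit_germ_iff: "f dvd 1 \<longleftrightarrow> \<not> vanishes f"
proof
  assume "f dvd 1"
  then show "\<not> vanishes f" using vanishes_dvd[of f 1] by (auto simp: vanishes_def gcoeff_1)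
next
  assume f: "\<not> vanishes f"
  define c where "c = gcoeff f 0 0"
  have c: "c \<noteq> 0" using f by (simp add: c_def vanishes_def)
  define u where "u = 1 - gconst (1 / c) * f"
  have u: "vanishes u" using c by (simp add: u_def vanishes_def gcoeff_1) (simp add: c_def)
  have "(1 - u) * gsubst geometric u 0 = gsubst ((1 - gX) * geometric) u 0"
    using u by (simp add: gsubst_mult gsubst_diff)
  then have "(1 - u) * gsubst geometric u 0 = 1" using u by (simp add: geometric)
  moreover have "1 - u = f * gconst (1 / c)" by (simp add: u_def)
  ultimately have "1 = f * (gconst (1 / c) * gsubst geometric u 0)" by (simp add: mult.assoc)
  then show "f dvd 1" by (rule dvdI)
qed

lemma gmult_unit: "f dvd 1 \<Longrightarrow> gmult f = 0"
  by (rule gmult_eqI) (auto simp: is_unit_germ_iff vanishes_iff_ord_ge)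

lift_definition shiftX :: "germ \<Rightarrow> germ" is "\<lambda>F. Abs_fps (\<lambda>j. fps_shift 1 (F $ j))"
proof (rule convergent2_deriv_bound[where a = 1 and b = 0], assumption)
  fix F :: "complex fps fps" and i j
  have "1 * norm (F $ j $ Suc i) \<le> (real (Suc i) * real (Suc j)) * norm (F $ j $ Suc i)"
    by (intro mult_right_mono) (auto simp: algebra_simps)
  then show "norm (Abs_fps (\<lambda>j. fps_shift 1 (F $ j)) $ j $ i) \<le> real (Suc i) * real (Suc j) * norm (F $ (j + 0) $ (i + 1))"
    by simp
qed auto

lift_definition shiftY :: "germ \<Rightarrow> germ" is "fps_shift 1"
proof (rule convergent2_deriv_bound[where a = 0 and b = 1], assumption)
  fix F :: "complex fps fps" and i j
  have "1 * norm (F $ Suc j $ i) \<le> (real (Suc i) * real (Suc j)) * norm (F $ Suc j $ i)"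
    by (intro mult_right_mono) (auto simp: algebra_simps)
  then show "norm (fps_shift 1 F $ j $ i) \<le> real (Suc i) * real (Suc j) * norm (F $ (j + 1) $ (i + 0))"
    by simp
qed auto

lemma gcoeff_shiftX [simp]: "gcoeff (shiftX f) i j = gcoeff f (Suc i) j"
  and gcoeff_shiftY [simp]: "gcoeff (shiftY f) i j = gcoeff f i (Suc j)"
  by (transfer; simp)+

lemma gX_dvd_iff: "gX dvd f \<longleftrightarrow> (\<forall>j. gcoeff f 0 j = 0)"
proof
  assume "\<forall>j. gcoeff f 0 j = 0"
  then have "f = gX * shiftX f" by (intro germ_eqI) (simp add: gcoeff_gX_mult)
  then show "gX dvd f" by (metis dvd_triv_left)
qed (auto simp: gcoeff_gX_mult)

lemma gY_dvd_iff: "gY dvd f \<longleftrightarrow> (\<forall>i. gcoeff f i 0 = 0)"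
proof
  assume "\<forall>i. gcoeff f i 0 = 0"
  then have "f = gY * shiftY f" by (intro germ_eqI) (simp add: gcoeff_gY_mult)
  then show "gY dvd f" by (metis dvd_triv_left)
qed (auto simp: gcoeff_gY_mult)

lemma gX_power_dvd_iff: "gX ^ n dvd f \<longleftrightarrow> (\<forall>i<n. \<forall>j. gcoeff f i j = 0)"
proof
  show "\<forall>i<n. \<forall>j. gcoeff f i j = 0 \<Longrightarrow> gX ^ n dvd f"
  proof (induction n arbitrary: f)
    case (Suc n)
    then obtain g where g: "f = gX * g" using gX_dvd_iff[of f] by auto
    have "gX ^ n dvd g" 
    proof (rule Suc.IH, intro allI impI)
      fix i j assume "i < n"
      then show "gcoeff g i j = 0" using Suc.prems[rule_format, of "Suc i" j] by (simp add: g gcoeff_gX_mult)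
    qed
    then show ?case by (simp add: g)
  qed simp
qed (auto simp: gcoeff_gX_power_mult)

subsection \<open>Germs in one variable, and smooth branches\<close>

definition xonly :: "germ \<Rightarrow> bool" where
  "xonly s \<longleftrightarrow> dY s = 0"

lemma xonly_iff: "xonly s \<longleftrightarrow> (\<forall>i j. j > 0 \<longrightarrow> gcoeff s i j = 0)"
proof
  assume "xonly s"
  then have "of_nat (Suc j) * gcoeff s i (Suc j) = 0" for i j
    unfolding xonly_def gcoeff_dY[symmetric] by simp
  then show "\<forall>i j. j > 0 \<longrightarrow> gcoeff s i j = 0" 
    by (metis gr0_conv_Suc mult_eq_0_iff of_nat_neq_0)
qed (auto simp: xonly_def intro!: germ_eqI simp: gcoeff_dY)

lemma xonly_simps [simp]: "xonly 0" "xonly 1" "xonly (gconst c)" "xonly gX"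
  by (simp_all add: xonly_def)

lemma xonly_closed: "xonly s \<Longrightarrow> xonly t \<Longrightarrow> xonly (s + t)" "xonly s \<Longrightarrow> xonly t \<Longrightarrow> xonly (s - t)"
  "xonly s \<Longrightarrow> xonly t \<Longrightarrow> xonly (s * t)" "xonly s \<Longrightarrow> xonly (- s)" "xonly s \<Longrightarrow> xonly (s ^ n)"
  by (simp_all add: xonly_def dY_add dY_diff dY_mult dY_minus dY_power)

lemma xonly_gsubst: "xonly p \<Longrightarrow> xonly q \<Longrightarrow> vanishes p \<Longrightarrow> vanishes q \<Longrightarrow> xonly (gsubst f p q)"
  "xonly s \<Longrightarrow> xonly p \<Longrightarrow> vanishes p \<Longrightarrow> vanishes q \<Longrightarrow> xonly (gsubst s p q)"
  by (simp_all add: xonly_def dY_gsubst)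

lemma gsubst_xonly_cong:
  assumes "xonly s" "vanishes p" "vanishes q" "vanishes q'"
  shows "gsubst s p q = gsubst s p q'"
proof (rule germ_eqI)
  fix i j
  have "gcoeff s k l * gcoeff (p ^ k * q ^ l) i j = gcoeff s k l * gcoeff (p ^ k * q' ^ l) i j" for k l
    using assms(1) by (cases "l = 0") (auto simp: xonly_iff)
  then show "gcoeff (gsubst s p q) i j = gcoeff (gsubst s p q') i j"
    unfolding gcoeff_gsubst[OF assms(2,3)] gcoeff_gsubst[OF assms(2,4)] by (intro sum.cong refl) simp
qed

lemma gsubst_xonly [simp]: "xonly s \<Longrightarrow> vanishes q \<Longrightarrow> gsubst s gX q = s"
  using gsubst_xonly_cong[of s gX q gY] by simp

lemma gcoeff_gsubst_0_gY: "gcoeff (gsubst f 0 gY) i j = (if i = 0 then gcoeff f 0 j else 0)"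
proof -
  have *: "gcoeff (0 ^ k * gY ^ l) i j = (if k = 0 then if l = j \<and> i = 0 then 1 else 0 else 0)" for k l
    using gcoeff_monom[of 0 l i j] by (cases k) auto
  have "gcoeff (gsubst f 0 gY) i j = (\<Sum>k\<le>i+j. \<Sum>l\<le>i+j. if k = 0 then if l = j \<and> i = 0 then gcoeff f 0 j else 0 else 0)"
    by (subst gcoeff_gsubst) (simp_all add: *, intro sum.cong refl, auto)
  also have "\<dots> = (\<Sum>k\<le>i+j. if k = 0 then \<Sum>l\<le>i+j. if l = j \<and> i = 0 then gcoeff f 0 j else 0 else 0)"
    by (intro sum.cong) auto
  also have "\<dots> = (if i = 0 then gcoeff f 0 j else 0)" by auto
  finally show ?thesis .
qed

lemma gX_dvd_iff_gsubst: "gX dvd f \<longleftrightarrow> gsubst f 0 gY = 0"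
  unfolding gX_dvd_iff by (metis gcoeff_0 gcoeff_gsubst_0_gY germ_eqI)

lemma prime_elem_gX: "prime_elem gX"
  by (rule prime_elemI) (auto simp: is_unit_germ_iff gX_dvd_iff_gsubst gsubst_mult)

lemma gcoeff_gsubst_gX_0: "gcoeff (gsubst f gX 0) i j = (if j = 0 then gcoeff f i 0 else 0)"
proof -
  have *: "gcoeff (gX ^ k * 0 ^ l) i j = (if l = 0 then if k = i \<and> j = 0 then 1 else 0 else 0)" for k l
    using gcoeff_monom[of k 0 i j] by (cases l) auto
  have "gcoeff (gsubst f gX 0) i j = (\<Sum>k\<le>i+j. \<Sum>l\<le>i+j. if l = 0 then if k = i \<and> j = 0 then gcoeff f i 0 else 0 else 0)"
    unfolding gcoeff_gsubst[OF vanishes_simps(1,3)] * by (intro sum.cong refl) auto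
  also have "\<dots> = (\<Sum>k\<le>i+j. if k = i then if j = 0 then gcoeff f i 0 else 0 else 0)"
    by (intro sum.cong) auto
  also have "\<dots> = (if j = 0 then gcoeff f i 0 else 0)" by auto
  finally show ?thesis .
qed

lemma gY_dvd_iff_gsubst: "gY dvd f \<longleftrightarrow> gsubst f gX 0 = 0"
  unfolding gY_dvd_iff by (metis gcoeff_0 gcoeff_gsubst_gX_0 germ_eqI)

text \<open>
  The substitution \<open>y + s\<close> for \<open>y\<close> moves the branch to the axis \<open>y = 0\<close>.
\<close>

lemma branch_dvd_iff:
  assumes s: "xonly s" "vanishes s"
  shows "gY - s dvd f \<longleftrightarrow> gsubst f gX s = 0"
proof
  assume "gY - s dvd f"
  then obtain g where "f = (gY - s) * g" by (auto simp: dvd_def)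
  then show "gsubst f gX s = 0" using s by (simp add: gsubst_mult gsubst_diff)
next
  assume "gsubst f gX s = 0"
  have v: "vanishes (gY + s)" "vanishes (gY - s)" using s by (auto intro: vanishes_add vanishes_diff)
  have "gsubst (gsubst f gX (gY + s)) gX 0 = gsubst f gX s"
    using s v by (simp add: gsubst_gsubst gsubst_add)
  then have "gY dvd gsubst f gX (gY + s)" using \<open>gsubst f gX s = 0\<close> by (simp add: gY_dvd_iff_gsubst)
  then have "gsubst gY gX (gY - s) dvd gsubst (gsubst f gX (gY + s)) gX (gY - s)"
    using v by (intro gsubst_dvd) auto
  then show "gY - s dvd f" using s v by (simp add: gsubst_gsubst gsubst_add)
qed

lemma gcoeff_branch: "xonly s \<Longrightarrow> gcoeff (gY - s) i j = (if i = 0 \<and> j = 1 then 1 else if j = 0 then - gcoeff s i 0 else 0)"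
  by (auto simp: xonly_iff gcoeff_gY)

lemma branch_nonzero: "xonly s \<Longrightarrow> gY - s \<noteq> 0"
  using gcoeff_branch[of s 0 1] by auto

lemma prime_elem_branch: 
  assumes s: "xonly s" "vanishes s" shows "prime_elem (gY - s)"
  using assms branch_nonzero[of s]
  by (intro prime_elemI) (auto simp: is_unit_germ_iff branch_dvd_iff gsubst_mult vanishes_diff)

lemma gmult_branch:
  assumes s: "xonly s" "vanishes s" shows "gmult (gY - s) = 1"
proof (rule gmult_eqI)
  have "vanishes (gY - s)" using s by (intro vanishes_diff) auto
  then show "ord_ge (gY - s) 1" by (simp only: vanishes_iff_ord_ge)
  have "gcoeff (gY - s) 0 1 = 1" using s by (simp add: gcoeff_gY xonly_iff)
  then show "\<not> ord_ge (gY - s) (Suc 1)" using ord_geD[of "gY - s" "Suc 1" 0 1] by fastforce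
qed

subsection \<open>Monomial substitutions\<close>

text \<open>Distinct monomials have distinct images: coefficients are moved, never added.\<close>

lemma gcoeff_gsubst_monomial:
  assumes "a \<ge> 1"
  shows "gcoeff (gsubst f (gX ^ a) (gX ^ b * gY)) i j =
    (if b * j \<le> i \<and> a dvd (i - b * j) then gcoeff f ((i - b * j) div a) j else 0)"
proof -
  have *: "gcoeff ((gX ^ a) ^ k * (gX ^ b * gY) ^ l) i j = (if l = j then if i = a * k + b * l then 1 else 0 else 0)" for k l
  proof -
    have "(gX ^ a) ^ k * (gX ^ b * gY) ^ l = gX ^ (a * k + b * l) * gY ^ l"
      by (simp add: power_mult power_mult_distrib power_add)
    then show ?thesis by (simp only: gcoeff_monom) auto
  qed
  have v: "vanishes (gX ^ a)" "vanishes (gX ^ b * gY)" using assms by auto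
  have k: "i = a * k + b * j \<longleftrightarrow> b * j \<le> i \<and> a dvd (i - b * j) \<and> k = (i - b * j) div a" for k
    using assms by auto
  have "gcoeff (gsubst f (gX ^ a) (gX ^ b * gY)) i j = 
    (\<Sum>k\<le>i+j. \<Sum>l\<le>i+j. if l = j then if i = a * k + b * j then gcoeff f k j else 0 else 0)"
    unfolding gcoeff_gsubst[OF v] * by (intro sum.cong refl) auto
  also have "\<dots> = (\<Sum>k\<le>i+j. if i = a * k + b * j then gcoeff f k j else 0)"
    by (intro sum.cong) auto
  also have "\<dots> = (\<Sum>k\<le>i+j. if k = (i - b * j) div a then 
      (if b * j \<le> i \<and> a dvd (i - b * j) then gcoeff f ((i - b * j) div a) j else 0) else 0)"
    unfolding k by (intro sum.cong) auto
  also have "\<dots> = (if b * j \<le> i \<and> a dvd (i - b * j) then gcoeff f ((i - b * j) div a) j else 0)"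
  proof -
    have "(i - b * j) div a \<le> i + j" by (rule order_trans[OF div_le_dividend]) simp
    then show ?thesis by simp
  qed
  finally show ?thesis .
qed

lemma gcoeff_ramify: "a \<ge> 1 \<Longrightarrow> gcoeff (gsubst f (gX ^ a) gY) i j = (if a dvd i then gcoeff f (i div a) j else 0)"
  using gcoeff_gsubst_monomial[of a f 0] by simp

lemma gcoeff_twist: "gcoeff (gsubst f (gconst \<zeta> * gX) gY) i j = \<zeta> ^ i * gcoeff f i j"
proof -
  have v: "vanishes (gconst \<zeta> * gX)" "vanishes gY" by auto
  have *: "gcoeff ((gconst \<zeta> * gX) ^ k * gY ^ l) i j = (if l = j then if k = i then \<zeta> ^ i else 0 else 0)" for k l
  proof -
    have "(gconst \<zeta> * gX) ^ k * gY ^ l = gconst (\<zeta> ^ k) * (gX ^ k * gY ^ l)"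
      by (simp add: power_mult_distrib gconst_power)
    then show ?thesis by (simp only: gcoeff_monom gcoeff_gconst_mult) auto
  qed
  have "gcoeff (gsubst f (gconst \<zeta> * gX) gY) i j = 
    (\<Sum>k\<le>i+j. \<Sum>l\<le>i+j. if l = j then if k = i then \<zeta> ^ i * gcoeff f i j else 0 else 0)"
    unfolding gcoeff_gsubst[OF v] * by (intro sum.cong refl) auto
  also have "\<dots> = (\<Sum>k\<le>i+j. if k = i then \<zeta> ^ i * gcoeff f i j else 0)"
    by (intro sum.cong) auto
  also have "\<dots> = \<zeta> ^ i * gcoeff f i j" by simp
  finally show ?thesis .
qed

text \<open>
  A series in \<open>t = x^a\<close> that converges for \<open>\<bar>x\<bar> < \<rho>\<close> converges for \<open>\<bar>t\<bar> < \<rho>^a\<close>.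
\<close>

lemma descend:
  assumes a: "a \<ge> 1" and f: "\<And>i j. \<not> a dvd i \<Longrightarrow> gcoeff f i j = 0"
  obtains g where "f = gsubst g (gX ^ a) gY"
proof -
  define F where "F = Rep_germ f"
  have "convergent2 F" using Rep_germ[of f] by (simp add: F_def)
  then obtain r C where r: "r > 0" and C: "\<And>m. wsum r m F \<le> C" unfolding convergent2_iff by blast
  define G where "G = Abs_fps (\<lambda>j. Abs_fps (\<lambda>i. F $ j $ (a * i)))"
  define \<rho> where "\<rho> = min r 1"
  have \<rho>: "0 < \<rho>" "\<rho> \<le> 1" "\<rho> \<le> r" using r by (auto simp: \<rho>_def)
  have "wsum (\<rho> ^ a) m G \<le> C" for m
  proof -
    have "wsum (\<rho> ^ a) m G \<le> (\<Sum>(i,j)\<in>{..m}\<times>{..m}. norm (F $ j $ (a * i)) * \<rho> ^ (a * i) * \<rho> ^ j)"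
      unfolding wsum_altdef
    proof (intro sum_mono, clarify)
      fix i j
      have "(\<rho> ^ a) ^ j \<le> \<rho> ^ j"
        using \<rho> a power_decreasing[of 1 a \<rho>] by (intro power_mono) auto
      then show "norm (G $ j $ i) * (\<rho> ^ a) ^ i * (\<rho> ^ a) ^ j \<le> norm (F $ j $ (a * i)) * \<rho> ^ (a * i) * \<rho> ^ j"
        using \<rho> unfolding G_def power_mult[symmetric] by (intro mult_mono) (auto simp: power_mult)
    qed
    also have "\<dots> = (\<Sum>(i,j)\<in>(\<lambda>(i,j). (a * i, j)) ` ({..m}\<times>{..m}). norm (F $ j $ i) * \<rho> ^ i * \<rho> ^ j)"
      using a by (subst sum.reindex) (auto simp: inj_on_def case_prod_unfold)
    also have "\<dots> \<le> (\<Sum>(i,j)\<in>{..a * m}\<times>{..a * m}. norm (F $ j $ i) * \<rho> ^ i * \<rho> ^ j)"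
    proof (intro sum_mono2)
      have "m \<le> a * m" using a by simp
      then show "(\<lambda>(i,j). (a * i, j)) ` ({..m}\<times>{..m}) \<subseteq> {..a * m}\<times>{..a * m}"
        by (auto simp: image_subset_iff intro: le_trans[OF _ \<open>m \<le> a * m\<close>])
    qed (use \<rho> in auto)
    also have "\<dots> = wsum \<rho> (a * m) F" by (simp add: wsum_altdef)
    also have "\<dots> \<le> wsum r (a * m) F" using \<rho> by (intro wsum_radius_mono) auto
    also have "\<dots> \<le> C" by (rule C)
    finally show ?thesis .
  qed
  then have G: "convergent2 G" unfolding convergent2_iff using \<rho> by (intro exI[of _ "\<rho> ^ a"]) auto
  define g where "g = Abs_germ G"
  have g: "gcoeff g i j = gcoeff f (a * i) j" for i j
    using G by (simp add: gcoeff.rep_eq g_def Abs_germ_inverse) (simp add: G_def F_def)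
  have "f = gsubst g (gX ^ a) gY"
    by (rule germ_eqI) (use a f in \<open>auto simp: gcoeff_ramify g\<close>)
  then show ?thesis using that by blast
qed

section \<open>The implicit function theorem\<close>

text \<open>
  The equation \<open>y = G(x,y)\<close>, where \<open>G\<close> has no linear term in \<open>y\<close>, is solved by iteration from
  \<open>0\<close>. Each coefficient is eventually constant along the iteration, and on a small polydisc
  the iterates stay in a ball of the norm \<open>wsum\<close>; so does their limit, which therefore converges.
\<close>

text \<open>
  Only the terms of degree at most \<open>i + j\<close> contribute to the coefficient of \<open>x^i y^j\<close>, and \<open>i\<close>, \<open>j\<close> are at
  most \<open>m\<close>: this is where \<open>2 * m\<close> comes from.
\<close>

lemma wsum_gsubst_gX_le:
  assumes u: "vanishes u" "wsum r m (Rep_germ u) \<le> s" and r: "r \<ge> 0"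
  shows "wsum r m (Rep_germ (gsubst G gX u)) \<le> (\<Sum>(k,l)\<in>{..2*m}\<times>{..2*m}. norm (gcoeff G k l) * (r ^ k * s ^ l))"
proof -
  have w: "wsum r m (Rep_germ f) = (\<Sum>(i,j)\<in>{..m}\<times>{..m}. norm (gcoeff f i j) * (r ^ i * r ^ j))" for f
    by (simp add: wsum_altdef gcoeff.rep_eq mult.assoc)
  have X: "wsum r m (Rep_germ gX) \<le> r"
  proof -
    have "wsum r m (Rep_germ gX) = (\<Sum>p\<in>{..m}\<times>{..m}. if p = (1, 0) then r else 0)"
      unfolding w by (intro sum.cong) (auto simp: gcoeff_gX split: if_splits)
    also have "\<dots> \<le> r" using r by simp
    finally show ?thesis .
  qed
  have s: "s \<ge> 0" using wsum_nonneg[OF r, of m "Rep_germ u"] u by simp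
  have Xu: "wsum r m (Rep_germ (gX ^ k * u ^ l)) \<le> r ^ k * s ^ l" for k l
  proof -
    have "wsum r m (Rep_germ (gX ^ k * u ^ l)) \<le> wsum r m (Rep_germ gX ^ k) * wsum r m (Rep_germ u ^ l)"
      unfolding times_germ.rep_eq Rep_germ_power using r by (rule wsum_mult)
    also have "\<dots> \<le> wsum r m (Rep_germ gX) ^ k * wsum r m (Rep_germ u) ^ l"
      using r by (intro mult_mono wsum_power wsum_nonneg zero_le_power) auto
    also have "\<dots> \<le> r ^ k * s ^ l"
      using r s u X by (intro mult_mono power_mono wsum_nonneg zero_le_power) auto
    finally show ?thesis .
  qed
  have "wsum r m (Rep_germ (gsubst G gX u)) \<le> (\<Sum>(i,j)\<in>{..m}\<times>{..m}. \<Sum>(k,l)\<in>{..2*m}\<times>{..2*m}.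
      norm (gcoeff G k l) * (norm (gcoeff (gX ^ k * u ^ l) i j) * (r ^ i * r ^ j)))"
    unfolding w
  proof (intro sum_mono, clarify)
    fix i j assume ij: "i \<le> m" "j \<le> m"
    have "gcoeff (gsubst G gX u) i j = (\<Sum>k\<le>2*m. \<Sum>l\<le>2*m. gcoeff G k l * gcoeff (gX ^ k * u ^ l) i j)"
      using ij u by (intro gcoeff_gsubst_ge) auto
    then have "norm (gcoeff (gsubst G gX u) i j) \<le> (\<Sum>(k,l)\<in>{..2*m}\<times>{..2*m}. norm (gcoeff G k l) * norm (gcoeff (gX ^ k * u ^ l) i j))"
      by (simp add: sum.cartesian_product case_prod_unfold norm_mult[symmetric] norm_sum)
    then have "norm (gcoeff (gsubst G gX u) i j) * (r ^ i * r ^ j) \<le> 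
      (\<Sum>(k,l)\<in>{..2*m}\<times>{..2*m}. norm (gcoeff G k l) * norm (gcoeff (gX ^ k * u ^ l) i j)) * (r ^ i * r ^ j)"
      using r by (intro mult_right_mono) auto
    then show "norm (gcoeff (gsubst G gX u) i j) * (r ^ i * r ^ j) \<le> 
      (\<Sum>(k,l)\<in>{..2*m}\<times>{..2*m}. norm (gcoeff G k l) * (norm (gcoeff (gX ^ k * u ^ l) i j) * (r ^ i * r ^ j)))"
      by (simp add: sum_distrib_right case_prod_unfold mult.assoc)
  qed
  also have "\<dots> = (\<Sum>(k,l)\<in>{..2*m}\<times>{..2*m}. norm (gcoeff G k l) * wsum r m (Rep_germ (gX ^ k * u ^ l)))"
    unfolding w case_prod_unfold by (subst sum.swap) (simp add: sum_distrib_left)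
  also have "\<dots> \<le> (\<Sum>(k,l)\<in>{..2*m}\<times>{..2*m}. norm (gcoeff G k l) * (r ^ k * s ^ l))"
    unfolding case_prod_unfold by (intro sum_mono mult_left_mono Xu) auto
  finally show ?thesis .
qed

text \<open>
  Every term of \<open>G\<close> contains \<open>x\<close> or \<open>y^2\<close>. The radius \<open>s\<close> in \<open>y\<close> is chosen first, to make the terms in \<open>y^2\<close>
  at most \<open>s / 2\<close>; then the radius \<open>r\<close> in \<open>x\<close> is chosen so small that the others are at most \<open>s / 2\<close>.
\<close>

lemma small_polydisc:
  assumes G: "gcoeff G 0 0 = 0" "gcoeff G 0 1 = 0"
  obtains r s where "r > 0" "s > 0"
    "\<And>m. (\<Sum>(k,l)\<in>{..m}\<times>{..m}. norm (gcoeff G k l) * (r ^ k * s ^ l)) \<le> s"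
proof -
  obtain R C where R: "R > 0" and C: "\<And>m. wsum R m (Rep_germ G) \<le> C"
    using Rep_germ[of G] unfolding convergent2_iff mem_Collect_eq by blast
  define D where "D = max C 1"
  have D: "D > 0" "\<And>m. wsum R m (Rep_germ G) \<le> D" using C by (auto simp: D_def intro: max.coboundedI1)
  define s where "s = min R (R\<^sup>2 / (2 * D))"
  define r where "r = min R (s * R / (2 * D))"
  have s: "s > 0" "s \<le> R" using R D by (auto simp: s_def)
  have r: "r > 0" "r \<le> R" using R D s by (auto simp: r_def)
  have sD: "D * (s / R)\<^sup>2 \<le> s / 2"
  proof -
    have "s \<le> R\<^sup>2 / (2 * D)" by (simp add: s_def)
    then have "s * (s * (2 * D)) \<le> s * R\<^sup>2" using D s by (intro mult_left_mono) (simp_all add: field_simps)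
    then show ?thesis using R by (simp add: field_simps power2_eq_square)
  qed
  have rD: "D * (r / R) \<le> s / 2"
  proof -
    have "r \<le> s * R / (2 * D)" by (simp add: r_def)
    then show ?thesis using R D by (simp add: field_simps)
  qed
  have summand: "norm (gcoeff G k l) * (r ^ k * s ^ l) \<le> norm (gcoeff G k l) * R ^ k * R ^ l * (r / R + (s / R)\<^sup>2)" for k l
  proof -
    have "gcoeff G k l = 0 \<or> k \<ge> 1 \<or> l \<ge> 2" 
      using G by (cases k; cases l; cases "l - 1") auto
    moreover have "r ^ k * s ^ l \<le> R ^ k * R ^ l * (r / R + (s / R)\<^sup>2)" if "k \<ge> 1"
    proof -
      have "r ^ k * s ^ l = r * r ^ (k - 1) * s ^ l" using that by (cases k) auto
      also have "\<dots> \<le> r * R ^ (k - 1) * R ^ l" using r s by (intro mult_mono power_mono) auto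
      also have "\<dots> = R ^ k * R ^ l * (r / R)" using that R by (cases k) auto
      also have "\<dots> \<le> R ^ k * R ^ l * (r / R + (s / R)\<^sup>2)" using R by (intro mult_left_mono) auto
      finally show ?thesis .
    qed
    moreover have "r ^ k * s ^ l \<le> R ^ k * R ^ l * (r / R + (s / R)\<^sup>2)" if l2: "l \<ge> 2"
    proof -
      obtain l' where "l = 2 + l'" using l2 le_Suc_ex[of 2 l] by blast
      then have l': "l = Suc (Suc l')" by simp
      have "r ^ k * s ^ l = r ^ k * (s\<^sup>2 * s ^ l')" by (simp add: l' power2_eq_square)
      also have "\<dots> \<le> R ^ k * (s\<^sup>2 * R ^ l')" using r s by (intro mult_mono power_mono) auto
      also have "\<dots> = R ^ k * R ^ l * (s / R)\<^sup>2" using R by (simp add: l' field_simps power2_eq_square)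
      also have "\<dots> \<le> R ^ k * R ^ l * (r / R + (s / R)\<^sup>2)" using R r by (intro mult_left_mono) auto
      finally show ?thesis .
    qed
    ultimately have "gcoeff G k l = 0 \<or> r ^ k * s ^ l \<le> R ^ k * R ^ l * (r / R + (s / R)\<^sup>2)" by blast
    then show ?thesis using mult_left_mono[of "r ^ k * s ^ l" "R ^ k * R ^ l * (r / R + (s / R)\<^sup>2)" "norm (gcoeff G k l)"]
      by (auto simp: mult.assoc)
  qed
  have "(\<Sum>(k,l)\<in>{..m}\<times>{..m}. norm (gcoeff G k l) * (r ^ k * s ^ l)) \<le> s" for m
  proof -
    have "(\<Sum>(k,l)\<in>{..m}\<times>{..m}. norm (gcoeff G k l) * (r ^ k * s ^ l)) \<le> 
       (\<Sum>(k,l)\<in>{..m}\<times>{..m}. norm (gcoeff G k l) * R ^ k * R ^ l * (r / R + (s / R)\<^sup>2))"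
      unfolding case_prod_unfold by (intro sum_mono summand)
    also have "\<dots> = wsum R m (Rep_germ G) * (r / R + (s / R)\<^sup>2)"
      by (simp add: wsum_altdef gcoeff.rep_eq sum_distrib_right case_prod_unfold)
    also have "\<dots> \<le> D * (r / R + (s / R)\<^sup>2)" using R r by (intro mult_right_mono D) auto
    also have "\<dots> \<le> s" unfolding distrib_left using sD rD by linarith
    finally show ?thesis .
  qed
  then show ?thesis using that r s by blast
qed

text \<open>
  The difference is \<open>u - v\<close> times a germ that vanishes at the origin, because \<open>G\<close> has no linear term in \<open>y\<close>.
\<close>

lemma gsubst_contracts:
  assumes G: "gcoeff G 0 1 = 0" and u: "xonly u" "vanishes u" and v: "xonly v" "vanishes v"
    and d: "ord_ge (u - v) d"
  shows "ord_ge (gsubst G gX u - gsubst G gX v) (Suc d)"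
proof -
  define H where "H = gsubst G gX (v + gY)"
  have van: "vanishes (v + gY)" "vanishes (u - v)" using u v by (auto intro: vanishes_add vanishes_diff)
  have H0: "gsubst H gX 0 = gsubst G gX v" and Hu: "gsubst H gX (u - v) = gsubst G gX u"
    using u v van by (simp_all add: H_def gsubst_gsubst gsubst_add)
  define H1 where "H1 = shiftY (H - gsubst H gX 0)"
  have H1: "H - gsubst H gX 0 = gY * H1" 
    by (rule germ_eqI) (auto simp: H1_def gcoeff_gY_mult gcoeff_gsubst_gX_0)
  have "gcoeff H1 0 0 = gcoeff (dY H) 0 0" by (simp add: H1_def gcoeff_dY gcoeff_gsubst_gX_0)
  also have "dY H = gsubst (dY G) gX (v + gY)" using v van by (simp add: H_def dY_gsubst dY_add xonly_def)
  also have "gcoeff \<dots> 0 0 = 0" using van G by (simp add: gcoeff_gsubst gcoeff_dY)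
  finally have "vanishes H1" by (simp add: vanishes_def)
  have x: "xonly (gsubst H gX 0)" by (auto simp: xonly_iff gcoeff_gsubst_gX_0)
  have "gsubst (H - gsubst H gX 0) gX (u - v) = gsubst G gX u - gsubst G gX v"
    using x van by (simp add: gsubst_diff Hu) (simp add: H0)
  then have "gsubst G gX u - gsubst G gX v = (u - v) * gsubst H1 gX (u - v)"
    using van by (simp add: H1 gsubst_mult)
  moreover have "ord_ge (gsubst H1 gX (u - v)) 1"
    unfolding vanishes_iff_ord_ge[symmetric] using \<open>vanishes H1\<close> van by simp
  then have "ord_ge ((u - v) * gsubst H1 gX (u - v)) (d + 1)" by (rule ord_ge_mult[OF d])
  ultimately show ?thesis by simp
qed

lemma fixpoint_germ:
  assumes G: "gcoeff G 0 0 = 0" "gcoeff G 0 1 = 0"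
  obtains s where "xonly s" "vanishes s" "gsubst G gX s = s"
proof -
  obtain r \<rho> where r: "r > 0" "\<rho> > 0" 
    and bound: "\<And>m. (\<Sum>(k,l)\<in>{..m}\<times>{..m}. norm (gcoeff G k l) * (r ^ k * \<rho> ^ l)) \<le> \<rho>"
    using small_polydisc[OF G] by blast
  define u where "u = rec_nat 0 (\<lambda>_. gsubst G gX)"
  have u0: "u 0 = 0" and uS: "u (Suc N) = gsubst G gX (u N)" for N by (simp_all add: u_def)
  have ux: "xonly (u N) \<and> vanishes (u N)" for N
  proof (induction N)
    case (Suc N)
    then have "xonly (gsubst G gX (u N))" by (intro xonly_gsubst) auto
    moreover have "vanishes G" using G by (simp add: vanishes_def)
    ultimately show ?case using Suc by (simp add: uS)
  qed (simp add: u0)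
  have wu: "wsum r m (Rep_germ (u N)) \<le> \<rho>" for N m
  proof (induction N)
    case 0
    then show ?case using r by (simp add: u0 zero_germ.rep_eq wsum_altdef)
  next
    case (Suc N)
    have "wsum r m (Rep_germ (gsubst G gX (u N))) \<le> 
        (\<Sum>(k,l)\<in>{..2*m}\<times>{..2*m}. norm (gcoeff G k l) * (r ^ k * \<rho> ^ l))"
      by (rule wsum_gsubst_gX_le) (use ux Suc r in auto)
    also have "\<dots> \<le> \<rho>" by (rule bound)
    finally show ?case by (simp only: uS)
  qed
  have step: "ord_ge (u (Suc N) - u N) (Suc N)" for N
  proof (induction N)
    case 0
    have "vanishes (u (Suc 0))" using ux by blast
    then show ?case by (simp add: u0 vanishes_iff_ord_ge)
  next
    case (Suc N)
    have "ord_ge (gsubst G gX (u (Suc N)) - gsubst G gX (u N)) (Suc (Suc N))"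
      by (rule gsubst_contracts) (use G ux Suc in auto)
    then show ?case by (simp only: uS)
  qed
  have stable: "ord_ge (u (N + k) - u N) (Suc N)" for N k
  proof (induction k)
    case (Suc k)
    have "ord_ge ((u (Suc (N + k)) - u (N + k)) + (u (N + k) - u N)) (Suc N)"
      by (intro ord_ge_add Suc ord_ge_mono[OF step]) auto
    then show ?case by simp
  qed simp
  define c where "c = (\<lambda>i. gcoeff (u i) i 0)"
  \<comment> \<open>the limit: its coefficient of \<open>x^i\<close> is that of the \<open>i\<close>-th iterate and of all later ones\<close>
  define F where "F = fps_const (Abs_fps c)"
  have coeff_u: "gcoeff (u N) i j = (if j = 0 then c i else 0)" if "i \<le> N" for N i j
    using ux[of N] stable[of i "N - i"] that by (auto simp: xonly_iff ord_ge_def c_def)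
  have "wsum r m F \<le> wsum r m (Rep_germ (u m))" for m
  proof -
    have "Rep_germ (u m) $ j $ i = gcoeff (u m) i j" for i j by (simp add: gcoeff.rep_eq)
    then show ?thesis unfolding wsum_altdef using r by (intro sum_mono) (auto simp: F_def coeff_u)
  qed
  then have "wsum r m F \<le> \<rho>" for m using wu order_trans by blast
  then have F: "convergent2 F" unfolding convergent2_iff using r by blast
  define s where "s = Abs_germ F"
  have s: "gcoeff s i j = (if j = 0 then c i else 0)" for i j
    using F by (simp add: s_def gcoeff.rep_eq Abs_germ_inverse) (simp add: F_def)
  have sx: "xonly s" "vanishes s" by (auto simp: xonly_iff s vanishes_def c_def u0)
  have su: "ord_ge (s - u N) (Suc N)" for N by (auto simp: ord_ge_def s coeff_u)
  have "gsubst G gX s - s = 0"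
  proof (rule eq_0_if_ord_ge)
    fix d
    have "ord_ge (gsubst G gX s - gsubst G gX (u d)) (Suc (Suc d))"
      using sx ux su by (intro gsubst_contracts G) auto
    then have "ord_ge (gsubst G gX s - u (Suc d)) d" unfolding uS by (rule ord_ge_mono) simp
    moreover have "ord_ge (s - u (Suc d)) d" by (rule ord_ge_mono[OF su]) simp
    ultimately have "ord_ge ((gsubst G gX s - u (Suc d)) - (s - u (Suc d))) d" by (rule ord_ge_diff)
    then show "ord_ge (gsubst G gX s - s) d" by simp
  qed
  then show ?thesis using that sx by simp
qed

lemma implicit_function:
  assumes f: "gcoeff f 0 0 = 0" "gcoeff f 0 1 \<noteq> 0"
  obtains s where "xonly s" "vanishes s" "gsubst f gX s = 0"
proof -
  define c where "c = gcoeff f 0 1"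
  define G where "G = gY - gconst (1 / c) * f"
  have "gcoeff G 0 0 = 0" "gcoeff G 0 1 = 0" using f by (simp_all add: G_def gcoeff_gY c_def)
  then obtain s where s: "xonly s" "vanishes s" "gsubst G gX s = s" using fixpoint_germ by blast
  then have "gconst (1 / c) * gsubst f gX s = 0" by (simp add: G_def gsubst_diff gsubst_mult)
  then have "gsubst f gX s = 0" using f by (simp add: c_def)
  then show ?thesis using that s by blast
qed

section \<open>Puiseux parametrizations\<close>

lemma gcoeff_dY_funpow: "fact j * gcoeff ((dY ^^ k) f) i j = fact (j + k) * gcoeff f i (j + k)"
proof (induction k arbitrary: j)
  case (Suc k)
  have "fact j * gcoeff ((dY ^^ Suc k) f) i j = fact (Suc j) * gcoeff ((dY ^^ k) f) i (Suc j)"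
    by (simp add: gcoeff_dY)
  then show ?case using Suc[of "Suc j"] by (simp add: mult_ac)
qed simp

lemma dY_funpow_gsubst: "xonly s \<Longrightarrow> vanishes s \<Longrightarrow> (dY ^^ k) (gsubst f gX (gY + s)) = gsubst ((dY ^^ k) f) gX (gY + s)"
  by (induction k) (simp_all add: dY_gsubst vanishes_add dY_add xonly_def)

text \<open>
  The shift that kills the coefficient of \<open>y^(N-1)\<close>: it is given by the root of the derivative of
  order \<open>N - 1\<close>, which is regular of order one in \<open>y\<close>.
\<close>

lemma tschirnhaus:
  assumes N: "N \<ge> 2" and f: "\<And>j. j < N \<Longrightarrow> gcoeff f 0 j = 0" "gcoeff f 0 N \<noteq> 0"
  obtains s where "xonly s" "vanishes s" "\<And>i. gcoeff (gsubst f gX (gY + s)) i (N - 1) = 0"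
    "\<And>j. gcoeff (gsubst f gX (gY + s)) 0 j = gcoeff f 0 j"
proof -
  define h where "h = (dY ^^ (N - 1)) f"
  have "gcoeff h 0 0 = 0" "gcoeff h 0 1 \<noteq> 0"
    using gcoeff_dY_funpow[of 0 "N - 1" f 0] gcoeff_dY_funpow[of 1 "N - 1" f 0] N f by (auto simp: h_def)
  then obtain s where s: "xonly s" "vanishes s" "gsubst h gX s = 0" by (rule implicit_function)
  define g where "g = gsubst f gX (gY + s)"
  have v: "vanishes (gY + s)" using s by (intro vanishes_add) auto
  have "gsubst ((dY ^^ (N - 1)) g) gX 0 = gsubst h gX s"
    using s v by (simp add: g_def dY_funpow_gsubst h_def gsubst_gsubst gsubst_add)
  then have "gcoeff ((dY ^^ (N - 1)) g) i 0 = 0" for i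
    using s(3) gcoeff_gsubst_gX_0[of "(dY ^^ (N - 1)) g" i 0] by simp
  then have "gcoeff g i (N - 1) = 0" for i
    using gcoeff_dY_funpow[of 0 "N - 1" g i] by simp
  moreover have "gcoeff g 0 j = gcoeff f 0 j" for j
  proof -
    have "gcoeff s 0 j = 0" for j using s by (cases "j = 0") (auto simp: xonly_iff vanishes_def)
    then have "gsubst s 0 gY = 0" by (intro germ_eqI) (auto simp: gcoeff_gsubst_0_gY)
    then have "gsubst g 0 gY = gsubst f 0 gY"
      using s v by (simp add: g_def gsubst_gsubst gsubst_add)
    then show ?thesis using gcoeff_gsubst_0_gY[of g 0 j] gcoeff_gsubst_0_gY[of f 0 j] by simp
  qed
  ultimately show ?thesis using that s by (simp add: g_def)
qed

lemma gcoeff_mult_gY_power: "gcoeff (f * gY ^ n) i j = (if j < n then 0 else gcoeff f i (j - n))"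
  using gcoeff_gY_power_mult[of n f i j] by (simp add: mult.commute)

definition ycoeff :: "germ \<Rightarrow> nat \<Rightarrow> germ" where
  "ycoeff f j = gsubst ((shiftY ^^ j) f) gX 0"

lemma gcoeff_shiftY_funpow: "gcoeff ((shiftY ^^ k) f) i j = gcoeff f i (j + k)"
  by (induction k arbitrary: j) auto

lemma gcoeff_ycoeff: "gcoeff (ycoeff f j) i l = (if l = 0 then gcoeff f i j else 0)"
  by (simp add: ycoeff_def gcoeff_gsubst_gX_0 gcoeff_shiftY_funpow)

lemma xonly_ycoeff [simp]: "xonly (ycoeff f j)"
  by (auto simp: xonly_iff gcoeff_ycoeff)

lemma y_expansion: "f = (\<Sum>j<N. ycoeff f j * gY ^ j) + (shiftY ^^ N) f * gY ^ N"
proof (rule germ_eqI)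
  fix i l
  have "(\<Sum>j<N. gcoeff (ycoeff f j * gY ^ j) i l) = (\<Sum>j<N. if j = l then gcoeff f i l else 0)"
    by (intro sum.cong) (auto simp: gcoeff_mult_gY_power gcoeff_ycoeff)
  then show "gcoeff f i l = gcoeff ((\<Sum>j<N. ycoeff f j * gY ^ j) + (shiftY ^^ N) f * gY ^ N) i l"
    by (auto simp: gcoeff_mult_gY_power gcoeff_shiftY_funpow)
qed

lemma gcoeff_gY_gconst_power:
  "gcoeff (gconst a * (gY + gconst c) ^ n) i j = (if i = 0 then a * coeff ([:c, 1:] ^ n) j else 0)"
proof -
  have "gcoeff ((gY + gconst c) ^ n) i j = (if i = 0 then coeff ([:c, 1:] ^ n) j else 0)"
  proof (induction n arbitrary: i j)
    case 0
    then show ?case by (auto simp: gcoeff_1)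
  next
    case (Suc n)
    show ?case unfolding power_Suc distrib_right
      by (auto simp: Suc gcoeff_gY_mult coeff_pCons split: nat.splits)
  qed
  then show ?thesis by simp
qed

lemma pcompose_monom: "pcompose (monom a n) q = smult a (q ^ n)"
  by (induction n) (simp_all add: monom_0 monom_Suc pcompose_pCons)

text \<open>
  The substitution \<open>x = t^e\<close>, \<open>y = t^p (c + y)\<close> belonging to an edge of slope \<open>p / e\<close> of the Newton diagram. The
  hypothesis that no term lies below the edge allows to divide by \<open>t^(p N)\<close>; on \<open>t = 0\<close> there remains the polynomial
  of the terms on the edge, with \<open>c + y\<close> as its argument.
\<close>

lemma puiseux_shift:
  assumes e: "e \<ge> 1" and p: "p \<ge> 1"
    and low: "\<And>i j. j < N \<Longrightarrow> gcoeff g i j \<noteq> 0 \<Longrightarrow> p * (N - j) \<le> e * i"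
  defines "a \<equiv> (\<lambda>j. if e dvd p * (N - j) then gcoeff g (p * (N - j) div e) j else 0)"
  obtains h where "gsubst g (gX ^ e) (gX ^ p * (gY + gconst c)) = gX ^ (p * N) * h"
    "\<And>m. gcoeff h 0 m = coeff (pcompose (\<Sum>j\<le>N. monom (a j) j) [:c, 1:]) m"
proof -
  define Y where "Y = gX ^ p * (gY + gconst c)"
  have v: "vanishes (gX ^ e)" "vanishes Y" using e p by (auto simp: Y_def)
  have Y: "Y ^ j = gX ^ (p * j) * (gY + gconst c) ^ j" for j
    by (simp add: Y_def power_mult_distrib power_mult)
  have "\<exists>h. gsubst (ycoeff g j) (gX ^ e) gY = gX ^ (p * (N - j)) * h \<and> gcoeff h 0 0 = a j \<and> xonly h" if j: "j < N" for j
  proof -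
    have "gX ^ (p * (N - j)) dvd gsubst (ycoeff g j) (gX ^ e) gY"
      unfolding gX_power_dvd_iff
    proof (intro allI impI)
      fix i l assume i: "i < p * (N - j)"
      have "\<not> p * (N - j) \<le> e * (i div e)" using i times_div_less_eq_dividend[of e i] by linarith
      then have "gcoeff g (i div e) j = 0" using low[OF j, of "i div e"] by blast
      then show "gcoeff (gsubst (ycoeff g j) (gX ^ e) gY) i l = 0"
        using e by (simp add: gcoeff_ramify gcoeff_ycoeff)
    qed
    then obtain h where h: "gsubst (ycoeff g j) (gX ^ e) gY = gX ^ (p * (N - j)) * h" by (auto simp: dvd_def)
    have "gcoeff h i l = gcoeff (gsubst (ycoeff g j) (gX ^ e) gY) (i + p * (N - j)) l" for i l
      by (simp add: h gcoeff_gX_power_mult)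
    then have "gcoeff h i l = (if e dvd i + p * (N - j) then gcoeff (ycoeff g j) ((i + p * (N - j)) div e) l else 0)" for i l
      using e by (simp add: gcoeff_ramify)
    then have "gcoeff h 0 0 = a j" "xonly h" by (auto simp: gcoeff_ycoeff a_def xonly_iff)
    then show ?thesis using h by blast
  qed
  then obtain h where h: "\<And>j. j < N \<Longrightarrow> gsubst (ycoeff g j) (gX ^ e) gY = gX ^ (p * (N - j)) * h j"
    "\<And>j. j < N \<Longrightarrow> gcoeff (h j) 0 0 = a j" "\<And>j. j < N \<Longrightarrow> xonly (h j)" by metis
  define r where "r = gsubst ((shiftY ^^ N) g) (gX ^ e) Y"
  define H where "H = (\<Sum>j<N. h j * (gY + gconst c) ^ j) + r * (gY + gconst c) ^ N"
  have "gsubst g (gX ^ e) Y = (\<Sum>j<N. gsubst (ycoeff g j) (gX ^ e) Y * Y ^ j) + r * Y ^ N"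
    by (subst y_expansion[of g N]) (simp only: gsubst_add[OF v] gsubst_sum[OF v] gsubst_mult[OF v] gsubst_power[OF v] gsubst_gY[OF v] r_def)
  also have "(\<Sum>j<N. gsubst (ycoeff g j) (gX ^ e) Y * Y ^ j) = (\<Sum>j<N. gX ^ (p * N) * (h j * (gY + gconst c) ^ j))"
  proof (intro sum.cong refl)
    fix j assume j: "j \<in> {..<N}"
    have "gsubst (ycoeff g j) (gX ^ e) Y = gX ^ (p * (N - j)) * h j"
      using gsubst_xonly_cong[of "ycoeff g j" "gX ^ e" Y gY] h(1)[of j] v j by simp
    moreover have "p * N = p * (N - j) + p * j" using j by (simp add: distrib_left[symmetric])
    then have "gX ^ (p * N) = gX ^ (p * (N - j)) * gX ^ (p * j)" by (simp only: power_add)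
    ultimately show "gsubst (ycoeff g j) (gX ^ e) Y * Y ^ j = gX ^ (p * N) * (h j * (gY + gconst c) ^ j)"
      by (simp only: Y mult_ac)
  qed
  also have "\<dots> + r * Y ^ N = gX ^ (p * N) * H"
    by (simp only: H_def Y sum_distrib_left distrib_left mult_ac)
  finally have main: "gsubst g (gX ^ e) Y = gX ^ (p * N) * H" .
  have h0: "gsubst (h j) 0 gY = gconst (a j)" if "j < N" for j
    using h(2,3)[OF that] by (intro germ_eqI) (auto simp: gcoeff_gsubst_0_gY gcoeff_gconst xonly_iff)
  have r0: "gsubst r 0 gY = gconst (a N)"
  proof -
    have "gsubst (gX ^ e) 0 gY = 0" "gsubst Y 0 gY = 0" 
      using e p by (simp_all add: Y_def gsubst_mult gsubst_power)
    then have "gsubst r 0 gY = gsubst ((shiftY ^^ N) g) 0 0" using v by (simp add: r_def gsubst_gsubst)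
    also have "\<dots> = gsubst (gsubst ((shiftY ^^ N) g) gX 0) 0 gY" by (simp add: gsubst_gsubst)
    also have "\<dots> = gconst (a N)"
      by (rule germ_eqI) (auto simp: gcoeff_gsubst_0_gY gcoeff_gsubst_gX_0 gcoeff_gconst gcoeff_shiftY_funpow a_def)
    finally show ?thesis .
  qed
  have "gsubst H 0 gY = (\<Sum>j<N. gconst (a j) * (gY + gconst c) ^ j) + gconst (a N) * (gY + gconst c) ^ N"
    by (simp add: H_def gsubst_add gsubst_sum gsubst_mult gsubst_power h0 r0)
  also have "\<dots> = (\<Sum>j\<le>N. gconst (a j) * (gY + gconst c) ^ j)" by (simp add: lessThan_Suc_atMost[symmetric])
  finally have H0: "gsubst H 0 gY = (\<Sum>j\<le>N. gconst (a j) * (gY + gconst c) ^ j)" .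
  have "gcoeff H 0 m = coeff (pcompose (\<Sum>j\<le>N. monom (a j) j) [:c, 1:]) m" for m
  proof -
    have "gcoeff H 0 m = gcoeff (gsubst H 0 gY) 0 m" by (simp add: gcoeff_gsubst_0_gY)
    also have "\<dots> = (\<Sum>j\<le>N. a j * coeff ([:c, 1:] ^ j) m)" by (simp only: H0 gcoeff_sum gcoeff_gY_gconst_power) simp
    also have "\<dots> = coeff (pcompose (\<Sum>j\<le>N. monom (a j) j) [:c, 1:]) m"
      by (simp add: pcompose_sum pcompose_monom coeff_sum)
    finally show ?thesis .
  qed
  then show ?thesis using that main Y_def by blast
qed

lemma coeff_pcompose_order:
  fixes P :: "complex poly"
  assumes "P \<noteq> 0"
  shows "j < order c P \<Longrightarrow> coeff (pcompose P [:c, 1:]) j = 0" 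
    and "coeff (pcompose P [:c, 1:]) (order c P) \<noteq> 0"
proof -
  obtain S where S: "P = [:-c, 1:] ^ order c P * S" "\<not> [:-c, 1:] dvd S"
    using order_decomp[OF assms, of c] by blast
  have "pcompose ([:-c, 1:] ^ n) [:c, 1:] = monom 1 n" for n :: nat
  proof (induction n)
    case (Suc n)
    have "pcompose [:-c, 1:] [:c, 1:] = [:0, 1:]" by (simp add: pcompose_pCons)
    then show ?case by (simp only: power_Suc pcompose_mult Suc) (simp add: monom_Suc)
  qed (simp add: pcompose_1)
  then have *: "pcompose P [:c, 1:] = monom 1 (order c P) * pcompose S [:c, 1:]"
    by (subst S(1)) (simp add: pcompose_mult)
  show "coeff (pcompose P [:c, 1:]) j = 0" if "j < order c P"
    using that by (simp add: * coeff_monom_mult)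
  have "poly S c \<noteq> 0" using S(2) by (simp add: poly_eq_0_iff_dvd)
  moreover have "coeff (pcompose P [:c, 1:]) (order c P) = poly S c"
    by (simp add: * coeff_monom_mult)
  ultimately show "coeff (pcompose P [:c, 1:]) (order c P) \<noteq> 0" by simp
qed

text \<open>
  If \<open>c\<close> were a root of multiplicity \<open>N\<close>, the polynomial would be \<open>b (y - c)^N\<close>. As it has no term in \<open>y^(N-1)\<close>,
  \<open>c\<close> would be \<open>0\<close>, and there would be no terms of degree less than \<open>N\<close>.
\<close>

lemma root_of_lower_order:
  fixes P :: "complex poly"
  assumes N: "N \<ge> 1" and deg: "degree P = N" and zero: "coeff P (N - 1) = 0" and j: "j < N" "coeff P j \<noteq> 0"
  obtains c where "1 \<le> order c P" "order c P < N"
proof -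
  have "\<not> constant (poly P)" using deg N by (simp add: constant_degree)
  then obtain c where c: "poly P c = 0" using fundamental_theorem_of_algebra by blast
  have P: "P \<noteq> 0" using j by auto
  have "order c P \<noteq> N"
  proof
    assume ord: "order c P = N"
    obtain S where S: "P = [:-c, 1:] ^ N * S" using order_1[of c P] ord by (auto simp: dvd_def)
    have "S \<noteq> 0" using P S by auto
    then have "degree S = 0" using deg S by (simp add: degree_mult_eq degree_power_eq)
    then obtain b where b: "S = [:b:]" by (meson degree_eq_zeroE)
    have P': "P = smult b ([:-c, 1:] ^ N)" by (simp add: S b)
    have "coeff ([:-c, 1:] ^ N) (N - 1) = of_nat N * (-c)"
      using N binomial_symmetric[of 1 N] by (simp add: coeff_linear_poly_power)
    then have "c = 0" using zero N P P' by auto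
    then have "coeff P j = 0" using j(1) by (simp add: P' coeff_linear_poly_power)
    then show False using j by simp
  qed
  moreover have "order c P \<le> N" using order_degree[OF P] deg by simp
  moreover have "order c P \<noteq> 0" using c P by (simp add: order_root)
  ultimately show ?thesis using that[of c] by simp
qed

text \<open>
  Existence of a Puiseux root, by induction on the order \<open>N\<close> of \<open>f(0,y)\<close>. After a shift the
  coefficient of \<open>y^(N-1)\<close> vanishes, so the polynomial read on the first edge of the Newton polygon is
  not a power of a linear form: each of its roots is a point where the order is smaller.
\<close>

lemma puiseux_root:
  assumes "N \<ge> 1" "\<And>j. j < N \<Longrightarrow> gcoeff f 0 j = 0" "gcoeff f 0 N \<noteq> 0"
  shows "\<exists>e s. e \<ge> 1 \<and> xonly s \<and> vanishes s \<and> gsubst f (gX ^ e) s = 0"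
  using assms
proof (induction N arbitrary: f rule: less_induct)
  case (less N)
  show ?case
  proof (cases "N = 1")
    case True
    then have "gcoeff f 0 0 = 0" "gcoeff f 0 1 \<noteq> 0" using less.prems by auto
    then obtain s where "xonly s" "vanishes s" "gsubst f gX s = 0" by (rule implicit_function)
    then show ?thesis by (intro exI[of _ 1] exI[of _ s]) simp
  next
    case False
    then have N: "N \<ge> 2" using less.prems by simp
    obtain \<phi> where \<phi>: "xonly \<phi>" "vanishes \<phi>" and g1: "\<And>i. gcoeff (gsubst f gX (gY + \<phi>)) i (N - 1) = 0"
      and g0: "\<And>j. gcoeff (gsubst f gX (gY + \<phi>)) 0 j = gcoeff f 0 j"
      using tschirnhaus[OF N less.prems(2,3)] by blast
    define g where "g = gsubst f gX (gY + \<phi>)"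
    have v\<phi>: "vanishes (gY + \<phi>)" using \<phi> by (intro vanishes_add) auto
    have unshift: "gsubst g (gX ^ e) s = gsubst f (gX ^ e) (s + gsubst \<phi> (gX ^ e) gY)"
      if "e \<ge> 1" "vanishes s" for e s
    proof -
      have "gsubst \<phi> (gX ^ e) s = gsubst \<phi> (gX ^ e) gY"
        using that by (intro gsubst_xonly_cong \<phi>) auto
      then show ?thesis using that v\<phi> by (simp add: g_def gsubst_gsubst gsubst_add)
    qed
    have root: ?thesis if "e \<ge> 1" "xonly s" "vanishes s" "gsubst g (gX ^ e) s = 0" for e s
      using that \<phi> unshift[of e s]
      by (intro exI[of _ e] exI[of _ "s + gsubst \<phi> (gX ^ e) gY"])
         (auto intro!: xonly_closed xonly_gsubst(2) vanishes_add)
    show ?thesis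
    proof (cases "\<forall>i j. j < N \<longrightarrow> gcoeff g i j = 0")
      case True
      then have "gsubst g gX 0 = 0" using N by (intro germ_eqI) (auto simp: gcoeff_gsubst_gX_0)
      then show ?thesis using root[of 1 0] by simp
    next
      case False
      \<comment> \<open>a point of smallest slope \<open>i / (N - j)\<close> of the Newton diagram\<close>
      define D where "D = {(i, j). j < N \<and> gcoeff g i j \<noteq> 0}"
      define q where "q = (\<lambda>(i, j). real i / real (N - j))"
      have "\<exists>x\<in>D. \<forall>y\<in>D. q x \<le> q y"
      proof -
        obtain i1 j1 where D1: "(i1, j1) \<in> D" using False by (auto simp: D_def)
        define B where "B = {x \<in> D. q x \<le> q (i1, j1)}"
        have "B \<subseteq> {..i1 * N} \<times> {..<N}"
        proof
          fix x assume "x \<in> B"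
          obtain i j where x: "x = (i, j)" by (cases x)
          have j: "j < N" "j1 < N" using \<open>x \<in> B\<close> D1 by (auto simp: B_def D_def x)
          have "real i / real (N - j) \<le> real i1 / real (N - j1)" using \<open>x \<in> B\<close> by (simp add: B_def q_def x)
          then have "real i * real (N - j1) \<le> real i1 * real (N - j)" using j by (simp add: field_simps)
          then have "i * (N - j1) \<le> i1 * (N - j)" by (metis of_nat_le_iff of_nat_mult)
          moreover have "i \<le> i * (N - j1)" using j by (cases "N - j1") auto
          moreover have "i1 * (N - j) \<le> i1 * N" by simp
          ultimately have "i \<le> i1 * N" by linarith
          then show "x \<in> {..i1 * N} \<times> {..<N}" using j x by simp
        qed
        then have fin: "finite B" by (rule finite_subset) auto
        have "B \<noteq> {}" using D1 by (auto simp: B_def)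
        define x where "x = arg_min_on q B"
        have x: "x \<in> B" "\<And>y. y \<in> B \<Longrightarrow> q x \<le> q y"
          using fin \<open>B \<noteq> {}\<close> by (auto simp: x_def arg_min_if_finite arg_min_least)
        have "q x \<le> q y" if "y \<in> D" for y
          using x that by (cases "y \<in> B") (auto simp: B_def)
        moreover have "x \<in> D" using x by (simp add: B_def)
        ultimately show ?thesis by blast
      qed
      then obtain p j0 where D0: "(p, j0) \<in> D" and min: "\<And>y. y \<in> D \<Longrightarrow> q (p, j0) \<le> q y" by auto
      have j0: "j0 < N" "gcoeff g p j0 \<noteq> 0" using D0 by (auto simp: D_def)
      define e where "e = N - j0"
      have e: "e \<ge> 1" using j0 by (simp add: e_def)
      have p: "p \<ge> 1" using j0 g0[of j0] less.prems(2)[of j0] by (cases p) (auto simp: g_def)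
      have low: "p * (N - j) \<le> e * i" if "j < N" "gcoeff g i j \<noteq> 0" for i j
      proof -
        have "real p / real e \<le> real i / real (N - j)" using min[of "(i, j)"] that by (simp add: D_def q_def e_def)
        then have "real p * real (N - j) \<le> real e * real i" using e that by (simp add: field_simps)
        then show ?thesis by (metis of_nat_le_iff of_nat_mult)
      qed
      define a where "a = (\<lambda>j. if e dvd p * (N - j) then gcoeff g (p * (N - j) div e) j else 0)"
      define P where "P = (\<Sum>j\<le>N. monom (a j) j)"
      have coeffP: "coeff P j = (if j \<le> N then a j else 0)" for j
        by (simp add: P_def coeff_sum)
      have aN: "a N \<noteq> 0" using less.prems(3) g0[of N] by (simp add: a_def g_def)
      have degP: "degree P = N"
        by (rule antisym[OF degree_le le_degree]) (auto simp: coeffP aN)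
      have "coeff P (N - 1) = 0" using g1 by (simp add: coeffP a_def g_def)
      moreover have "coeff P j0 \<noteq> 0" using j0 e by (simp add: coeffP a_def e_def)
      ultimately obtain c where c: "1 \<le> order c P" "order c P < N"
        using root_of_lower_order[OF less.prems(1) degP _ j0(1)] by blast
      obtain h where h: "gsubst g (gX ^ e) (gX ^ p * (gY + gconst c)) = gX ^ (p * N) * h"
        "\<And>m. gcoeff h 0 m = coeff (pcompose P [:c, 1:]) m"
        using puiseux_shift[OF e p low, where c = c] unfolding P_def a_def by blast
      have "P \<noteq> 0" using aN coeffP[of N] by auto
      then have "\<And>j. j < order c P \<Longrightarrow> gcoeff h 0 j = 0" "gcoeff h 0 (order c P) \<noteq> 0"
        unfolding h(2) using coeff_pcompose_order by blast+
      from less.IH[OF c(2) c(1) this] obtain e' s where es: "e' \<ge> 1" "xonly s" "vanishes s" "gsubst h (gX ^ e') s = 0"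
        by blast
      have v: "vanishes (gX ^ e)" "vanishes (gX ^ p * (gY + gconst c))" "vanishes (gX ^ e')" 
        using e p es by auto
      have "gsubst (gsubst g (gX ^ e) (gX ^ p * (gY + gconst c))) (gX ^ e') s = 0"
        using es v unfolding h by (simp add: gsubst_mult)
      then have "gsubst g (gX ^ (e' * e)) (gX ^ (e' * p) * (s + gconst c)) = 0"
        using es v by (simp add: gsubst_gsubst gsubst_power gsubst_mult gsubst_add power_mult)
      moreover have "xonly (gX ^ (e' * p) * (s + gconst c))" using es by (intro xonly_closed(1,3,5)) auto
      ultimately show ?thesis
        using root[of "e' * e" "gX ^ (e' * p) * (s + gconst c)"] e p es by auto
    qed
  qed
qed

section \<open>Ramified irreducible germs\<close>

abbreviation twist :: "complex \<Rightarrow> germ \<Rightarrow> germ" where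
  "twist \<zeta> f \<equiv> gsubst f (gconst \<zeta> * gX) gY"

abbreviation ramify :: "nat \<Rightarrow> germ \<Rightarrow> germ" where
  "ramify n f \<equiv> gsubst f (gX ^ n) gY"

lemma ramify_eq_iff: "n \<ge> 1 \<Longrightarrow> ramify n f = ramify n g \<longleftrightarrow> f = g"
proof
  assume n: "n \<ge> 1" and eq: "ramify n f = ramify n g"
  show "f = g"
  proof (rule germ_eqI)
    fix i j
    show "gcoeff f i j = gcoeff g i j"
      using gcoeff_ramify[OF n, of f "n * i" j] gcoeff_ramify[OF n, of g "n * i" j] n eq by simp
  qed
qed auto

lemma twist_twist: "twist \<zeta> (twist \<omega> f) = twist (\<omega> * \<zeta>) f"
  by (rule germ_eqI) (simp only: gcoeff_twist power_mult_distrib, simp only: mult_ac)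

lemma twist_ramify: "\<zeta> ^ n = 1 \<Longrightarrow> n \<ge> 1 \<Longrightarrow> twist \<zeta> (ramify n f) = ramify n f"
  by (rule germ_eqI) (auto simp: gcoeff_twist gcoeff_ramify power_mult)

lemma xonly_twist: "xonly s \<Longrightarrow> xonly (twist \<zeta> s)"
  by (intro xonly_gsubst) (auto intro: xonly_closed)

lemma gX_power_dvd_twist: "gX ^ m dvd s \<Longrightarrow> gX ^ m dvd twist \<zeta> s"
  by (simp add: gX_power_dvd_iff gcoeff_twist)

text \<open>There are too many \<open>n\<close>-th roots of unity for all of them to be \<open>r\<close>-th roots with \<open>0 < r < n\<close>.\<close>

lemma roots_unity_dvd:
  assumes n: "n \<ge> 1" and all: "\<And>\<zeta>::complex. \<zeta> ^ n = 1 \<Longrightarrow> \<zeta> ^ i = 1"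
  shows "n dvd i"
proof (rule ccontr)
  assume "\<not> n dvd i"
  define r where "r = i mod n"
  have r: "0 < r" "r < n" using \<open>\<not> n dvd i\<close> n by (auto simp: r_def dvd_eq_mod_eq_0)
  have "\<zeta> ^ r = 1" if "\<zeta> ^ n = 1" for \<zeta> :: complex
  proof -
    have "\<zeta> ^ i = (\<zeta> ^ n) ^ (i div n) * \<zeta> ^ r"
      by (simp add: r_def power_mult[symmetric] power_add[symmetric])
    then show ?thesis using all[OF that] that by simp
  qed
  then have "{\<zeta>::complex. \<zeta> ^ n = 1} \<subseteq> {\<zeta>. \<zeta> ^ r = 1}" by auto
  then have "card {\<zeta>::complex. \<zeta> ^ n = 1} \<le> card {\<zeta>::complex. \<zeta> ^ r = 1}"
    using r finite_roots_unity[of r] by (intro card_mono) auto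
  then show False using r n by (simp add: card_roots_unity_eq)
qed

text \<open>Invariance under the Galois group of \<open>x = t^n\<close>.\<close>

lemma descend_if_twist_invariant:
  assumes n: "n \<ge> 1" and inv: "\<And>\<zeta>. \<zeta> ^ n = 1 \<Longrightarrow> twist \<zeta> f = f"
  obtains g where "f = ramify n g"
proof (rule descend[OF n])
  fix i j assume "\<not> n dvd i"
  then obtain \<zeta> :: complex where \<zeta>: "\<zeta> ^ n = 1" "\<zeta> ^ i \<noteq> 1" using roots_unity_dvd[OF n] by blast
  have "gcoeff f i j = \<zeta> ^ i * gcoeff f i j" using inv[OF \<zeta>(1)] gcoeff_twist[of f \<zeta> i j] by simp
  then have "(1 - \<zeta> ^ i) * gcoeff f i j = 0" by (simp add: algebra_simps)
  then show "gcoeff f i j = 0" using \<zeta> by simp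
qed (rule that)

lemma prod_branches_dvd:
  assumes "finite A" "inj_on s A" "\<And>a. a \<in> A \<Longrightarrow> xonly (s a) \<and> vanishes (s a) \<and> gsubst f gX (s a) = 0"
  shows "(\<Prod>a\<in>A. gY - s a) dvd f"
  using assms
proof (induction A rule: finite_induct)
  case (insert a A)
  then have "(\<Prod>a\<in>A. gY - s a) dvd f" by simp
  then obtain q where q: "f = (\<Prod>a\<in>A. gY - s a) * q" by (auto simp: dvd_def)
  have a: "xonly (s a)" "vanishes (s a)" "gsubst f gX (s a) = 0" using insert.prems by auto
  have "(\<Prod>b\<in>A. s a - s b) * gsubst q gX (s a) = 0"
  proof -
    have "gsubst (gY - s b) gX (s a) = s a - s b" if "b \<in> A" for b
      using insert.prems(2)[of b] that a by (simp add: gsubst_diff)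
    then have "gsubst (\<Prod>b\<in>A. gY - s b) gX (s a) = (\<Prod>b\<in>A. s a - s b)" using a by (simp add: gsubst_prod)
    then show ?thesis using a(3) a(2) by (simp add: q gsubst_mult)
  qed
  moreover have "(\<Prod>b\<in>A. s a - s b) \<noteq> 0"
    using insert.hyps insert.prems(1) by (auto simp: inj_on_def)
  ultimately have "gY - s a dvd q" using a by (simp add: branch_dvd_iff)
  then show ?case using insert.hyps by (auto simp: q dvd_def mult_ac)
qed simp

lemma regular_in_y:
  assumes "\<not> gX dvd f" "vanishes f"
  obtains N where "N \<ge> 1" "\<And>j. j < N \<Longrightarrow> gcoeff f 0 j = 0" "gcoeff f 0 N \<noteq> 0"
proof -
  have ex: "\<exists>j. gcoeff f 0 j \<noteq> 0" using assms by (auto simp: gX_dvd_iff)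
  define N where "N = (LEAST j. gcoeff f 0 j \<noteq> 0)"
  have "gcoeff f 0 N \<noteq> 0" unfolding N_def by (rule LeastI_ex[OF ex])
  moreover have "gcoeff f 0 j = 0" if "j < N" for j using not_less_Least that unfolding N_def by blast
  moreover have "N \<ge> 1" using calculation assms by (cases N) (auto simp: vanishes_def)
  ultimately show ?thesis using that by blast
qed

text \<open>
  When the parameter \<open>t\<close> of a root \<open>s(t)\<close> of \<open>h(t^e,y)\<close> is chosen with \<open>e\<close> minimal, the conjugates
  \<open>s(\<zeta> t)\<close> are distinct: a coincidence would make \<open>s\<close> a series in a power of \<open>t\<close>.
\<close>

lemma conjugates_distinct:
  assumes e: "e \<ge> 1" and s: "xonly s" "vanishes s" "gsubst h (gX ^ e) s = 0"
    and min: "\<And>e' s'. e' \<ge> 1 \<Longrightarrow> xonly s' \<Longrightarrow> vanishes s' \<Longrightarrow> gsubst h (gX ^ e') s' = 0 \<Longrightarrow> e \<le> e'"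
    and \<zeta>: "\<zeta> ^ e = 1" "\<omega> ^ e = 1" and eq: "twist \<zeta> s = twist \<omega> s"
  shows "\<zeta> = \<omega>"
proof -
  have nz: "\<omega> \<noteq> 0" using \<zeta>(2) e by (metis power_0_left zero_neq_one not_one_le_zero)
  define \<xi> where "\<xi> = \<zeta> / \<omega>"
  have \<xi>e: "\<xi> ^ e = 1" using \<zeta> by (simp add: \<xi>_def power_divide)
  have \<xi>s: "\<xi> ^ i = 1" if "gcoeff s i 0 \<noteq> 0" for i
  proof -
    have "\<zeta> ^ i * gcoeff s i 0 = \<omega> ^ i * gcoeff s i 0"
      using arg_cong[OF eq, of "\<lambda>f. gcoeff f i 0"] by (simp add: gcoeff_twist)
    then show ?thesis using that nz by (simp add: \<xi>_def power_divide)
  qed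
  define d where "d = (LEAST d. d > 0 \<and> \<xi> ^ d = 1)"
  have d: "d > 0" "\<xi> ^ d = 1"
    using LeastI[of "\<lambda>d. d > 0 \<and> \<xi> ^ d = 1" e] e \<xi>e by (auto simp: d_def)
  have dvd: "d dvd k" if "\<xi> ^ k = 1" for k
  proof -
    have "\<xi> ^ k = (\<xi> ^ d) ^ (k div d) * \<xi> ^ (k mod d)"
      by (simp add: power_mult[symmetric] power_add[symmetric])
    then have "\<xi> ^ (k mod d) = 1" using that d by simp
    moreover have "k mod d < d" using d by simp
    ultimately have "k mod d = 0" using not_less_Least[of "k mod d" "\<lambda>d. d > 0 \<and> \<xi> ^ d = 1"] by (auto simp: d_def)
    then show ?thesis by auto
  qed
  have "gcoeff s i j = 0" if "\<not> d dvd i" for i j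
    using dvd \<xi>s that s(1) by (cases "j = 0") (auto simp: xonly_iff)
  then obtain \<sigma> where \<sigma>: "s = ramify d \<sigma>" using descend[of d s] d by (metis Suc_leI One_nat_def)
  have "gcoeff \<sigma> i j = gcoeff s (d * i) j" for i j using d by (simp add: \<sigma> gcoeff_ramify)
  then have \<sigma>x: "xonly \<sigma>" "vanishes \<sigma>" using s by (auto simp: xonly_iff vanishes_def)
  obtain e' where e': "e = d * e'" using dvd[OF \<xi>e] by (auto simp: dvd_def)
  have e'1: "e' \<ge> 1" using e e' by (cases e') auto
  have "ramify d (gsubst h (gX ^ e') \<sigma>) = gsubst h (gX ^ e) s"
    using d e'1 \<sigma>x by (simp add: gsubst_gsubst gsubst_power \<sigma> e' power_mult)
  also have "\<dots> = ramify d 0" using s d by simp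
  finally have "gsubst h (gX ^ e') \<sigma> = 0" using d by (subst (asm) ramify_eq_iff) auto
  then have "d * e' \<le> e'" using min[OF e'1 \<sigma>x] e' by simp
  then have "d = 1" using d e'1 by simp
  then show ?thesis using d nz by (simp add: \<xi>_def)
qed

text \<open>
  The product over the conjugates and its cofactor are both invariant under \<open>t\<close> to \<open>\<zeta> t\<close>. They come from a
  factorization of \<open>h\<close>, in which the cofactor must be the unit.
\<close>

lemma irreducible_split:
  assumes h: "irreducible h" "\<not> gX dvd h"
  obtains e s u where "e \<ge> 1" "xonly s" "vanishes s" "gsubst h (gX ^ e) s = 0" "\<not> vanishes u"
    "ramify e h = u * (\<Prod>\<zeta> | \<zeta> ^ e = 1. gY - twist \<zeta> s)"
proof -
  have "vanishes h" using h by (auto simp: irreducible_def is_unit_germ_iff)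
  then obtain N where "N \<ge> 1" "\<And>j. j < N \<Longrightarrow> gcoeff h 0 j = 0" "gcoeff h 0 N \<noteq> 0"
    by (rule regular_in_y[OF h(2)]) blast
  then have ex: "\<exists>e. e \<ge> 1 \<and> (\<exists>s. xonly s \<and> vanishes s \<and> gsubst h (gX ^ e) s = 0)"
    using puiseux_root by blast
  define e where "e = (LEAST e. e \<ge> 1 \<and> (\<exists>s. xonly s \<and> vanishes s \<and> gsubst h (gX ^ e) s = 0))"
  obtain s where e: "e \<ge> 1" and s: "xonly s" "vanishes s" "gsubst h (gX ^ e) s = 0"
    using LeastI_ex[OF ex] unfolding e_def by blast
  have min: "e \<le> e'" if "e' \<ge> 1" "xonly s'" "vanishes s'" "gsubst h (gX ^ e') s' = 0" for e' s'
    unfolding e_def using that by (intro Least_le) blast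
  define R where "R = {\<zeta>::complex. \<zeta> ^ e = 1}"
  have R: "finite R" using e finite_roots_unity[of e] by (simp add: R_def)
  define P where "P = (\<Prod>\<zeta>\<in>R. gY - twist \<zeta> s)"
  have inj: "inj_on (\<lambda>\<zeta>. twist \<zeta> s) R"
    using conjugates_distinct[OF e s] min by (auto simp: inj_on_def R_def)
  have root: "gsubst (ramify e h) gX (twist \<zeta> s) = 0" if "\<zeta> \<in> R" for \<zeta>
  proof -
    have "gsubst (ramify e h) gX (twist \<zeta> s) = gsubst h (gX ^ e) (twist \<zeta> s)"
      using e s by (simp add: gsubst_gsubst gsubst_power)
    also have "\<dots> = twist \<zeta> (gsubst h (gX ^ e) s)"
    proof -
      have "twist \<zeta> (gX ^ e) = gX ^ e"
        using that by (simp add: gsubst_power power_mult_distrib R_def gconst_power[symmetric])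
      moreover have "twist \<zeta> (gsubst h (gX ^ e) s) = gsubst h (twist \<zeta> (gX ^ e)) (twist \<zeta> s)"
        by (subst gsubst_gsubst) (use e s(2) in auto)
      ultimately show ?thesis by simp
    qed
    finally show ?thesis using s by simp
  qed
  have "P dvd ramify e h" unfolding P_def
    using R inj root s xonly_twist by (intro prod_branches_dvd) auto
  then obtain q where q: "ramify e h = P * q" by (auto simp: dvd_def)
  have twP: "twist \<omega> P = P" if \<omega>: "\<omega> ^ e = 1" for \<omega>
  proof -
    have nz: "\<omega> \<noteq> 0" using \<omega> e by (metis power_0_left zero_neq_one not_one_le_zero)
    have "twist \<omega> P = (\<Prod>\<zeta>\<in>R. gY - twist (\<zeta> * \<omega>) s)"
      by (simp add: P_def gsubst_prod gsubst_diff twist_twist)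
    also have "\<dots> = P" unfolding P_def
      by (rule prod.reindex_bij_witness[where i = "\<lambda>\<zeta>. \<zeta> / \<omega>" and j = "\<lambda>\<zeta>. \<zeta> * \<omega>"])
         (use nz \<omega> in \<open>auto simp: R_def power_mult_distrib power_divide\<close>)
    finally show ?thesis .
  qed
  have P0: "P \<noteq> 0" using R branch_nonzero[OF xonly_twist[OF s(1)]] by (auto simp: P_def)
  have twq: "twist \<omega> q = q" if \<omega>: "\<omega> ^ e = 1" for \<omega>
  proof -
    have "P * twist \<omega> q = twist \<omega> (ramify e h)" using twP[OF \<omega>] by (simp add: q gsubst_mult)
    also have "\<dots> = P * q" unfolding q[symmetric] by (rule twist_ramify[OF \<omega> e])
    finally show ?thesis using P0 by simp
  qed
  obtain H where H: "P = ramify e H" using descend_if_twist_invariant[OF e twP] by blast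
  obtain Q where Q: "q = ramify e Q" using descend_if_twist_invariant[OF e twq] by blast
  have v: "vanishes (gX ^ e)" using e by simp
  have "ramify e h = ramify e (H * Q)" using q H Q v by (simp add: gsubst_mult)
  then have hHQ: "h = H * Q" using ramify_eq_iff[OF e] by blast
  have "1 \<in> R" by (simp add: R_def)
  have "vanishes (\<Prod>\<zeta>\<in>R. gY - twist \<zeta> s)"
    using vanishes_dvd[OF dvd_prodI[OF R \<open>1 \<in> R\<close>, of "\<lambda>\<zeta>. gY - twist \<zeta> s"]] vanishes_diff[of gY s] s by simp
  then have "vanishes H" using H v by (simp add: P_def)
  then have "Q dvd 1" using irreducibleD[OF h(1) hHQ] by (auto simp: is_unit_germ_iff)
  then have "\<not> vanishes q" using v by (simp add: is_unit_germ_iff Q)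
  then show ?thesis using that[OF e s, of q] q by (simp add: P_def R_def mult.commute)
qed

lemma xonly_gX_power:
  assumes "xonly s" "s \<noteq> 0"
  obtains m \<sigma> where "s = gX ^ m * \<sigma>" "xonly \<sigma>" "\<not> vanishes \<sigma>"
proof -
  have "\<exists>i. gcoeff s i 0 \<noteq> 0"
  proof (rule ccontr)
    assume "\<nexists>i. gcoeff s i 0 \<noteq> 0"
    then have "s = 0" using assms(1) by (intro germ_eqI) (metis xonly_iff gcoeff_0 neq0_conv)
    then show False using assms by simp
  qed
  then have ex: "\<exists>i. gcoeff s i 0 \<noteq> 0" .
  define m where "m = (LEAST i. gcoeff s i 0 \<noteq> 0)"
  have m: "gcoeff s m 0 \<noteq> 0" unfolding m_def by (rule LeastI_ex[OF ex])
  have "gcoeff s i j = 0" if "i < m" for i j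
    using not_less_Least[of i "\<lambda>i. gcoeff s i 0 \<noteq> 0"] that assms(1) by (cases "j = 0") (auto simp: m_def xonly_iff)
  then obtain \<sigma> where \<sigma>: "s = gX ^ m * \<sigma>" using gX_power_dvd_iff[of m s] by (auto simp: dvd_def)
  have c: "gcoeff \<sigma> i j = gcoeff s (i + m) j" for i j by (simp add: \<sigma> gcoeff_gX_power_mult)
  have "xonly \<sigma>" "\<not> vanishes \<sigma>" using assms(1) m by (auto simp: xonly_iff c vanishes_def)
  then show ?thesis using that \<sigma> by blast
qed

text \<open>
  The Newton diagram of \<open>h\<close> lies on or above the segment from \<open>(0,e)\<close> to \<open>(m,0)\<close>. This decides
  both the multiplicity of \<open>h\<close> when \<open>m\<close> is at least \<open>e\<close>, and its tangent cone when \<open>m < e\<close>.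
\<close>

lemma split_newton_diagram:
  assumes e: "e \<ge> 1" and m: "m \<ge> 1" and s: "xonly s" "gX ^ m dvd s"
    and split: "ramify e h = u * (\<Prod>\<zeta> | \<zeta> ^ e = 1. gY - twist \<zeta> s)"
    and h: "gcoeff h i j \<noteq> 0"
  shows "m * e \<le> e * i + m * j"
proof -
  define Y where "Y = gX ^ m * gY"
  have v: "vanishes gX" "vanishes Y" "vanishes (gX ^ e)" using e by (auto simp: Y_def)
  have "gX ^ m dvd gsubst (gY - twist \<zeta> s) gX Y" for \<zeta>
    using s v gX_power_dvd_twist[of m s \<zeta>] by (simp add: gsubst_diff xonly_twist Y_def)
  then have "(\<Prod>\<zeta>\<in>{\<zeta>::complex. \<zeta> ^ e = 1}. gX ^ m) dvd (\<Prod>\<zeta> | \<zeta> ^ e = 1. gsubst (gY - twist \<zeta> s) gX Y)"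
    by (intro prod_dvd_prod) auto
  then have "gX ^ (m * e) dvd gsubst (ramify e h) gX Y"
    using e v by (simp add: split gsubst_mult gsubst_prod card_roots_unity_eq power_mult)
  also have "gsubst (ramify e h) gX Y = gsubst h (gX ^ e) Y" using v by (simp add: gsubst_gsubst gsubst_power)
  finally have "gcoeff (gsubst h (gX ^ e) Y) k l = 0" if "k < m * e" for k l
    using that by (simp add: gX_power_dvd_iff)
  moreover have "gcoeff (gsubst h (gX ^ e) Y) (e * i + m * j) j = gcoeff h i j"
    using e unfolding Y_def by (subst gcoeff_gsubst_monomial) auto
  ultimately show ?thesis using h by (metis not_less)
qed

lemma split_gmult:
  assumes e: "e \<ge> 1" and s: "xonly s" "gX ^ e dvd s" and u: "\<not> vanishes u"
    and split: "ramify e h = u * (\<Prod>\<zeta> | \<zeta> ^ e = 1. gY - twist \<zeta> s)"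
  shows "gmult h = e"
proof (rule gmult_eqI)
  show "ord_ge h e" unfolding ord_ge_def
  proof (intro allI impI)
    fix i j assume ij: "i + j < e"
    show "gcoeff h i j = 0"
    proof (rule ccontr)
      assume "gcoeff h i j \<noteq> 0"
      from split_newton_diagram[OF e e s split this] have "e * e \<le> e * (i + j)" by (simp add: distrib_left)
      then show False using e ij by simp
    qed
  qed
  have "vanishes s" using s e by (auto simp: dvd_def)
  have "gsubst (twist \<zeta> s) 0 gY = 0" for \<zeta>
  proof (rule germ_eqI)
    fix i j
    have "gcoeff s 0 j = 0" using s e by (auto simp: gX_power_dvd_iff)
    then show "gcoeff (gsubst (twist \<zeta> s) 0 gY) i j = gcoeff 0 i j"
      by (simp add: gcoeff_gsubst_0_gY gcoeff_twist)
  qed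
  then have "gsubst (ramify e h) 0 gY = gsubst u 0 gY * gY ^ e"
    using e by (simp add: split gsubst_mult gsubst_prod gsubst_diff card_roots_unity_eq)
  then have "gcoeff (gsubst (ramify e h) 0 gY) 0 e = gcoeff u 0 0"
    by (simp add: gcoeff_mult_gY_power gcoeff_gsubst_0_gY)
  then have "gcoeff h 0 e \<noteq> 0" using e u by (simp add: gcoeff_gsubst_0_gY gcoeff_ramify vanishes_def)
  then show "\<not> ord_ge h (Suc e)" using ord_geD[of h "Suc e" 0 e] by auto
qed

text \<open>
  The lowest term of \<open>h\<close> is the end \<open>x^m\<close> of the segment; its coefficient is the product of those of the conjugates of \<open>s\<close>.
\<close>

lemma split_tangent_cone:
  assumes e: "e \<ge> 1" and s: "xonly s" "vanishes s" "\<not> gX ^ e dvd s" and u: "\<not> vanishes u"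
    and split: "ramify e h = u * (\<Prod>\<zeta> | \<zeta> ^ e = 1. gY - twist \<zeta> s)"
  shows "tangent_cone h = {(x, y). x = 0}"
proof -
  have "s \<noteq> 0" using s by auto
  then obtain m \<sigma> where \<sigma>: "s = gX ^ m * \<sigma>" "xonly \<sigma>" "\<not> vanishes \<sigma>" using xonly_gX_power s by blast
  have m: "m \<ge> 1" using s \<sigma> by (cases m) auto
  have me: "m < e" using s(3) \<sigma>(1) le_imp_power_dvd[of e m gX] by (metis dvd_mult2 not_less)
  have newton: "m * e \<le> e * i + m * j" if "gcoeff h i j \<noteq> 0" for i j
    by (rule split_newton_diagram[OF e m s(1) _ split that]) (simp add: \<sigma>)
  have above: "i + j > m \<or> (i = m \<and> j = 0)" if "gcoeff h i j \<noteq> 0" for i j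
  proof (rule ccontr)
    assume c: "\<not> ?thesis"
    have "e * i + m * j \<le> e * (i + j)" using me by (simp add: distrib_left)
    moreover have "e * (i + j) \<le> e * m" using c by (intro mult_le_mono2) auto
    moreover have "m * e \<le> e * i + m * j" using newton that by blast
    ultimately have eq: "e * (i + j) = e * m" "e * i + m * j = e * (i + j)"
      using mult.commute[of m e] by linarith+
    then have "e * i + m * j = e * i + e * j" by (simp only: distrib_left)
    then have "j = 0" using me by simp
    then show False using eq c e by simp
  qed
  have "gsubst (ramify e h) gX 0 = gsubst u gX 0 * (\<Prod>\<zeta> | \<zeta> ^ e = 1. - twist \<zeta> s)"
    using s by (simp add: split gsubst_mult gsubst_prod gsubst_diff xonly_twist)
  also have "(\<Prod>\<zeta> | \<zeta> ^ e = 1. - twist \<zeta> s) = (\<Prod>\<zeta> | \<zeta> ^ e = 1. gX ^ m * (- (gconst (\<zeta> ^ m) * twist \<zeta> \<sigma>)))"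
    by (intro prod.cong) (auto simp: \<sigma> gsubst_mult gsubst_power power_mult_distrib gconst_power)
  also have "\<dots> = gX ^ (m * e) * (\<Prod>\<zeta> | \<zeta> ^ e = 1. - (gconst (\<zeta> ^ m) * twist \<zeta> \<sigma>))"
    by (subst prod.distrib) (use e in \<open>simp add: card_roots_unity_eq power_mult\<close>)
  finally have eq: "gsubst (ramify e h) gX 0 = 
    gX ^ (m * e) * (gsubst u gX 0 * (\<Prod>\<zeta> | \<zeta> ^ e = 1. - (gconst (\<zeta> ^ m) * twist \<zeta> \<sigma>)))"
    by (simp add: mult_ac)
  have nv: "\<not> vanishes (\<Prod>\<zeta>\<in>R. - (gconst (\<zeta> ^ m) * twist \<zeta> \<sigma>))" if "finite R" "R \<subseteq> {\<zeta>. \<zeta> ^ e = 1}" for R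
    using that
  proof (induction R rule: finite_induct)
    case (insert a R)
    then have "a \<noteq> 0" using e by (auto simp: power_0_left)
    then show ?case using insert \<sigma>(3) by (simp del: prod.insert_remove add: prod.insert)
  qed simp
  then have "\<not> vanishes (gsubst u gX 0 * (\<Prod>\<zeta> | \<zeta> ^ e = 1. - (gconst (\<zeta> ^ m) * twist \<zeta> \<sigma>)))"
    using u nv[OF finite_roots_unity[OF e] subset_refl] by (simp only: vanishes_mult_iff vanishes_gsubst vanishes_simps) simp
  then have "gcoeff (gsubst (ramify e h) gX 0) (m * e) 0 \<noteq> 0"
    by (simp add: eq gcoeff_gX_power_mult vanishes_def)
  then have hm: "gcoeff h m 0 \<noteq> 0" using e by (simp add: gcoeff_gsubst_gX_0 gcoeff_ramify)
  have "gmult h = m"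
  proof (rule gmult_eqI)
    show "ord_ge h m" using above by (fastforce simp: ord_ge_def)
    show "\<not> ord_ge h (Suc m)" using hm ord_geD[of h "Suc m" m 0] by auto
  qed
  moreover have "homog_part m h x y = gcoeff h m 0 * x ^ m" for x y
  proof -
    have "homog_part m h x y = (\<Sum>i\<le>m. if i = m then gcoeff h m 0 * x ^ m else 0)"
      unfolding homog_part_def
    proof (intro sum.cong refl)
      fix i assume i: "i \<in> {..m}"
      show "gcoeff h i (m - i) * x ^ i * y ^ (m - i) = (if i = m then gcoeff h m 0 * x ^ m else 0)"
        using above[of i "m - i"] i by (cases "i = m") auto
    qed
    then show ?thesis by simp
  qed
  ultimately show ?thesis using hm m by (auto simp: tangent_cone_def)
qed

section \<open>Products of smooth branches\<close>

definition branch_prod :: "germ \<Rightarrow> germ list \<Rightarrow> germ" where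
  "branch_prod u ss = u * prod_list (map (\<lambda>s. gY - s) ss)"

lemma branch_prod_simps [simp]: "branch_prod u [] = u" 
  "branch_prod u (s # ss) = (gY - s) * branch_prod u ss"
  by (simp_all add: branch_prod_def mult_ac)

lemma branch_prod_append: "branch_prod u ss * branch_prod v ts = branch_prod (u * v) (ss @ ts)"
  by (simp add: branch_prod_def mult_ac)

lemma gsubst_branch_prod: 
  assumes "vanishes p" "vanishes q"
  shows "gsubst (branch_prod u ss) p q = gsubst u p q * prod_list (map (\<lambda>s. q - gsubst s p q) ss)"
  by (induction ss) (simp_all add: assms gsubst_mult gsubst_diff mult_ac)

lemma branch_prod_nonzero:
  "\<not> vanishes u \<Longrightarrow> \<forall>s\<in>set ss. xonly s \<Longrightarrow> branch_prod u ss \<noteq> 0"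
  using branch_nonzero by (induction ss) (auto simp: vanishes_def)

lemma gmult_branch_prod:
  "\<not> vanishes u \<Longrightarrow> \<forall>s\<in>set ss. xonly s \<and> vanishes s \<Longrightarrow> gmult (branch_prod u ss) = length ss"
proof (induction ss)
  case Nil
  then show ?case by (simp add: gmult_unit is_unit_germ_iff)
next
  case (Cons s ss)
  have "gY - s \<noteq> 0" "branch_prod u ss \<noteq> 0"
    using Cons branch_nonzero[of s] branch_prod_nonzero[of u ss] by auto
  then show ?case using Cons gmult_branch[of s] by (simp add: gmult_mult)
qed

lemma vanishes_branch_prod:
  "\<not> vanishes u \<Longrightarrow> \<forall>s\<in>set ss. xonly s \<and> vanishes s \<Longrightarrow> vanishes (branch_prod u ss) \<longleftrightarrow> ss \<noteq> []"
  using vanishes_diff[of gY] by (induction ss) auto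

lemma irreducible_branch: "xonly s \<Longrightarrow> vanishes s \<Longrightarrow> irreducible (gY - s)"
  by (intro prime_elem_imp_irreducible prime_elem_branch)

lemma root_branch_prod_iff:
  assumes "\<not> vanishes u" "\<forall>s\<in>set ss. xonly s \<and> vanishes s" "xonly t" "vanishes t"
  shows "gsubst (branch_prod u ss) gX t = 0 \<longleftrightarrow> t \<in> set ss"
proof -
  have "gsubst u gX t \<noteq> 0" using assms vanishes_gsubst[of gX t u] by force
  moreover have "gsubst s gX t = s" if "s \<in> set ss" for s using that assms by simp
  ultimately show ?thesis
    using assms by (auto simp: gsubst_branch_prod prod_list_zero_iff)
qed

lemma irreducible_dvd_branch_prod:
  assumes "\<not> vanishes u" "\<forall>s\<in>set ss. xonly s \<and> vanishes s" and g: "irreducible g" "g dvd branch_prod u ss"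
  shows "\<exists>s\<in>set ss. \<exists>v. \<not> vanishes v \<and> g = branch_prod v [s]"
  using assms
proof (induction ss arbitrary: u)
  case Nil
  then have "g dvd 1" using is_unit_germ_iff[of u] by (metis branch_prod_simps(1) dvd_trans)
  then show ?case using Nil by (simp add: irreducible_def)
next
  case (Cons s ss)
  obtain q where q: "(gY - s) * branch_prod u ss = g * q" using Cons.prems by (auto simp: dvd_def)
  have "gY - s dvd g * q" by (metis q dvd_triv_left)
  then have "gY - s dvd g \<or> gY - s dvd q"
    using prime_elem_branch[of s] Cons.prems by (simp add: prime_elem_dvd_mult_iff)
  then show ?case
  proof
    assume "gY - s dvd g"
    then obtain v where v: "g = (gY - s) * v" by (auto simp: dvd_def)
    then have "gY - s dvd 1 \<or> v dvd 1" using irreducibleD[OF g(1) v] by simp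
    moreover have "\<not> gY - s dvd 1" using irreducible_branch[of s] Cons.prems by (auto simp: irreducible_def)
    ultimately have "\<not> vanishes v" by (simp add: is_unit_germ_iff)
    then show ?case using v by (auto simp: branch_prod_def mult_ac)
  next
    assume "gY - s dvd q"
    then obtain q' where "q = (gY - s) * q'" by (auto simp: dvd_def)
    then have "(gY - s) * branch_prod u ss = (gY - s) * (g * q')" using q by (simp add: mult_ac)
    then have "g dvd branch_prod u ss" using branch_nonzero[of s] Cons.prems by (simp add: dvd_def)
    then show ?case using Cons by auto
  qed
qed

lemma component_branch_prod_iff:
  assumes "\<not> vanishes u" "\<forall>s\<in>set ss. xonly s \<and> vanishes s"
  shows "component g (branch_prod u ss) \<longleftrightarrow> (\<exists>s\<in>set ss. \<exists>v. \<not> vanishes v \<and> g = branch_prod v [s])"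
proof
  assume "component g (branch_prod u ss)"
  then show "\<exists>s\<in>set ss. \<exists>v. \<not> vanishes v \<and> g = branch_prod v [s]"
    using irreducible_dvd_branch_prod[OF assms] by (simp add: component_def)
next
  assume "\<exists>s\<in>set ss. \<exists>v. \<not> vanishes v \<and> g = branch_prod v [s]"
  then obtain s v where s: "s \<in> set ss" "\<not> vanishes v" "g = (gY - s) * v" by auto
  then have sx: "xonly s" "vanishes s" using assms by auto
  have "irreducible g" using s irreducible_branch[OF sx] by (simp add: irreducible_mult_unit_left is_unit_germ_iff mult.commute[of _ v])
  moreover have "gY - s dvd branch_prod u ss"
    using root_branch_prod_iff[OF assms sx] s by (simp add: branch_dvd_iff[OF sx])
  then have "g dvd branch_prod u ss" using s by (simp add: mult_unit_dvd_iff is_unit_germ_iff)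
  ultimately show "component g (branch_prod u ss)" by (simp add: component_def)
qed

section \<open>The branches of the ramified curve\<close>

lemma irreducible_factor:
  assumes "f \<noteq> 0" "vanishes f" obtains h where "irreducible h" "h dvd f"
proof -
  have "\<exists>h. irreducible h \<and> h dvd f" using assms
  proof (induction "gmult f" arbitrary: f rule: less_induct)
    case less
    show ?case
    proof (cases "irreducible f")
      case False
      then obtain a b where ab: "f = a * b" "\<not> a dvd 1" "\<not> b dvd 1"
        using less.prems by (auto simp: irreducible_def is_unit_germ_iff)
      then have nz: "a \<noteq> 0" "b \<noteq> 0" "vanishes a" "vanishes b" using less.prems by (auto simp: is_unit_germ_iff)
      then have "gmult a < gmult f" using vanishes_iff_gmult[of b] by (simp add: ab gmult_mult)
      then show ?thesis using less.hyps[of a] nz ab by (metis dvd_mult2)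
    qed auto
  qed
  then show ?thesis using that by blast
qed

lemma finite_component_gmults:
  assumes "f \<noteq> 0"
  shows "finite {gmult g | g. component g f}" "0 \<notin> {gmult g | g. component g f}"
proof -
  have "gmult g \<le> gmult f \<and> gmult g \<noteq> 0" if "component g f" for g
  proof -
    have "g dvd f" using that by (simp add: component_def)
    then obtain q where q: "f = g * q" by (auto simp: dvd_def)
    then have "g \<noteq> 0" "q \<noteq> 0" using assms by auto
    moreover have "vanishes g" using that by (auto simp: component_def irreducible_def is_unit_germ_iff)
    ultimately show ?thesis using vanishes_iff_gmult[of g] by (simp add: q gmult_mult)
  qed
  note bound = this
  show "finite {gmult g | g. component g f}"
    by (rule finite_subset[of _ "{..gmult f}"]) (use bound in auto)
  show "0 \<notin> {gmult g | g. component g f}" using bound by fastforce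
qed

lemma ramification_index_pos: "f \<noteq> 0 \<Longrightarrow> ramification_index f \<ge> 1"
  using finite_component_gmults[of f] unfolding ramification_index_def
  by (metis Lcm_0_iff_nat One_nat_def Suc_leI neq0_conv)

lemma ramified_irreducible_branches:
  assumes e: "e \<ge> 1" "e dvd n" "n \<ge> 1" and s: "xonly s" "gX ^ e dvd s" and u: "\<not> vanishes u"
    and split: "ramify e h = u * (\<Prod>\<zeta> | \<zeta> ^ e = 1. gY - twist \<zeta> s)"
  shows "\<exists>v ss. \<not> vanishes v \<and> (\<forall>s\<in>set ss. xonly s \<and> gX ^ n dvd s) \<and> ramify n h = branch_prod v ss"
proof -
  obtain k where k: "n = e * k" using e by (auto simp: dvd_def)
  have k1: "k \<ge> 1" using k e by (cases k) auto
  obtain \<zeta>s where \<zeta>s: "set \<zeta>s = {\<zeta>::complex. \<zeta> ^ e = 1}" "distinct \<zeta>s"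
    using finite_distinct_list[OF finite_roots_unity[OF e(1)]] by blast
  have "(\<Prod>\<zeta> | \<zeta> ^ e = 1. gY - twist \<zeta> s) = prod_list (map (\<lambda>\<zeta>. gY - twist \<zeta> s) \<zeta>s)"
    using \<zeta>s by (simp add: prod.distinct_set_conv_list[symmetric])
  then have "ramify e h = branch_prod u (map (\<lambda>\<zeta>. twist \<zeta> s) \<zeta>s)"
    by (simp add: split branch_prod_def comp_def)
  moreover have "ramify n h = ramify k (ramify e h)"
    using e k1 by (simp add: gsubst_gsubst gsubst_power k power_mult[symmetric] mult.commute)
  ultimately have "ramify n h = branch_prod (ramify k u) (map (\<lambda>\<zeta>. ramify k (twist \<zeta> s)) \<zeta>s)"
    using k1 by (simp add: gsubst_branch_prod) (simp add: branch_prod_def comp_def)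
  moreover have "gX ^ n dvd ramify k (twist \<zeta> s)" for \<zeta>
  proof -
    have "ramify k (gX ^ e) dvd ramify k (twist \<zeta> s)"
      using k1 s gX_power_dvd_twist by (intro gsubst_dvd) auto
    then show ?thesis using k1 by (simp add: gsubst_power k power_mult[symmetric] mult.commute)
  qed
  moreover have "xonly (ramify k (twist \<zeta> s))" for \<zeta>
    using s k1 by (intro xonly_gsubst xonly_twist xonly_closed) auto
  moreover have "\<not> vanishes (ramify k u)" using u k1 by simp
  ultimately show ?thesis by (intro exI[of _ "ramify k u"] exI[of _ "map (\<lambda>\<zeta>. ramify k (twist \<zeta> s)) \<zeta>s"]) auto
qed

text \<open>
  The condition \<open>gX ^ e dvd s\<close> on a root says that the component is not tangent to \<open>x = 0\<close>. Then \<open>e\<close> is the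
  multiplicity of the component (\<open>split_gmult\<close>), and its parametrizations split after a ramification of any order
  that is a multiple of \<open>e\<close>.
\<close>

lemma ramified_branches:
  assumes "f \<noteq> 0" "n \<ge> 1"
    and "\<And>h. component h f \<Longrightarrow> \<not> gX dvd h \<and> gmult h dvd n \<and> 
      (\<forall>e s u. e \<ge> 1 \<and> xonly s \<and> vanishes s \<and> \<not> vanishes u \<and> gsubst h (gX ^ e) s = 0 \<and>
        ramify e h = u * (\<Prod>\<zeta> | \<zeta> ^ e = 1. gY - twist \<zeta> s) \<longrightarrow> gX ^ e dvd s)"
  shows "\<exists>v ss. \<not> vanishes v \<and> (\<forall>s\<in>set ss. xonly s \<and> gX ^ n dvd s) \<and> ramify n f = branch_prod v ss"
  using assms(1,3)
proof (induction "gmult f" arbitrary: f rule: less_induct)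
  case less
  show ?case
  proof (cases "vanishes f")
    case False
    then show ?thesis using assms(2) by (intro exI[of _ "ramify n f"] exI[of _ "[]"]) simp
  next
    case True
    obtain h where h: "irreducible h" "h dvd f" using irreducible_factor[OF less.prems(1) True] .
    then have comp: "component h f" by (simp add: component_def)
    obtain q where q: "f = h * q" using h by (auto simp: dvd_def)
    have nz: "h \<noteq> 0" "q \<noteq> 0" using q less.prems by auto
    have "vanishes h" using h by (auto simp: irreducible_def is_unit_germ_iff)
    then have "gmult q < gmult f" using nz vanishes_iff_gmult[of h] by (simp add: q gmult_mult)
    moreover have "component h' f" if "component h' q" for h' using that by (auto simp: component_def q)
    ultimately have "\<exists>v ss. \<not> vanishes v \<and> (\<forall>s\<in>set ss. xonly s \<and> gX ^ n dvd s) \<and> ramify n q = branch_prod v ss"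
      using less.hyps[of q] nz less.prems(2) by blast
    then obtain v ss where v: "\<not> vanishes v" "\<forall>s\<in>set ss. xonly s \<and> gX ^ n dvd s" "ramify n q = branch_prod v ss" by blast
    have good: "\<not> gX dvd h" "gmult h dvd n" using less.prems(2)[OF comp] by auto
    obtain e s u where s: "e \<ge> 1" "xonly s" "vanishes s" "gsubst h (gX ^ e) s = 0" "\<not> vanishes u"
      and split: "ramify e h = u * (\<Prod>\<zeta> | \<zeta> ^ e = 1. gY - twist \<zeta> s)"
      using irreducible_split[OF h(1) good(1)] by blast
    have es: "gX ^ e dvd s" using less.prems(2)[OF comp] s split by blast
    have "gmult h = e" using split_gmult[OF s(1,2) es s(5) split] .
    then obtain v' ss' where v': "\<not> vanishes v'" "\<forall>s\<in>set ss'. xonly s \<and> gX ^ n dvd s" "ramify n h = branch_prod v' ss'"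
      using ramified_irreducible_branches[OF s(1) _ assms(2) s(2) es s(5) split] good by auto
    have "ramify n f = branch_prod (v' * v) (ss' @ ss)"
      using assms(2) v v' by (simp add: q gsubst_mult branch_prod_append)
    then show ?thesis using v v' by (intro exI[of _ "v' * v"] exI[of _ "ss' @ ss"]) auto
  qed
qed

section \<open>Infinitely near points of a union of smooth branches\<close>

lemma strict_transform_eqI:
  assumes "gsubst f (fst (blowup_chart d)) (snd (blowup_chart d)) = exc_eq d ^ gmult f * g"
  shows "strict_transform d f = g"
  using assms by (cases d) (simp_all add: strict_transform_def)

lemma strict_transform_unit: "\<not> vanishes u \<Longrightarrow> \<not> vanishes (strict_transform d u)"
proof -
  assume u: "\<not> vanishes u"
  then have "gmult u = 0" by (simp add: gmult_unit is_unit_germ_iff)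
  then have "strict_transform d u = gsubst u (fst (blowup_chart d)) (snd (blowup_chart d))"
    by (intro strict_transform_eqI) simp
  then show ?thesis using u by (cases d) auto
qed

lemma strict_at_unit: "\<not> vanishes u \<Longrightarrow> \<not> vanishes (strict_at p u)"
  unfolding strict_at_def by (induction p arbitrary: u) (auto simp: strict_transform_unit)

lemma shiftX_branch:
  assumes "xonly s" "vanishes s" shows "s = gX * shiftX s" "xonly (shiftX s)"
proof -
  have "gcoeff s 0 j = 0" for j using assms by (cases "j = 0") (auto simp: xonly_iff vanishes_def)
  then show "s = gX * shiftX s" by (intro germ_eqI) (auto simp: gcoeff_gX_mult)
  show "xonly (shiftX s)" using assms by (simp add: xonly_iff)
qed

text \<open>
  Branches with a slope other than \<open>c\<close> do not pass through the point \<open>c\<close>: their equations become units.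
\<close>

lemma strict_transform_slope:
  assumes u: "\<not> vanishes u" and ss: "\<forall>s\<in>set ss. xonly s \<and> vanishes s"
  shows "\<exists>v. \<not> vanishes v \<and> strict_transform (Slope c) (branch_prod u ss) = 
    branch_prod v (map (\<lambda>s. shiftX s - gconst c) (filter (\<lambda>s. gcoeff s 1 0 = c) ss))"
proof -
  have ex: "\<exists>v. \<not> vanishes v \<and> branch_prod u' (map (\<lambda>s. shiftX s - gconst c) ss) =
      branch_prod v (map (\<lambda>s. shiftX s - gconst c) (filter (\<lambda>s. gcoeff s 1 0 = c) ss))" if u': "\<not> vanishes u'" for u'
  proof (induction ss)
    case (Cons s ss)
    then obtain v where v: "\<not> vanishes v" "branch_prod u' (map (\<lambda>s. shiftX s - gconst c) ss) =
      branch_prod v (map (\<lambda>s. shiftX s - gconst c) (filter (\<lambda>s. gcoeff s 1 0 = c) ss))" by blast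
    show ?case
    proof (cases "gcoeff s 1 0 = c")
      case True
      then show ?thesis using v by (intro exI[of _ v]) simp
    next
      case False
      then have "\<not> vanishes (gY - (shiftX s - gconst c))" by (simp add: vanishes_def gcoeff_gY gcoeff_gconst)
      then show ?thesis using v False
        by (intro exI[of _ "(gY - (shiftX s - gconst c)) * v"]) (simp add: branch_prod_def mult_ac)
    qed
  qed (use u' in auto)
  define C where "C = gX * (gY + gconst c)"
  have vC: "vanishes gX" "vanishes C" by (auto simp: C_def)
  have "gsubst (branch_prod u ss) gX C = gX ^ length ss * branch_prod (gsubst u gX C) (map (\<lambda>s. shiftX s - gconst c) ss)"
    using ss
  proof (induction ss)
    case (Cons s ss)
    have "gsubst s gX C = gX * shiftX s" using Cons.prems vC shiftX_branch(1)[of s] by simp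
    then have "gsubst (gY - s) gX C = gX * (gY - (shiftX s - gconst c))"
      using vC by (simp add: gsubst_diff) (simp add: C_def algebra_simps)
    then show ?case using Cons vC by (simp add: gsubst_mult mult_ac)
  qed simp
  then have "strict_transform (Slope c) (branch_prod u ss) = branch_prod (gsubst u gX C) (map (\<lambda>s. shiftX s - gconst c) ss)"
    by (intro strict_transform_eqI) (simp add: gmult_branch_prod[OF u ss] C_def)
  then show ?thesis using ex[of "gsubst u gX C"] u vC by simp
qed

text \<open>A graph over the \<open>x\<close>-axis is not tangent to \<open>x = 0\<close>.\<close>

lemma strict_transform_vertical:
  assumes u: "\<not> vanishes u" and ss: "\<forall>s\<in>set ss. xonly s \<and> vanishes s"
  shows "\<not> vanishes (strict_transform Vertical (branch_prod u ss))"
proof -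
  define C where "C = gX * gY"
  have vC: "vanishes C" "vanishes gY" by (auto simp: C_def)
  have "\<exists>v. \<not> vanishes v \<and> gsubst (branch_prod u ss) C gY = gY ^ length ss * v"
    using ss
  proof (induction ss)
    case Nil
    show ?case using vC u by (intro exI[of _ "gsubst u C gY"]) simp
  next
    case (Cons s ss)
    then obtain v where v: "\<not> vanishes v" "gsubst (branch_prod u ss) C gY = gY ^ length ss * v" by auto
    have "s = gX * shiftX s" using Cons.prems shiftX_branch(1)[of s] by simp
    then have "gsubst s C gY = gsubst (gX * shiftX s) C gY" by simp
    also have "\<dots> = C * gsubst (shiftX s) C gY" using vC by (simp add: gsubst_mult)
    finally have "gsubst s C gY = C * gsubst (shiftX s) C gY" .
    then have "gsubst (gY - s) C gY = gY * (1 - gX * gsubst (shiftX s) C gY)"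
      using vC by (simp add: gsubst_diff) (simp add: C_def algebra_simps)
    then have "gsubst (branch_prod u (s # ss)) C gY = gY ^ length (s # ss) * ((1 - gX * gsubst (shiftX s) C gY) * v)"
      using v vC by (simp add: gsubst_mult mult_ac)
    moreover have "\<not> vanishes (1 - gX * gsubst (shiftX s) C gY)"
      by (simp add: vanishes_def gcoeff_1 gcoeff_gX_mult)
    ultimately show ?case using v by (intro exI[of _ "(1 - gX * gsubst (shiftX s) C gY) * v"]) simp
  qed
  then obtain v where v: "\<not> vanishes v" "gsubst (branch_prod u ss) C gY = gY ^ length ss * v" by blast
  then have "strict_transform Vertical (branch_prod u ss) = v"
    by (intro strict_transform_eqI) (simp add: gmult_branch_prod[OF u ss] C_def)
  then show ?thesis using v by simp
qed

text \<open>
  The coefficients of \<open>s / x\<close>. They are the directions of the successive infinitely near points of the graph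
  of \<open>s\<close>.
\<close>

definition slope_coeffs :: "germ \<Rightarrow> complex fps" where
  "slope_coeffs s = Abs_fps (\<lambda>i. gcoeff s (Suc i) 0)"

definition follows :: "complex list \<Rightarrow> complex fps \<Rightarrow> bool" where
  "follows l z \<longleftrightarrow> (\<forall>i<length l. z $ i = l ! i)"

lemma follows_Nil [simp]: "follows [] z"
  by (simp add: follows_def)

lemma follows_Cons: "follows (c # l) z \<longleftrightarrow> z $ 0 = c \<and> follows l (fps_shift 1 z)"
  unfolding follows_def by (auto simp: nth_Cons less_Suc_eq_0_disj split: nat.splits)

lemma slope_coeffs_shift: "fps_shift 1 (slope_coeffs s) = slope_coeffs (shiftX s - gconst c)"
  by (rule fps_ext) (simp add: slope_coeffs_def gcoeff_gconst)

definition passes :: "near_point \<Rightarrow> germ \<Rightarrow> bool" where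
  "passes p s \<longleftrightarrow> (\<exists>l. p = map Slope l \<and> follows l (slope_coeffs s))"

lemma passes_simps: "passes [] s" "\<not> passes (Vertical # p) s" 
  "passes (Slope c # p) s \<longleftrightarrow> gcoeff s 1 0 = c \<and> passes p (shiftX s - gconst c)"
proof -
  show "passes (Slope c # p) s \<longleftrightarrow> gcoeff s 1 0 = c \<and> passes p (shiftX s - gconst c)"
  proof
    assume "passes (Slope c # p) s"
    then obtain l where l: "Slope c # p = map Slope l" "follows l (slope_coeffs s)"
      unfolding passes_def by (elim exE conjE) (rule that)
    then obtain l' where "l = c # l'" "p = map Slope l'" by (cases l) auto
    then have "slope_coeffs s $ 0 = c" "follows l' (fps_shift 1 (slope_coeffs s))" "p = map Slope l'"
      using l(2) by (simp_all add: follows_Cons)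
    then have "gcoeff s 1 0 = c" "p = map Slope l'" "follows l' (slope_coeffs (shiftX s - gconst c))"
      using slope_coeffs_shift[of s c] by (simp_all add: slope_coeffs_def)
    then show "gcoeff s 1 0 = c \<and> passes p (shiftX s - gconst c)" unfolding passes_def by blast
  next
    assume a: "gcoeff s 1 0 = c \<and> passes p (shiftX s - gconst c)"
    then obtain l where "p = map Slope l" "follows l (slope_coeffs (shiftX s - gconst c))" by (auto simp: passes_def)
    moreover have "slope_coeffs s $ 0 = c" using a by (simp add: slope_coeffs_def)
    ultimately have "Slope c # p = map Slope (c # l)" "follows (c # l) (slope_coeffs s)"
      by (simp_all only: follows_Cons slope_coeffs_shift[of s c] list.map simp_thms)
    then show "passes (Slope c # p) s" unfolding passes_def by (intro exI conjI)
  qed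
qed (auto simp: passes_def)

lemma strict_at_branch_prod:
  assumes "\<not> vanishes u" "\<forall>s\<in>set ss. xonly s \<and> vanishes s"
  shows "\<exists>v ts. \<not> vanishes v \<and> (\<forall>s\<in>set ts. xonly s \<and> vanishes s) \<and> length ts = length (filter (passes p) ss) \<and>
    strict_at p (branch_prod u ss) = branch_prod v ts"
  using assms
proof (induction p arbitrary: u ss)
  case Nil
  then show ?case by (intro exI[of _ u] exI[of _ ss]) (simp add: strict_at_def passes_simps)
next
  case (Cons d p)
  show ?case
  proof (cases d)
    case (Slope c)
    define ts where "ts = map (\<lambda>s. shiftX s - gconst c) (filter (\<lambda>s. gcoeff s 1 0 = c) ss)"
    obtain v where v: "\<not> vanishes v" "strict_transform (Slope c) (branch_prod u ss) = branch_prod v ts"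
      using strict_transform_slope[OF Cons.prems] unfolding ts_def by blast
    have ts: "\<forall>s\<in>set ts. xonly s \<and> vanishes s"
      using Cons.prems shiftX_branch(2)
      by (auto simp: ts_def vanishes_def gcoeff_gconst intro!: xonly_closed)
    have "length (filter (passes p) ts) = length (filter (passes (d # p)) ss)"
      unfolding ts_def filter_map length_map filter_filter Slope passes_simps comp_def by (simp add: conj_commute)
    then show ?thesis using Cons.IH[OF v(1) ts] v Slope by (simp add: strict_at_def)
  next
    case Vertical
    have "\<not> vanishes (strict_at (d # p) (branch_prod u ss))"
      using strict_at_unit[OF strict_transform_vertical[OF Cons.prems], of p] Vertical by (simp add: strict_at_def)
    then show ?thesis
      by (intro exI[of _ "strict_at (d # p) (branch_prod u ss)"] exI[of _ "[]"]) (simp add: Vertical passes_simps)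
  qed
qed

lemma vanishes_strict_at_branch_prod:
  assumes "\<not> vanishes u" "\<forall>s\<in>set ss. xonly s \<and> vanishes s"
  shows "vanishes (strict_at p (branch_prod u ss)) \<longleftrightarrow> (\<exists>s\<in>set ss. passes p s)"
proof -
  obtain v ts where v: "\<not> vanishes v" "\<forall>s\<in>set ts. xonly s \<and> vanishes s" "length ts = length (filter (passes p) ss)"
    "strict_at p (branch_prod u ss) = branch_prod v ts" using strict_at_branch_prod[OF assms] by blast
  have "ts = [] \<longleftrightarrow> filter (passes p) ss = []" using v(3) by (metis length_0_conv)
  then have "vanishes (strict_at p (branch_prod u ss)) \<longleftrightarrow> filter (passes p) ss \<noteq> []"
    using v vanishes_branch_prod[OF v(1,2)] by simp
  then show ?thesis by (simp add: filter_empty_conv)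
qed

lemma strict_transform_slope_gX: "strict_transform (Slope c) gX = 1"
  by (rule strict_transform_eqI) simp

text \<open>
  The strict transform of a component of the divisor is vertical after the next blow-up. A point with finite
  slopes only is therefore on the last component and on no earlier one.
\<close>

lemma divisor_at_slopes: "divisor_at q (map Slope l) e \<longleftrightarrow> l \<noteq> [] \<and> q = map Slope (butlast l) \<and> e = gX"
proof
  assume "divisor_at q (map Slope l) e"
  then obtain d r where dr: "map Slope l = q @ d # r" "e = strict_at r (exc_eq d)" "vanishes e"
    unfolding divisor_at_def by (elim exE conjE) (rule that)
  obtain l1 l3 where l13: "l = l1 @ l3" "q = map Slope l1" "d # r = map Slope l3"
    using iffD1[OF map_eq_append_conv dr(1)] by (elim exE conjE) (rule that)
  obtain c l2 where l3: "l3 = c # l2" using l13(3) by (cases l3) auto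
  have l: "l = l1 @ c # l2" "q = map Slope l1" "d = Slope c" "r = map Slope l2" 
    using l13 unfolding l3 by simp_all
  have "l2 = []"
  proof (cases l2)
    case (Cons c' l')
    then have "e = strict_at (map Slope l') 1" 
      unfolding dr(2) l(3,4) Cons by (simp add: strict_at_def strict_transform_slope_gX)
    then show ?thesis using dr(3) strict_at_unit[of 1] by simp
  qed simp
  then have "e = gX" "butlast l = l1" "l \<noteq> []" unfolding dr(2) l by (simp_all add: strict_at_def)
  then show "l \<noteq> [] \<and> q = map Slope (butlast l) \<and> e = gX" using l(2) by (simp del: map_butlast)
next
  assume a: "l \<noteq> [] \<and> q = map Slope (butlast l) \<and> e = gX"
  then have "l = butlast l @ [last l]" by simp
  then have "map Slope l = map Slope (butlast l @ [last l])" by (rule arg_cong)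
  also have "\<dots> = q @ Slope (last l) # []" using a by (simp only: map_append list.map)
  finally have "map Slope l = q @ Slope (last l) # []" .
  moreover have "e = strict_at [] (exc_eq (Slope (last l)))" "vanishes e" using a by (simp_all add: strict_at_def)
  ultimately show "divisor_at q (map Slope l) e" unfolding divisor_at_def by (intro exI conjI)
qed

lemma on_divisor_slopes: "on_divisor q (map Slope l) \<longleftrightarrow> l \<noteq> [] \<and> q = map Slope (butlast l)"
  by (simp add: on_divisor_def divisor_at_slopes)

section \<open>The tree of a finite set of series\<close>

text \<open>
  The nodes of the tree are the points through which at least two series pass; they will be the points to be blown up,
  and stand for the components that these blow-ups create. A node is divisorial if some
  series leaves the tree immediately after it: this is a branch of the curve that meets the component.
\<close>

definition nodes :: "complex fps set \<Rightarrow> complex list set" where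
  "nodes Z = {l. \<exists>z\<in>Z. \<exists>z'\<in>Z. z \<noteq> z' \<and> follows l z \<and> follows l z'}"

definition terminal_nodes :: "complex fps set \<Rightarrow> complex list set" where
  "terminal_nodes Z = {l \<in> nodes Z. \<forall>c. l @ [c] \<notin> nodes Z}"

definition divisorial_nodes :: "complex fps set \<Rightarrow> complex list set" where
  "divisorial_nodes Z = {l \<in> nodes Z. \<exists>c. l @ [c] \<notin> nodes Z \<and> (\<exists>z\<in>Z. follows (l @ [c]) z)}"

lemma follows_prefix: "follows (l @ l') z \<Longrightarrow> follows l z"
  by (auto simp: follows_def nth_append split: if_splits)

text \<open>
  A node for \<open>z\<close> and \<open>z'\<close> is a beginning of \<open>z\<close>, shorter than the first coefficient where they differ.
\<close>

lemma finite_nodes: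
  assumes "finite Z" shows "finite (nodes Z)"
proof -
  have *: "finite {l. follows l z \<and> follows l z'}" if zz': "z \<noteq> z'" for z z' :: "complex fps"
  proof -
    obtain n where n: "z $ n \<noteq> z' $ n" using zz' by (auto simp: fps_eq_iff)
    have "l = map (($) z) [0..<length l] \<and> length l \<le> n" if "follows l z" "follows l z'" for l
    proof -
      have "\<not> n < length l" using that n by (auto simp: follows_def)
      moreover have "l = map (($) z) [0..<length l]" using that by (intro nth_equalityI) (auto simp: follows_def)
      ultimately show ?thesis by simp
    qed
    then have "{l. follows l z \<and> follows l z'} \<subseteq> (\<lambda>k. map (($) z) [0..<k]) ` {..n}"
      by (intro subsetI image_eqI[where x = "length l" for l]) auto
    then show ?thesis by (rule finite_subset) simp
  qed
  have "finite (\<Union>z\<in>Z. \<Union>z'\<in>Z - {z}. {l. follows l z \<and> follows l z'})"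
    using assms by (intro finite_UN_I finite_Diff *) auto
  moreover have "nodes Z \<subseteq> (\<Union>z\<in>Z. \<Union>z'\<in>Z - {z}. {l. follows l z \<and> follows l z'})"
    unfolding nodes_def by blast
  ultimately show ?thesis by (rule finite_subset[rotated])
qed

section \<open>Minimal desingularization of a union of smooth branches\<close>

text \<open>
  The origin is added: for a single branch there are no nodes, but the origin is blown up all the same, as
  the branch has to meet a component of the divisor.
\<close>

definition centers :: "complex fps set \<Rightarrow> near_point set" where
  "centers Z = map Slope ` insert [] (nodes Z)"

lemma map_Slope_eq_iff [simp]: "map Slope l = map Slope l' \<longleftrightarrow> l = l'"
  by (auto simp: inj_map_eq_map inj_def)

lemma map_Slope_in_centers [simp]: "map Slope l \<in> centers Z \<longleftrightarrow> l = [] \<or> l \<in> nodes Z"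
  by (auto simp: centers_def)

lemma butlast_node: "l \<in> nodes Z \<Longrightarrow> butlast l \<in> nodes Z"
  using follows_prefix[of "butlast l" "[last l]"] by (cases "l = []") (auto simp: nodes_def)

lemma slope_coeffs_eq_iff:
  assumes "xonly s" "vanishes s" "xonly t" "vanishes t"
  shows "slope_coeffs s = slope_coeffs t \<longleftrightarrow> s = t"
proof
  assume eq: "slope_coeffs s = slope_coeffs t"
  show "s = t"
  proof (rule germ_eqI)
    fix i j
    show "gcoeff s i j = gcoeff t i j"
    proof (cases "j = 0")
      case True
      have "gcoeff s (Suc k) 0 = gcoeff t (Suc k) 0" for k
        using arg_cong[OF eq, of "\<lambda>z. z $ k"] by (simp add: slope_coeffs_def)
      then show ?thesis using assms True by (cases i) (auto simp: vanishes_def)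
    qed (use assms in \<open>auto simp: xonly_iff\<close>)
  qed
qed simp

lemma blowup_seq_distinct: "blowup_seq cs \<Longrightarrow> distinct cs"
  unfolding distinct_conv_nth
proof (intro allI impI)
  fix i j assume cs: "blowup_seq cs" and ij: "i < length cs" "j < length cs" "i \<noteq> j"
  have *: "cs ! a \<noteq> cs ! b" if "a < b" "b < length cs" for a b
  proof -
    have "cs ! b \<notin> set (take b cs)" using cs that by (auto simp: blowup_seq_def points_over_def)
    moreover have "cs ! a \<in> set (take b cs)" using that by (auto simp: in_set_conv_nth intro!: exI[of _ a])
    ultimately show ?thesis by auto
  qed
  show "cs ! i \<noteq> cs ! j" using *[of i j] *[of j i] ij by (cases "i < j") auto
qed

text \<open>
  Counting the components by their centers: the definitions count positions in the sequence.
\<close>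

lemma card_indices:
  assumes "distinct cs"
  shows "card {i. i < length cs \<and> P (cs ! i)} = card {p \<in> set cs. P p}"
proof -
  have inj: "inj_on ((!) cs) {i. i < length cs \<and> P (cs ! i)}"
    using assms by (intro inj_onI) (simp add: nth_eq_iff_index_eq)
  have "(!) cs ` {i. i < length cs \<and> P (cs ! i)} = {p \<in> set cs. P p}"
  proof (intro set_eqI iffI)
    fix p assume "p \<in> {p \<in> set cs. P p}"
    then obtain i where "i < length cs" "p = cs ! i" "P p" unfolding in_set_conv_nth mem_Collect_eq by metis
    then show "p \<in> (!) cs ` {i. i < length cs \<and> P (cs ! i)}" by simp
  qed auto
  then show ?thesis using card_image[OF inj] by simp
qed

context
  fixes u :: germ and ss :: "germ list" and F :: germ and Z :: "complex fps set"
  assumes u: "\<not> vanishes u" and ss: "\<forall>s\<in>set ss. xonly s \<and> vanishes s" and F: "F = branch_prod u ss"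
    and Z: "Z = slope_coeffs ` set ss" and nonempty: "ss \<noteq> []"
begin

lemma vanishes_strict_at: "vanishes (strict_at p F) \<longleftrightarrow> (\<exists>l. p = map Slope l \<and> (\<exists>z\<in>Z. follows l z))"
  unfolding F vanishes_strict_at_branch_prod[OF u ss] passes_def Z by blast

lemma component_at:
  assumes "component g F" "vanishes (strict_at p g)"
  obtains s l v where "s \<in> set ss" "p = map Slope l" "follows l (slope_coeffs s)" "\<not> vanishes v" "g = branch_prod v [s]"
proof -
  obtain s v where s: "s \<in> set ss" "\<not> vanishes v" "g = branch_prod v [s]"
    using assms(1) component_branch_prod_iff[OF u ss] F by auto
  have "\<forall>s\<in>set [s]. xonly s \<and> vanishes s" using s ss by auto
  from vanishes_strict_at_branch_prod[OF s(2) this] have "passes p s" using assms(2) s(3) by simp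
  then obtain l where "p = map Slope l" "follows l (slope_coeffs s)" unfolding passes_def by (elim exE conjE) (rule that)
  then show ?thesis using that s by blast
qed

text \<open>
  At a point that is not blown up, the branches are disjoint and there is a component of the divisor.
\<close>

lemma desingularizes_imp:
  assumes des: "desingularizes cs F" and p: "map Slope l \<in> points_over (set cs)"
    and z: "z \<in> Z" "follows l z"
  shows "l \<noteq> []" and "z' \<in> Z \<Longrightarrow> follows l z' \<Longrightarrow> z' = z"
proof -
  have vb: "component (gY - s) F \<and> vanishes (strict_at (map Slope l) (gY - s))"
    if s: "s \<in> set ss" "follows l (slope_coeffs s)" for s
  proof -
    have "component (branch_prod 1 [s]) F"
      unfolding F component_branch_prod_iff[OF u ss] using s by (intro bexI[of _ s] exI[of _ 1]) auto
    moreover have "\<forall>s\<in>set [s]. xonly s \<and> vanishes s" using s ss by auto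
    then have "vanishes (strict_at (map Slope l) (branch_prod 1 [s]))"
      using s vanishes_strict_at_branch_prod[of 1 "[s]" "map Slope l"] by (auto simp: passes_def)
    ultimately show ?thesis by simp
  qed
  obtain s where s: "s \<in> set ss" "z = slope_coeffs s" using z Z by auto
  have *: "(\<forall>g'. component g' F \<and> vanishes (strict_at (map Slope l) g') \<longrightarrow> g' dvd gY - s) \<and>
        (\<exists>!q. q \<in> set cs \<and> on_divisor q (map Slope l))"
    using des p vb[of s] s z unfolding desingularizes_def by blast
  then show "l \<noteq> []" using on_divisor_slopes by blast
  show "z' = z" if z': "z' \<in> Z" "follows l z'"
  proof -
    obtain s' where s': "s' \<in> set ss" "z' = slope_coeffs s'" using z' Z by auto
    have "gY - s' dvd gY - s" using * vb[of s'] s' z' by blast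
    then have "gsubst (gY - s) gX s' = 0" using branch_dvd_iff s' ss by blast
    then have "s' = s" using s s' ss by (simp add: gsubst_diff)
    then show ?thesis using s s' by simp
  qed
qed

text \<open>
  Once the branches are separated they are also smooth and transverse to the divisor: at a point with
  finite slopes the divisor is \<open>x = 0\<close>, and the branch is a graph over the \<open>x\<close>-axis.
\<close>

lemma desingularizesI:
  assumes nil: "[] \<in> set cs"
    and sep: "\<And>l z z'. map Slope l \<in> points_over (set cs) \<Longrightarrow> z \<in> Z \<Longrightarrow> z' \<in> Z \<Longrightarrow>
        follows l z \<Longrightarrow> follows l z' \<Longrightarrow> z' = z"
  shows "desingularizes cs F"
  unfolding desingularizes_def
proof (intro ballI allI impI)
  fix p g
  assume p: "p \<in> points_over (set cs)" and g: "component g F \<and> vanishes (strict_at p g)"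
  obtain s l v where s: "s \<in> set ss" "p = map Slope l" "follows l (slope_coeffs s)" "\<not> vanishes v" "g = branch_prod v [s]"
    using component_at g by blast
  have sx: "\<forall>s\<in>set [s]. xonly s \<and> vanishes s" using s ss by auto
  have l: "l \<noteq> []" "map Slope (butlast l) \<in> set cs"
    using p nil s(2) by (auto simp: points_over_def map_butlast)
  obtain w ts where w: "\<not> vanishes w" "\<forall>s\<in>set ts. xonly s \<and> vanishes s"
    "length ts = length (filter (passes p) [s])" "strict_at p g = branch_prod w ts"
    using strict_at_branch_prod[OF s(4) sx, of p] s(5) by blast
  have "passes p s" using s by (auto simp: passes_def)
  then obtain t where t: "ts = [t]" using w(3) by (auto simp: length_Suc_conv)
  have gmult: "gmult (strict_at p g) = 1" using gmult_branch_prod[OF w(1,2)] by (simp add: w t)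
  have dvd: "g' dvd g" if g': "component g' F" "vanishes (strict_at p g')" for g'
  proof -
    obtain s' l' v' where s': "s' \<in> set ss" "p = map Slope l'" "follows l' (slope_coeffs s')" "\<not> vanishes v'" "g' = branch_prod v' [s']"
      using component_at g' by blast
    have "l' = l" using s(2) s'(2) map_Slope_eq_iff[of l' l] by simp
    have "slope_coeffs s \<in> Z" "slope_coeffs s' \<in> Z" using s(1) s'(1) Z by simp_all
    then have "slope_coeffs s' = slope_coeffs s"
      by (rule sep[OF p[unfolded s(2)] _ _ s(3) s'(3)[unfolded \<open>l' = l\<close>]])
    then have "s' = s" using slope_coeffs_eq_iff[of s' s] s(1) s'(1) ss by simp
    moreover have "v' dvd v" using s'(4) by (simp add: unit_imp_dvd is_unit_germ_iff)
    ultimately show ?thesis unfolding s(5) s'(5) by (simp add: mult_dvd_mono)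
  qed
  have uniq: "\<exists>!q. q \<in> set cs \<and> on_divisor q p"
    using l by (auto simp: s(2) on_divisor_slopes)
  have "\<not> vanishes (jacobian gX (strict_at p g))"
  proof -
    have "vanishes (gY - t)" using w t by (intro vanishes_diff) auto
    moreover have "jacobian gX (strict_at p g) = dY w * (gY - t) + w"
      using w t by (simp add: jacobian_def dY_mult dY_diff xonly_def)
    ultimately show ?thesis using w by (simp add: vanishes_def gcoeff_mult)
  qed
  then have jac: "\<not> vanishes (jacobian e (strict_at p g))" if "divisor_at q p e" for q e
    using that by (auto simp: s(2) divisor_at_slopes)
  show "gmult (strict_at p g) = 1 \<and>
        (\<forall>g'. component g' F \<and> vanishes (strict_at p g') \<longrightarrow> g' dvd g) \<and>
        (\<exists>!q. q \<in> set cs \<and> on_divisor q p) \<and>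
        (\<forall>q \<in> set cs. \<forall>e. divisor_at q p e \<longrightarrow> \<not> vanishes (jacobian e (strict_at p g)))"
    using gmult dvd uniq jac by blast
qed

lemma finite_Z: "finite Z" by (simp add: Z)

text \<open>
  By induction along the tree: a predecessor of a node is a center, so the node itself would otherwise be a point that is not
  blown up and lies on two branches.
\<close>

lemma centers_subset:
  assumes "blowup_seq cs" "desingularizes cs F"
  shows "centers Z \<subseteq> set cs"
proof -
  obtain z0 where z0: "z0 \<in> Z" using nonempty Z by (cases ss) auto
  have nil: "[] \<in> set cs"
  proof (rule ccontr)
    assume "[] \<notin> set cs"
    then have "map Slope [] \<in> points_over (set cs)" by (simp add: points_over_def)
    from desingularizes_imp(1)[OF assms(2) this z0] show False by simp
  qed
  have "l \<in> nodes Z \<Longrightarrow> map Slope l \<in> set cs" for l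
  proof (induction l rule: rev_induct)
    case Nil
    then show ?case using nil by simp
  next
    case (snoc c l)
    have "l \<in> nodes Z" using butlast_node[OF snoc.prems] by simp
    then have l: "map Slope l \<in> set cs" by (rule snoc.IH)
    show ?case
    proof (rule ccontr)
      assume "map Slope (l @ [c]) \<notin> set cs"
      then have "map Slope (l @ [c]) \<in> points_over (set cs)" using l by (simp add: points_over_def)
      moreover obtain z z' where "z \<in> Z" "z' \<in> Z" "z \<noteq> z'" "follows (l @ [c]) z" "follows (l @ [c]) z'"
        using snoc.prems unfolding nodes_def by blast
      ultimately show False using desingularizes_imp(2)[OF assms(2)] by blast
    qed
  qed
  then show ?thesis using nil by (auto simp: centers_def)
qed

lemma exists_desing: "\<exists>cs. blowup_seq cs \<and> desingularizes cs F \<and> set cs = centers Z \<and> distinct cs"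
proof -
  have "finite (centers Z)" using finite_nodes[OF finite_Z] by (simp add: centers_def)
  then obtain xs where xs: "set xs = centers Z" "distinct xs" using finite_distinct_list by blast
  \<comment> \<open>sorting by length puts every point after the points below it\<close>
  define cs where "cs = sort_key length xs"
  have cs: "set cs = centers Z" "distinct cs" "sorted (map length cs)" using xs by (auto simp: cs_def)
  have "blowup_seq cs" unfolding blowup_seq_def
  proof (intro allI impI)
    fix i assume i: "i < length cs"
    have "cs ! i \<notin> set (take i cs)"
    proof
      assume "cs ! i \<in> set (take i cs)"
      then obtain j where "j < i" "cs ! j = cs ! i" using i by (auto simp: in_set_conv_nth)
      then show False using cs(2) i by (simp add: nth_eq_iff_index_eq)
    qed
    moreover have "butlast (cs ! i) \<in> set (take i cs)" if ne: "cs ! i \<noteq> []"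
    proof -
      have "cs ! i \<in> centers Z" using cs(1) i nth_mem by blast
      then obtain l where l: "cs ! i = map Slope l" "l = [] \<or> l \<in> nodes Z" by (auto simp: centers_def)
      then have "map Slope (butlast l) \<in> centers Z" using butlast_node by auto
      then have "butlast (cs ! i) \<in> set cs" using l(1) cs(1) by (simp add: map_butlast)
      then obtain j where j: "j < length cs" "cs ! j = butlast (cs ! i)" by (auto simp: in_set_conv_nth)
      have "\<not> i \<le> j"
      proof
        assume "i \<le> j"
        then have le: "length (cs ! i) \<le> length (cs ! j)" using sorted_nth_mono[OF cs(3), of i j] i j(1) by simp
        then have "length (cs ! i) \<le> length (cs ! i) - 1" unfolding j(2) length_butlast .
        moreover have "length (cs ! i) > 0" using ne by simp
        ultimately show False by linarith
      qed
      then have "j < length (take i cs)" "take i cs ! j = cs ! j" using j(1) i by simp_all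
      then show ?thesis using nth_mem[of j "take i cs"] by (simp only: j(2))
    qed
    ultimately show "cs ! i \<in> points_over (set (take i cs))" by (auto simp: points_over_def)
  qed
  moreover have "desingularizes cs F"
  proof (rule desingularizesI)
    show "[] \<in> set cs" by (simp add: cs centers_def)
    fix l z z' assume l: "map Slope l \<in> points_over (set cs)" and z: "z \<in> Z" "z' \<in> Z" "follows l z" "follows l z'"
    have "l \<notin> nodes Z" using l by (simp add: points_over_def cs(1))
    then show "z' = z" using z unfolding nodes_def by blast
  qed
  ultimately show ?thesis using cs by blast
qed

lemma desing_centers:
  "blowup_seq (desing_centers F)" "set (desing_centers F) = centers Z" "distinct (desing_centers F)"
proof -
  obtain cs0 where cs0: "blowup_seq cs0" "desingularizes cs0 F" "set cs0 = centers Z" "distinct cs0"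
    using exists_desing by blast
  have card: "card (centers Z) \<le> length cs" if "blowup_seq cs" "desingularizes cs F" for cs
    using card_mono[OF List.finite_set centers_subset[OF that]] card_length[of cs] by (rule order_trans)
  have len0: "length cs0 = card (centers Z)" using distinct_card[OF cs0(4)] by (simp only: cs0(3))
  have "minimal_desing cs0 F"
    unfolding minimal_desing_def len0 by (intro conjI cs0 allI impI) (elim conjE, rule card)
  then have min: "minimal_desing (desing_centers F) F" unfolding desing_centers_def by (rule someI)
  then have bd: "blowup_seq (desing_centers F)" "desingularizes (desing_centers F) F"
    and le: "length (desing_centers F) \<le> length cs0"
    using cs0(1,2) unfolding minimal_desing_def by blast+
  show "blowup_seq (desing_centers F)" by (rule bd)
  show dist: "distinct (desing_centers F)" using bd(1) by (rule blowup_seq_distinct)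
  have "card (set (desing_centers F)) \<le> card (centers Z)"
    using le unfolding len0 distinct_card[OF dist] .
  then show "set (desing_centers F) = centers Z"
    using card_seteq[OF List.finite_set centers_subset[OF bd]] by (rule_tac sym)
qed

lemma terminal_iff:
  assumes i: "i < length (desing_centers F)" and l: "desing_centers F ! i = map Slope l"
  shows "terminal (desing_centers F) i \<longleftrightarrow> (\<forall>c. l @ [c] \<notin> nodes Z)"
proof
  define cs where "cs = desing_centers F"
  note cs = desing_centers[folded cs_def]
  assume t: "terminal (desing_centers F) i"
  show "\<forall>c. l @ [c] \<notin> nodes Z"
  proof (intro allI notI)
    fix c assume "l @ [c] \<in> nodes Z"
    then have "map Slope (l @ [c]) \<in> set cs" by (simp only: cs(2) map_Slope_in_centers simp_thms)
    then obtain j where j: "j < length cs" "cs ! j = map Slope (l @ [c])" by (auto simp only: in_set_conv_nth)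
    then have "butlast (cs ! j) = map Slope l" "cs ! j \<noteq> []" by auto
    then have "map Slope l \<in> set (take j cs)" using cs(1) j(1) by (auto simp: blowup_seq_def points_over_def)
    then obtain k where k: "k < j" "cs ! k = map Slope l" using j by (auto simp: in_set_conv_nth)
    then have "k = i" using l i cs(3) j by (metis cs_def nth_eq_iff_index_eq order.strict_trans)
    moreover have "on_divisor (cs ! i) (cs ! j)" using l unfolding j(2) on_divisor_slopes by (simp add: cs_def)
    ultimately show False using t k j by (auto simp: terminal_def cs_def)
  qed
next
  define cs where "cs = desing_centers F"
  note cs = desing_centers[folded cs_def]
  assume t: "\<forall>c. l @ [c] \<notin> nodes Z"
  show "terminal (desing_centers F) i" unfolding terminal_def
  proof (intro allI impI notI)
    fix j assume j: "i < j \<and> j < length (desing_centers F)"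
      and d: "on_divisor (desing_centers F ! i) (desing_centers F ! j)"
    have "cs ! j \<in> set cs" using j cs_def by simp
    then obtain l' where l': "cs ! j = map Slope l'" "l' = [] \<or> l' \<in> nodes Z"
      unfolding cs(2) by (auto simp: centers_def)
    have "on_divisor (map Slope l) (map Slope l')" using d unfolding l l'(1)[unfolded cs_def] .
    then have "l' \<noteq> []" "l = butlast l'" unfolding on_divisor_slopes map_Slope_eq_iff by blast+
    then have "l' = l @ [last l']" by (metis append_butlast_last_id)
    then have "l @ [last l'] \<in> nodes Z" using l'(2) \<open>l' \<noteq> []\<close> by metis
    then show False using t by blast
  qed
qed

lemma mu_T_eq: "card {i. i < length (desing_centers F) \<and> terminal (desing_centers F) i} = 
    card {l. (l = [] \<or> l \<in> nodes Z) \<and> (\<forall>c. l @ [c] \<notin> nodes Z)}"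
proof -
  define cs where "cs = desing_centers F"
  note cs = desing_centers[folded cs_def]
  define P where "P = (\<lambda>p. \<exists>l. p = map Slope l \<and> (\<forall>c. l @ [c] \<notin> nodes Z))"
  have "terminal cs i \<longleftrightarrow> P (cs ! i)" if i: "i < length cs" for i
  proof -
    have "cs ! i \<in> centers Z" using nth_mem[OF i] unfolding cs(2) .
    then obtain l where l: "cs ! i = map Slope l" unfolding centers_def by (elim imageE) (rule that)
    have "terminal cs i \<longleftrightarrow> (\<forall>c. l @ [c] \<notin> nodes Z)"
      using terminal_iff[of i l, folded cs_def] i l by blast
    moreover have "P (cs ! i) \<longleftrightarrow> (\<forall>c. l @ [c] \<notin> nodes Z)" unfolding P_def l map_Slope_eq_iff by blast
    ultimately show ?thesis by blast
  qed
  then have "{i. i < length cs \<and> terminal cs i} = {i. i < length cs \<and> P (cs ! i)}" by auto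
  then have "card {i. i < length cs \<and> terminal cs i} = card {p \<in> centers Z. P p}"
    using card_indices[OF cs(3), of P] cs(2) by simp
  also have "{p \<in> centers Z. P p} = map Slope ` {l. (l = [] \<or> l \<in> nodes Z) \<and> (\<forall>c. l @ [c] \<notin> nodes Z)}"
  proof -
    have "{p \<in> centers Z. P p} = map Slope ` {l. (l = [] \<or> l \<in> nodes Z) \<and> P (map Slope l)}"
      unfolding centers_def by blast
    also have "{l. (l = [] \<or> l \<in> nodes Z) \<and> P (map Slope l)} = 
        {l. (l = [] \<or> l \<in> nodes Z) \<and> (\<forall>c. l @ [c] \<notin> nodes Z)}"
      unfolding P_def map_Slope_eq_iff by blast
    finally show ?thesis .
  qed
  also have "card \<dots> = card {l. (l = [] \<or> l \<in> nodes Z) \<and> (\<forall>c. l @ [c] \<notin> nodes Z)}"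
    by (rule card_image) (simp add: inj_on_def)
  finally show ?thesis by (simp add: cs_def)
qed

lemma mu_D_eq: "card {i. i < length (desing_centers F) \<and> (\<exists>p \<in> points_over (set (desing_centers F)).
      on_divisor (desing_centers F ! i) p \<and> vanishes (strict_at p F))} =
    card {l. (l = [] \<or> l \<in> nodes Z) \<and> (\<exists>c. l @ [c] \<notin> nodes Z \<and> (\<exists>z\<in>Z. follows (l @ [c]) z))}"
proof -
  define cs where "cs = desing_centers F"
  note cs = desing_centers[folded cs_def]
  define P where "P = (\<lambda>q. \<exists>p \<in> points_over (set cs). on_divisor q p \<and> vanishes (strict_at p F))"
  have P: "P (map Slope l) \<longleftrightarrow> (\<exists>c. l @ [c] \<notin> nodes Z \<and> (\<exists>z\<in>Z. follows (l @ [c]) z))"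
    if l: "l = [] \<or> l \<in> nodes Z" for l
  proof
    assume "P (map Slope l)"
    then obtain p where p: "p \<in> points_over (centers Z)" "on_divisor (map Slope l) p" "vanishes (strict_at p F)"
      unfolding P_def cs(2) by blast
    obtain l' z where l': "p = map Slope l'" "z \<in> Z" "follows l' z"
      using p(3) unfolding vanishes_strict_at by (elim exE conjE bexE) (rule that)
    have "l' \<noteq> []" "l = butlast l'" 
      using p(2) unfolding l'(1) on_divisor_slopes map_Slope_eq_iff by blast+
    then have "l' = l @ [last l']" by (metis append_butlast_last_id)
    moreover have "l' \<notin> nodes Z" using p(1) unfolding l'(1) points_over_def mem_Collect_eq map_Slope_in_centers by blast
    ultimately show "\<exists>c. l @ [c] \<notin> nodes Z \<and> (\<exists>z\<in>Z. follows (l @ [c]) z)" using l'(2,3) by metis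
  next
    assume "\<exists>c. l @ [c] \<notin> nodes Z \<and> (\<exists>z\<in>Z. follows (l @ [c]) z)"
    then obtain c z where c: "l @ [c] \<notin> nodes Z" "z \<in> Z" "follows (l @ [c]) z" by blast
    have notin: "map Slope (l @ [c]) \<notin> centers Z" using c by (simp only: map_Slope_in_centers) simp
    have "butlast (map Slope (l @ [c])) = map Slope l" by simp
    then have "map Slope (l @ [c]) \<in> points_over (set cs)"
      using l notin unfolding points_over_def cs(2) mem_Collect_eq by (metis map_Slope_in_centers)
    moreover have "on_divisor (map Slope l) (map Slope (l @ [c]))" unfolding on_divisor_slopes by simp
    moreover have "vanishes (strict_at (map Slope (l @ [c])) F)"
      unfolding vanishes_strict_at using c(2,3) by (intro exI[of _ "l @ [c]"] conjI bexI[of _ z]) simp_all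
    ultimately show "P (map Slope l)" unfolding P_def by blast
  qed
  have "card {i. i < length cs \<and> P (cs ! i)} = card {p \<in> centers Z. P p}"
    using card_indices[OF cs(3), of P] cs(2) by simp
  also have "{p \<in> centers Z. P p} = map Slope ` {l. (l = [] \<or> l \<in> nodes Z) \<and> (\<exists>c. l @ [c] \<notin> nodes Z \<and> (\<exists>z\<in>Z. follows (l @ [c]) z))}"
  proof -
    have "{p \<in> centers Z. P p} = map Slope ` {l. (l = [] \<or> l \<in> nodes Z) \<and> P (map Slope l)}"
      unfolding centers_def by blast
    also have "{l. (l = [] \<or> l \<in> nodes Z) \<and> P (map Slope l)} = 
        {l. (l = [] \<or> l \<in> nodes Z) \<and> (\<exists>c. l @ [c] \<notin> nodes Z \<and> (\<exists>z\<in>Z. follows (l @ [c]) z))}"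
      using P by blast
    finally show ?thesis .
  qed
  also have "card \<dots> = card {l. (l = [] \<or> l \<in> nodes Z) \<and> (\<exists>c. l @ [c] \<notin> nodes Z \<and> (\<exists>z\<in>Z. follows (l @ [c]) z))}"
    by (rule card_image) (simp add: inj_on_def)
  finally show ?thesis by (simp add: cs_def P_def)
qed

lemma virtual_multiplicities_nodes:
  assumes "[] \<in> nodes Z"
  shows "card {i. i < length (desing_centers F) \<and> terminal (desing_centers F) i} = card (terminal_nodes Z)"
    and "card {i. i < length (desing_centers F) \<and> (\<exists>p \<in> points_over (set (desing_centers F)).
      on_divisor (desing_centers F ! i) p \<and> vanishes (strict_at p F))} = card (divisorial_nodes Z)"
proof -
  have "l = [] \<or> l \<in> nodes Z \<longleftrightarrow> l \<in> nodes Z" for l using assms by blast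
  note * = this
  show "card {i. i < length (desing_centers F) \<and> terminal (desing_centers F) i} = card (terminal_nodes Z)"
    unfolding mu_T_eq terminal_nodes_def * ..
  show "card {i. i < length (desing_centers F) \<and> (\<exists>p \<in> points_over (set (desing_centers F)).
      on_divisor (desing_centers F ! i) p \<and> vanishes (strict_at p F))} = card (divisorial_nodes Z)"
    unfolding mu_D_eq divisorial_nodes_def * ..
qed

lemma virtual_multiplicities_single:
  assumes "[] \<notin> nodes Z"
  shows "card {i. i < length (desing_centers F) \<and> terminal (desing_centers F) i} \<le> 1"
    and "card {i. i < length (desing_centers F) \<and> (\<exists>p \<in> points_over (set (desing_centers F)).
      on_divisor (desing_centers F ! i) p \<and> vanishes (strict_at p F))} \<le> 1"
proof -
  have "nodes Z = {}" using assms by (auto simp: nodes_def)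
  then have "{l. (l = [] \<or> l \<in> nodes Z) \<and> Q l} \<subseteq> {[]}" for Q by auto
  then have *: "card {l. (l = [] \<or> l \<in> nodes Z) \<and> Q l} \<le> 1" for Q
    using card_mono[of "{[] :: complex list}" "{l. (l = [] \<or> l \<in> nodes Z) \<and> Q l}"] by simp
  show "card {i. i < length (desing_centers F) \<and> terminal (desing_centers F) i} \<le> 1"
    unfolding mu_T_eq by (rule *)
  show "card {i. i < length (desing_centers F) \<and> (\<exists>p \<in> points_over (set (desing_centers F)).
      on_divisor (desing_centers F ! i) p \<and> vanishes (strict_at p F))} \<le> 1"
    unfolding mu_D_eq by (rule *)
qed

end

section \<open>Orders of polynomials and the residue formula\<close>

abbreviation taylor :: "complex \<Rightarrow> complex poly \<Rightarrow> complex poly" where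
  "taylor c P \<equiv> pcompose P [:c, 1:]"

text \<open>The first non-zero coefficient of the Taylor expansion at \<open>c\<close>.\<close>

definition lowest :: "complex \<Rightarrow> complex poly \<Rightarrow> complex" where
  "lowest c P = coeff (taylor c P) (order c P)"

definition pos_multiple :: "complex \<Rightarrow> complex \<Rightarrow> bool" where
  "pos_multiple a b \<longleftrightarrow> (\<exists>r::real. r > 0 \<and> a = of_real r * b)"

lemma lowest_nonzero: "P \<noteq> 0 \<Longrightarrow> lowest c P \<noteq> 0"
  unfolding lowest_def by (rule coeff_pcompose_order(2))

lemma lowest_mult:
  assumes "P \<noteq> 0" "Q \<noteq> 0" shows "lowest c (P * Q) = lowest c P * lowest c Q"
proof -
  have ord: "order c (P * Q) = order c P + order c Q" using assms by (simp add: order_mult)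
  have "coeff (taylor c P * taylor c Q) (order c P + order c Q) = 
      (\<Sum>i\<le>order c P + order c Q. coeff (taylor c P) i * coeff (taylor c Q) (order c P + order c Q - i))"
    by (simp add: coeff_mult)
  also have "\<dots> = (\<Sum>i\<le>order c P + order c Q. if i = order c P then lowest c P * lowest c Q else 0)"
  proof (intro sum.cong refl)
    fix i assume "i \<in> {..order c P + order c Q}"
    then show "coeff (taylor c P) i * coeff (taylor c Q) (order c P + order c Q - i) =
        (if i = order c P then lowest c P * lowest c Q else 0)"
      using coeff_pcompose_order(1)[OF assms(1), of i c] coeff_pcompose_order(1)[OF assms(2), of "order c P + order c Q - i" c]
      by (cases "i < order c P"; cases "i = order c P") (auto simp: lowest_def)
  qed
  finally show ?thesis by (simp add: lowest_def ord pcompose_mult)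
qed

lemma sum_order_le_degree:
  fixes P :: "complex poly"
  assumes "P \<noteq> 0" "finite S" shows "(\<Sum>c\<in>S. order c P) \<le> degree P"
proof -
  have "(\<Sum>c\<in>S. order c P) = (\<Sum>c\<in>S \<inter> set_mset (proots P). count (proots P) c)"
    using assms by (intro sum.mono_neutral_cong_right) (auto simp: order_root)
  also have "\<dots> \<le> (\<Sum>c\<in>set_mset (proots P). count (proots P) c)" by (intro sum_mono2) auto
  also have "\<dots> = size (proots P)" by (simp add: size_multiset_overloaded_eq)
  also have "\<dots> \<le> degree P" by (rule size_proots_le)
  finally show ?thesis .
qed

lemma monic_prod_linear:
  fixes K :: "complex set"
  assumes "finite K" 
  shows "degree (\<Prod>b\<in>K. [:- b, 1:]) = card K" "coeff (\<Prod>b\<in>K. [:- b, 1:]) (card K) = 1"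
proof -
  show deg: "degree (\<Prod>b\<in>K. [:- b, 1:]) = card K" by (subst degree_prod_eq_sum_degree) auto
  have "lead_coeff (\<Prod>b\<in>K. [:- b, 1:]) = 1" by (simp add: lead_coeff_prod)
  then show "coeff (\<Prod>b\<in>K. [:- b, 1:]) (card K) = 1" by (simp only: deg)
qed

text \<open>
  The sum of the residues of \<open>D / N\<close> is its coefficient of \<open>1 / z\<close> at infinity. If all of them are
  positive, so is the ratio of the leading coefficients. This is the form in which the
  Camacho-Sad formula enters.
\<close>

lemma positive_residues:
  fixes N D :: "complex poly"
  assumes K: "finite K" "card K = degree N" "K \<noteq> {}" and N: "N \<noteq> 0" and deg: "degree D < degree N"
    and pos: "\<And>c. c \<in> K \<Longrightarrow> order c N = 1 \<and> order c D = 0 \<and> pos_multiple (lowest c N) (lowest c D)"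
    and D: "D \<noteq> 0"
  shows "degree N = degree D + 1 \<and> pos_multiple (lead_coeff N) (lead_coeff D)"
proof -
  define q where "q = card K"
  have q: "q \<ge> 1" by (simp add: q_def Suc_le_eq card_gt_0_iff K(1,3))
  define L where "L = (\<lambda>c. \<Prod>b\<in>K - {c}. [:- b, 1:])"
  define W where "W = (\<Prod>b\<in>K. [:- b, 1:])"
  have split: "W = [:- c, 1:] * L c" if "c \<in> K" for c
    unfolding W_def L_def using K that by (simp add: prod.remove)
  have L0: "poly (L c) c \<noteq> 0" for c using K by (simp add: L_def poly_prod)
  have Lb: "poly (L c) b = 0" if "b \<in> K" "b \<noteq> c" for b c
    using K that by (auto simp: L_def poly_prod)
  \<comment> \<open>as many zeros as the degree: \<open>N\<close> is a multiple of the product of the linear factors\<close>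
  obtain a where a: "N = smult a W"
  proof -
    define E where "E = N - smult (lead_coeff N) W"
    have degW: "degree W = degree N" "coeff W (degree N) = 1" using monic_prod_linear[OF K(1)] K(2) by (simp_all add: W_def)
    have "E = 0"
    proof (rule ccontr)
      assume E: "E \<noteq> 0"
      have "degree E \<le> degree N" unfolding E_def using degW by (intro degree_diff_le) auto
      moreover have "coeff E (degree N) = 0" using degW by (simp add: E_def)
      ultimately have dE: "degree E < degree N" using E by (metis leading_coeff_0_iff le_neq_implies_less)
      have "poly E c = 0" if "c \<in> K" for c
      proof -
        have "poly N c = 0" using pos[OF that] by (simp add: order_root)
        moreover have "poly W c = 0" using split[OF that] by simp
        ultimately show ?thesis by (simp add: E_def)
      qed
      then have "K \<subseteq> {x. poly E x = 0}" by auto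
      then have "card K \<le> card {x. poly E x = 0}" using poly_roots_finite[OF E] by (intro card_mono)
      also have "\<dots> \<le> degree E" by (rule card_poly_roots_bound[OF E])
      finally show False using dE K by simp
    qed
    then show ?thesis using that by (simp add: E_def)
  qed
  have a0: "a \<noteq> 0" using N a by auto
  have lowN: "lowest c N = a * poly (L c) c" if c: "c \<in> K" for c
  proof -
    have "order c N = 1" using pos[OF c] by simp
    then have "lowest c N = coeff (taylor c N) 1" by (simp add: lowest_def)
    also have "taylor c N = smult a ([:0, 1:] * taylor c (L c))"
    proof -
      have "taylor c [:- c, 1:] = [:0, 1:]" by (simp add: pcompose_pCons)
      then show ?thesis by (simp only: a split[OF c] pcompose_smult pcompose_mult)
    qed
    also have "coeff \<dots> 1 = a * poly (L c) c" by simp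
    finally show ?thesis .
  qed
  have lowD: "lowest c D = poly D c" if c: "c \<in> K" for c using pos[OF c] by (simp add: lowest_def)
  have "\<exists>r::real. r > 0 \<and> a * poly (L c) c = of_real r * poly D c" if "c \<in> K" for c
    using pos[OF that] lowN[OF that] lowD[OF that] by (simp add: pos_multiple_def)
  then obtain r :: "complex \<Rightarrow> real" where r: "\<And>c. c \<in> K \<Longrightarrow> r c > 0" 
    "\<And>c. c \<in> K \<Longrightarrow> a * poly (L c) c = of_real (r c) * poly D c" by metis
  \<comment> \<open>Lagrange interpolation of \<open>D\<close> at the zeros of \<open>N\<close>, with leading coefficient a sum of residues\<close>
  define T where "T = (\<Sum>c\<in>K. smult (poly D c / poly (L c) c) (L c))"
  have degL: "degree (L c) = q - 1" "coeff (L c) (q - 1) = 1" if "c \<in> K" for c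
    using monic_prod_linear[of "K - {c}"] K that by (simp_all add: L_def q_def card_Diff_singleton)
  have "D - T = 0"
  proof (rule ccontr)
    assume E: "D - T \<noteq> 0"
    have "degree T \<le> q - 1" unfolding T_def using degL by (intro degree_sum_le K) (auto intro: order_trans[OF degree_smult_le])
    moreover have "degree D \<le> q - 1" using deg K by (simp add: q_def)
    ultimately have dE: "degree (D - T) \<le> q - 1" by (simp add: degree_diff_le)
    have "poly (D - T) b = 0" if b: "b \<in> K" for b
    proof -
      have "poly T b = (\<Sum>c\<in>K. if c = b then poly D b else 0)"
        unfolding T_def poly_sum poly_smult using Lb L0 b by (intro sum.cong) auto
      then show ?thesis using K b by simp
    qed
    then have "K \<subseteq> {x. poly (D - T) x = 0}" by auto
    then have "card K \<le> card {x. poly (D - T) x = 0}" using poly_roots_finite[OF E] by (intro card_mono)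
    also have "\<dots> \<le> degree (D - T)" by (rule card_poly_roots_bound[OF E])
    finally show False using dE q by (simp add: q_def)
  qed
  then have "coeff D (q - 1) = coeff T (q - 1)" by simp
  also have "\<dots> = (\<Sum>c\<in>K. poly D c / poly (L c) c * coeff (L c) (q - 1))"
    by (simp add: T_def coeff_sum)
  also have "\<dots> = (\<Sum>c\<in>K. a / of_real (r c))"
  proof (intro sum.cong refl)
    fix c assume c: "c \<in> K"
    show "poly D c / poly (L c) c * coeff (L c) (q - 1) = a / of_real (r c)"
      using r(1)[OF c] r(2)[OF c] L0[of c] degL[OF c] by (simp add: field_simps)
  qed
  also have "\<dots> = a * of_real (\<Sum>c\<in>K. 1 / r c)" by (simp add: sum_distrib_left)
  finally have cD: "coeff D (q - 1) = a * of_real (\<Sum>c\<in>K. 1 / r c)" .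
  define S where "S = (\<Sum>c\<in>K. 1 / r c)"
  have S: "S > 0" unfolding S_def using K r by (intro sum_pos) auto
  have cD: "coeff D (q - 1) = a * of_real S" using cD by (simp only: S_def)
  then have "q - 1 \<le> degree D" using S a0 by (intro le_degree) simp
  then have dD: "degree D = q - 1" using deg K by (simp add: q_def)
  have "lead_coeff N = a" using a monic_prod_linear[OF K(1)] a0 by (simp add: W_def)
  moreover have "a = of_real (1 / S) * lead_coeff D" using cD S dD by (simp add: field_simps)
  ultimately have "pos_multiple (lead_coeff N) (lead_coeff D)"
    unfolding pos_multiple_def using S by (intro exI[of _ "1 / S"]) simp
  then show ?thesis using dD q K by (simp add: q_def)
qed

section \<open>Counting on one component of the divisor\<close>

text \<open>
  After division by the common factors, the equation \<open>x A z' = R\<close> is \<open>x z' = \<lambda> (z - c) + \<dots>\<close> near such a point, with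
  \<open>\<lambda> > 0\<close>. Only over these points a component that is not invariant can arise after a few blow-ups without any loss
  in the orders of \<open>A\<close> and \<open>R\<close>.
\<close>

definition node_at :: "complex poly \<Rightarrow> complex poly \<Rightarrow> complex \<Rightarrow> bool" where
  "node_at A R c \<longleftrightarrow> order c R = order c A + 1 \<and> pos_multiple (lowest c R) (lowest c A)"

text \<open>
  The two counts are treated together: \<open>\<rho> = 1\<close> for the components that meet the curve, \<open>\<rho> = 2\<close>
  for twice the terminal ones. Here \<open>C\<close> is the set of points of a component through which branches pass, 
  \<open>M\<close> is the set of those through which several branches pass, and \<open>own_count\<close> is the contribution of the component.
\<close>

definition own_count :: "nat \<Rightarrow> complex set \<Rightarrow> complex set \<Rightarrow> nat" where
  "own_count \<rho> C M = (if \<rho> = 1 then (if C - M \<noteq> {} then 1 else 0) else (if M = {} then 2 else 0))"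

locale component_count =
  fixes \<rho> :: nat and C M :: "complex set"
  assumes \<rho>: "\<rho> = 1 \<or> \<rho> = 2" and C: "finite C" and M: "M \<subseteq> C"
    and several: "M = C \<and> M \<noteq> {} \<or> card C \<ge> 2"
begin

lemma finite_M: "finite M" using C M by (rule rev_finite_subset)

lemma own_cases:
  obtains (none) "own_count \<rho> C M = 0" "M \<noteq> {}" 
  | (single) c0 where "\<rho> = 1" "own_count \<rho> C M = 1" "c0 \<in> C - M" "card C \<ge> 2"
  | (all) "\<rho> = 2" "own_count \<rho> C M = 2" "M = {}" "card C \<ge> 2"
proof (cases "\<rho> = 1")
  case True
  show ?thesis
  proof (cases "C - M = {}")
    case True
    then have "own_count \<rho> C M = 0" "M \<noteq> {}" using \<open>\<rho> = 1\<close> several M by (auto simp: own_count_def)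
    then show ?thesis by (rule none)
  next
    case False
    then obtain c0 where "c0 \<in> C - M" by blast
    moreover have "own_count \<rho> C M = 1" using False True by (simp add: own_count_def)
    moreover have "card C \<ge> 2" using False several by auto
    ultimately show ?thesis using True by (intro single)
  qed
next
  case False
  then have "\<rho> = 2" using \<rho> by simp
  then show ?thesis using several none all by (cases "M = {}") (auto simp: own_count_def)
qed

text \<open>
  Here every point is allowed, and \<open>q\<close> is bounded by the order of tangency with the component, a zero of \<open>A\<close>.
\<close>

lemma count_dicritical:
  assumes A: "A \<noteq> 0" and q: "\<And>c. c \<in> M \<Longrightarrow> q c \<le> 2 * order c A"
  shows "own_count \<rho> C M + sum q M \<le> \<rho> + 2 * degree A"
proof -
  have "sum q M \<le> (\<Sum>c\<in>M. 2 * order c A)" by (intro sum_mono q)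
  also have "\<dots> \<le> 2 * degree A" using sum_order_le_degree[OF A finite_M] by (simp add: sum_distrib_left[symmetric])
  finally show ?thesis by (cases rule: own_cases) auto
qed

text \<open>
  Every point of \<open>C\<close> is a zero of \<open>R\<close>. The loss of \<open>2\<close> at each point of \<open>M\<close>, or the points outside \<open>M\<close>, pay
  for the summand \<open>2\<close> and for the contribution of the component itself.
\<close>

lemma count_irregular:
  assumes R: "R \<noteq> 0" and zero: "\<And>c. c \<in> C \<Longrightarrow> order c R \<ge> 1" 
    and q: "\<And>c. c \<in> M \<Longrightarrow> q c \<le> 2 * (order c R - 1)"
  shows "own_count \<rho> C M + sum q M + 2 \<le> 2 * degree R"
proof -
  have a: "sum q M \<le> (\<Sum>c\<in>M. 2 * (order c R - 1))" by (intro sum_mono q)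
  have b: "(\<Sum>c\<in>M. 2 * (order c R - 1)) + 2 * card M = 2 * (\<Sum>c\<in>M. order c R)"
  proof -
    have "(\<Sum>c\<in>M. 2 * (order c R - 1)) + 2 * card M = (\<Sum>c\<in>M. 2 * (order c R - 1) + 2)"
      by (simp only: sum.distrib sum_constant) simp
    also have "\<dots> = (\<Sum>c\<in>M. 2 * order c R)"
    proof (intro sum.cong refl)
      fix c assume "c \<in> M"
      then have "order c R \<ge> 1" using zero M by blast
      then show "2 * (order c R - 1) + 2 = 2 * order c R" by simp
    qed
    finally show ?thesis by (simp add: sum_distrib_left)
  qed
  have d: "(\<Sum>c\<in>M. order c R) + card (C - M) \<le> degree R"
  proof -
    have "card (C - M) \<le> (\<Sum>c\<in>C - M. order c R)"
      using sum_mono[of "C - M" "\<lambda>_. 1::nat" "\<lambda>c. order c R"] zero by auto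
    moreover have "(\<Sum>c\<in>C. order c R) = (\<Sum>c\<in>M. order c R) + (\<Sum>c\<in>C - M. order c R)"
      using C M by (metis add.commute sum.subset_diff)
    ultimately show ?thesis using sum_order_le_degree[OF R C] by simp
  qed
  have e: "card C = card M + card (C - M)" using C M by (simp add: card_Diff_subset card_mono finite_M)
  have ab: "sum q M + 2 * card M \<le> 2 * (\<Sum>c\<in>M. order c R)"
    using add_right_mono[OF a, of "2 * card M"] unfolding b .
  define x y k l where "x = sum q M" and "y = (\<Sum>c\<in>M. order c R)" and "k = card M" and "l = card (C - M)"
  note * = ab[folded x_def y_def k_def] d[folded y_def l_def] e[folded k_def l_def]
  show ?thesis unfolding x_def[symmetric]
  proof (cases rule: own_cases)
    case none
    then have "card M \<ge> 1" using finite_M by (simp add: Suc_le_eq card_gt_0_iff)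
    then show "own_count \<rho> C M + x + 2 \<le> 2 * degree R" using * none(1) unfolding k_def[symmetric] by linarith
  next
    case (single c0)
    have "C - M \<noteq> {}" using single(3) by blast
    then have "card (C - M) \<ge> 1" using C by (simp only: Suc_le_eq One_nat_def card_gt_0_iff) simp
    then show "own_count \<rho> C M + x + 2 \<le> 2 * degree R" using * single(2,4) unfolding l_def[symmetric] by linarith
  next
    case all
    then have "k = 0" "x = 0" by (simp_all add: k_def x_def)
    then show "own_count \<rho> C M + x + 2 \<le> 2 * degree R" using * all(2,4) by linarith
  qed
qed

text \<open>
  On a component where the two sides of the equation have the same order, \<open>A\<close> and \<open>R\<close> are
  divided by their gcd. The zeros of \<open>N = R / gcd\<close> which are nodes are at most
  \<open>degree N\<close>, and not all zeros of \<open>N\<close> are nodes unless the residue formula permits it.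
\<close>

lemma count_regular:
  assumes A: "A \<noteq> 0" and R: "R \<noteq> 0" and zero: "\<And>c. c \<in> C \<Longrightarrow> order c R \<ge> 1" 
    and q: "\<And>c. c \<in> M \<Longrightarrow> q c \<le> 2 * min (order c R - 1) (order c A) + (if node_at A R c then \<rho> else 0)"
  defines "Q \<equiv> own_count \<rho> C M + sum q M"
  shows "degree R \<le> degree A + 1 \<Longrightarrow> Q \<le> 2 * degree A + \<rho>"
    and "degree R \<le> degree A + 1 \<Longrightarrow> \<not> (degree R = degree A + 1 \<and> pos_multiple (lead_coeff R) (lead_coeff A)) \<Longrightarrow>
      Q \<le> 2 * degree A"
    and "degree R \<ge> degree A + 2 \<Longrightarrow> Q + 2 \<le> 2 * degree R"
proof -
  define G where "G = gcd A R"
  have G0: "G \<noteq> 0" using A by (simp add: G_def)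
  obtain D where D: "A = G * D" using gcd_dvd1[of A R] by (auto simp: G_def dvd_def)
  obtain N where N: "R = G * N" using gcd_dvd2[of A R] by (auto simp: G_def dvd_def)
  have nz: "D \<noteq> 0" "N \<noteq> 0" using A R D N by auto
  have cop: "order c D = 0 \<or> order c N = 0" for c
  proof (rule ccontr)
    assume "\<not> ?thesis"
    then have "[:-c, 1:] dvd D" "[:-c, 1:] dvd N" by (auto simp: order_root poly_eq_0_iff_dvd[symmetric])
    then have "G * [:-c, 1:] dvd A" "G * [:-c, 1:] dvd R" unfolding D N using mult_dvd_mono[OF dvd_refl[of G]] by blast+
    then have "G * [:-c, 1:] dvd gcd A R" by (rule gcd_greatest)
    then have "G * [:-c, 1:] dvd G * 1" by (simp only: G_def mult_1_right)
    then have "[:-c, 1:] dvd (1 :: complex poly)" using G0 dvd_mult_cancel_left[of G] by blast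
    then show False by (simp add: is_unit_poly_iff)
  qed
  define g p m where "g = degree G" and "p = degree D" and "m = degree N"
  have deg: "degree A = g + p" "degree R = g + m"
    using G0 nz by (simp_all add: D N g_def p_def m_def degree_mult_eq)
  have ord: "order c A = order c G + order c D" "order c R = order c G + order c N" for c
    using A R by (simp_all add: D N order_mult)
  define K where "K = {c \<in> M. node_at A R c}"
  define E where "E = {c \<in> M. order c N = 0}"
  have K: "finite K" "K \<subseteq> M" and E: "finite E" using finite_M by (auto simp: K_def E_def)
  have nodeK: "order c N = 1 \<and> order c D = 0 \<and> pos_multiple (lowest c N) (lowest c D)" if "c \<in> K" for c
  proof -
    have "order c R = order c A + 1" "pos_multiple (lowest c R) (lowest c A)"
      using that by (auto simp: K_def node_at_def)
    then obtain r :: real where r: "r > 0" "lowest c G * lowest c N = of_real r * (lowest c G * lowest c D)"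
      using G0 nz by (auto simp: pos_multiple_def D N lowest_mult)
    then have "lowest c G * lowest c N = lowest c G * (of_real r * lowest c D)" by (simp add: mult_ac)
    then have "lowest c N = of_real r * lowest c D" using lowest_nonzero[OF G0, of c] by simp
    moreover have "order c N = 1" "order c D = 0" using \<open>order c R = order c A + 1\<close> cop[of c] ord[of c] by auto
    ultimately show ?thesis using r(1) unfolding pos_multiple_def by blast
  qed
  have Km: "card K + (\<Sum>c\<in>S. order c N) \<le> m" if S: "finite S" "S \<inter> K = {}" for S
  proof -
    have "card K = (\<Sum>c\<in>K. order c N)" using nodeK by simp
    then have "card K + (\<Sum>c\<in>S. order c N) = (\<Sum>c\<in>K \<union> S. order c N)"
      using S K by (subst sum.union_disjoint) auto
    also have "\<dots> \<le> m" unfolding m_def using nz S K by (intro sum_order_le_degree) auto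
    finally show ?thesis .
  qed
  \<comment> \<open>the residue formula, for the case that all zeros of \<open>N\<close> are nodes\<close>
  have res: "card K < m" if "m > p" "m \<noteq> p + 1 \<or> \<not> pos_multiple (lead_coeff R) (lead_coeff A)"
  proof (rule ccontr)
    assume "\<not> card K < m"
    then have "card K = m" using Km[of "{}"] by simp
    moreover have "K \<noteq> {}" using \<open>card K = m\<close> that by auto
    moreover have "degree D < degree N" using that by (simp add: m_def p_def)
    ultimately have "m = p + 1 \<and> pos_multiple (lead_coeff N) (lead_coeff D)"
      using positive_residues[OF K(1) _ _ nz(2) _ nodeK nz(1)] unfolding m_def p_def by blast
    moreover have "pos_multiple (lead_coeff R) (lead_coeff A)" if "pos_multiple (lead_coeff N) (lead_coeff D)"
      using that by (auto simp: pos_multiple_def D N lead_coeff_mult mult_ac)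
    ultimately show False using that by blast
  qed
  define s where "s = (\<Sum>c\<in>C - M. order c G)"
  have sumG: "(\<Sum>c\<in>M. order c G) + s \<le> g"
  proof -
    have "(\<Sum>c\<in>M. order c G) + s = (\<Sum>c\<in>C. order c G)"
      unfolding s_def using C M by (metis add.commute sum.subset_diff)
    then show ?thesis using sum_order_le_degree[OF G0 C] by (simp add: g_def)
  qed
  \<comment> \<open>\<open>E\<close> and \<open>s\<close> measure the zeros of the gcd that are not used up by the points of \<open>M\<close>\<close>
  have bound: "sum q M + 2 * card E + 2 * s \<le> 2 * g + \<rho> * card K"
  proof -
    have one: "q c + (if c \<in> E then 2 else 0) \<le> 2 * order c G + (if c \<in> K then \<rho> else 0)" if c: "c \<in> M" for c
    proof -
      have "order c R \<ge> 1" using zero c M by blast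
      then have "2 * min (order c R - 1) (order c A) + (if c \<in> E then 2 else 0) \<le> 2 * order c G"
        using c cop[of c] ord[of c] by (auto simp: E_def)
      moreover have "q c \<le> 2 * min (order c R - 1) (order c A) + (if c \<in> K then \<rho> else 0)"
        using q[OF c] c by (simp add: K_def)
      ultimately show ?thesis by linarith
    qed
    have "sum q M + 2 * card E = (\<Sum>c\<in>M. q c + (if c \<in> E then 2 else 0))"
      using finite_M by (simp add: sum.distrib E_def sum.If_cases Int_def)
    also have "\<dots> \<le> (\<Sum>c\<in>M. 2 * order c G + (if c \<in> K then \<rho> else 0))" by (intro sum_mono one)
    also have "\<dots> = 2 * (\<Sum>c\<in>M. order c G) + \<rho> * card K"
      using finite_M by (simp add: sum.distrib K_def sum.If_cases Int_def sum_distrib_left)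
    finally show ?thesis using sumG by linarith
  qed
  \<comment> \<open>a point with a single branch is a zero of \<open>N\<close> that is not counted, or a zero of the gcd\<close>
  have c0: "s \<ge> 1 \<or> card K + 1 \<le> m" if "c0 \<in> C - M" for c0
  proof (cases "order c0 N = 0")
    case True
    then have "order c0 G \<ge> 1" using zero[of c0] ord[of c0] that by simp
    moreover have "order c0 G \<le> s" unfolding s_def using that C by (intro member_le_sum) auto
    ultimately show ?thesis by simp
  next
    case False
    moreover have "{c0} \<inter> K = {}" using that K by auto
    ultimately show ?thesis using Km[of "{c0}"] by simp
  qed
  have two: "2 \<le> degree R" if "card C \<ge> 2"
  proof -
    have "card C \<le> (\<Sum>c\<in>C. order c R)" using sum_mono[of C "\<lambda>_. 1::nat" "\<lambda>c. order c R"] zero by auto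
    then show ?thesis using that sum_order_le_degree[OF R C] by simp
  qed
  have Km0: "card K \<le> m" using Km[of "{}"] by simp
  show "Q \<le> 2 * degree A + \<rho>" if "degree R \<le> degree A + 1"
  proof (cases rule: own_cases)
    case none
    then show ?thesis using that bound Km0 \<rho> deg by (auto simp: Q_def)
  next
    case (single c0)
    then show ?thesis using that bound Km0 deg c0[OF single(3)] by (auto simp: Q_def)
  next
    case all
    then show ?thesis by (simp add: Q_def)
  qed
  show "Q + 2 \<le> 2 * degree R" if "degree R \<ge> degree A + 2"
  proof -
    have k: "card K < m" using res that deg by simp
    show ?thesis
    proof (cases rule: own_cases)
      case none
      then show ?thesis using that bound k \<rho> deg by (auto simp: Q_def)
    next
      case (single c0)
      then show ?thesis using that bound k deg by (auto simp: Q_def)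
    next
      case all
      then show ?thesis using that deg by (simp add: Q_def)
    qed
  qed
  show "Q \<le> 2 * degree A" if le: "degree R \<le> degree A + 1"
    and np: "\<not> (degree R = degree A + 1 \<and> pos_multiple (lead_coeff R) (lead_coeff A))"
  proof -
    have k: "card K \<le> p"
    proof (cases "m > p")
      case True
      then have "m = p + 1" using le deg by simp
      then show ?thesis using res[OF True] np deg by simp
    qed (use Km0 in simp)
    show ?thesis
    proof (cases rule: own_cases)
      case none
      then show ?thesis using bound k \<rho> deg by (auto simp: Q_def)
    next
      case (single c0)
      have "p \<ge> 1 \<or> s \<ge> 1 \<or> card E \<ge> 1"
      proof (rule ccontr)
        assume no: "\<not> ?thesis"
        obtain c1 where c1: "c1 \<in> C" "c1 \<noteq> c0"
        proof -
          have "\<not> C \<subseteq> {c0}" using single(4) card_mono[of "{c0}" C] by auto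
          then show ?thesis using that by blast
        qed
        have G1: "order c G = 0" if "c \<in> C - M" for c
        proof -
          have "order c G \<le> s" unfolding s_def using that C by (intro member_le_sum) auto
          then show ?thesis using no by simp
        qed
        have "order c1 N \<ge> 1"
        proof (cases "c1 \<in> M")
          case True
          have "E = {}" using no E by (simp add: Suc_le_eq card_gt_0_iff)
          then show ?thesis using True by (auto simp: E_def)
        next
          case False
          then show ?thesis using G1[of c1] zero[of c1] ord[of c1] c1 by simp
        qed
        moreover have "order c0 N \<ge> 1" using G1[of c0] zero[of c0] ord[of c0] single(3) by simp
        moreover have "(\<Sum>c\<in>{c0, c1}. order c N) \<le> m" unfolding m_def using nz by (intro sum_order_le_degree) auto
        ultimately have "m \<ge> 2" using c1(2) by simp
        then show False using no le deg by simp
      qed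
      then show ?thesis using bound k single deg by (auto simp: Q_def)
    next
      case all
      then have "2 \<le> degree R" using two by simp
      then show ?thesis using all le by (simp add: Q_def)
    qed
  qed
qed

end

section \<open>Blowing up along a branch\<close>

text \<open>
  Elements of \<open>\<complex>[z][[x]]\<close>. The polynomial \<open>taylor c P\<close> is \<open>P(c + z)\<close>, and \<open>blow c G\<close>
  is \<open>G(x, c + x z)\<close>.
\<close>

definition blow :: "complex \<Rightarrow> complex poly fps \<Rightarrow> complex poly fps" where
  "blow c G = Abs_fps (\<lambda>w. \<Sum>j\<le>w. monom (coeff (taylor c (G $ (w - j))) j) j)"

lemma coeff_blow: "coeff (blow c G $ w) j = (if j \<le> w then coeff (taylor c (G $ (w - j))) j else 0)"
proof -
  have "coeff (blow c G $ w) j = (\<Sum>i\<le>w. if i = j then coeff (taylor c (G $ (w - j))) j else 0)"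
    unfolding blow_def by (auto simp: coeff_sum coeff_monom intro!: sum.cong)
  then show ?thesis by simp
qed

text \<open>
  The gain \<open>w\<close> of order can be smaller than the order of the zero \<open>c\<close> of the lowest coefficient. In that case the
  coefficient of \<open>z^w\<close> is zero, so the new lowest coefficient has degree less than \<open>w\<close>.
\<close>

lemma blow_leading:
  assumes G: "G \<noteq> 0"
  obtains w where "blow c G \<noteq> 0" "subdegree (blow c G) = subdegree G + w" "w \<le> order c (G $ subdegree G)"
    "degree (blow c G $ subdegree (blow c G)) \<le> w"
    "coeff (blow c G $ subdegree (blow c G)) w = coeff (taylor c (G $ subdegree G)) w"
    "order c (G $ subdegree G) \<ge> 1 \<Longrightarrow> w \<ge> 1"
proof -
  define v where "v = subdegree G"
  define P where "P = G $ v"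
  define \<mu> where "\<mu> = order c P"
  have P: "P \<noteq> 0" using G by (simp add: P_def v_def)
  have z: "G $ k = 0" if "k < v" for k using that by (simp add: v_def nth_less_subdegree_zero)
  have "coeff (blow c G $ (v + \<mu>)) \<mu> \<noteq> 0"
    using coeff_pcompose_order(2)[OF P, of c] by (simp add: coeff_blow P_def[symmetric] \<mu>_def)
  then have nz: "blow c G $ (v + \<mu>) \<noteq> 0" by auto
  then have B: "blow c G \<noteq> 0" by auto
  have low: "blow c G $ k = 0" if "k < v" for k
    using that z by (intro poly_eqI) (simp add: coeff_blow)
  have ge: "v \<le> subdegree (blow c G)" using B low by (intro subdegree_geI) auto
  define w where "w = subdegree (blow c G) - v"
  have sw: "subdegree (blow c G) = v + w" using ge by (simp add: w_def)
  have w\<mu>: "w \<le> \<mu>" using subdegree_leI[OF nz] sw by simp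
  have deg: "degree (blow c G $ (v + w)) \<le> w"
    using z by (intro degree_le) (auto simp: coeff_blow)
  have cw: "coeff (blow c G $ (v + w)) w = coeff (taylor c P) w" by (simp add: coeff_blow P_def)
  have "w \<ge> 1" if "\<mu> \<ge> 1"
  proof (rule ccontr)
    assume "\<not> w \<ge> 1"
    then have w0: "w = 0" by simp
    have "blow c G $ v = 0"
    proof (rule poly_eqI)
      fix j
      have "coeff (taylor c P) 0 = 0" using that coeff_pcompose_order(1)[OF P, of 0 c] by (simp add: \<mu>_def)
      then show "coeff (blow c G $ v) j = coeff 0 j" using z by (cases "j = 0") (auto simp: coeff_blow P_def)
    qed
    then show False using sw w0 B nth_subdegree_nonzero[OF B] by simp
  qed
  then show ?thesis using that[of w] B sw w\<mu> deg cw by (simp add: v_def P_def \<mu>_def)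
qed

definition lead :: "complex poly fps \<Rightarrow> complex poly" where
  "lead G = G $ subdegree G"

abbreviation zvar :: "complex poly fps" where
  "zvar \<equiv> fps_const [:0, 1:]"

text \<open>
  With \<open>c + x z\<close> in place of \<open>z\<close>, the equation \<open>x A z' = R\<close> becomes \<open>x (x A) z' = R - z (x A)\<close>.
\<close>

definition child_A :: "complex \<Rightarrow> complex poly fps \<Rightarrow> complex poly fps" where
  "child_A c A = fps_X * blow c A"

definition child_R :: "complex \<Rightarrow> complex poly fps \<Rightarrow> complex poly fps \<Rightarrow> complex poly fps" where
  "child_R c A R = blow c R - zvar * child_A c A"

text \<open>
  The bounds for the equation \<open>x A z' = R\<close>. Three cases: the divisor is not invariant;
  it is invariant and \<open>A\<close>, \<open>R\<close> have the same order; it is invariant and \<open>R\<close> has smaller order.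
  In the second case the first bound, with the excess \<open>\<rho>\<close>, is needed only if the leading coefficients
  have a positive ratio; the point below it is then a node (\<open>node_at\<close>), where the excess is allowed.
\<close>

definition state_bound :: "nat \<Rightarrow> complex poly fps \<Rightarrow> complex poly fps \<Rightarrow> nat \<Rightarrow> bool" where
  "state_bound \<rho> A R q \<longleftrightarrow>
     (if R = 0 \<or> subdegree R > subdegree A then q \<le> 2 * degree (lead A) + \<rho>
      else if subdegree R = subdegree A then
        (degree (lead R) \<le> degree (lead A) + 1 \<longrightarrow> q \<le> 2 * degree (lead A) + \<rho>) \<and>
        (degree (lead R) \<le> degree (lead A) + 1 \<longrightarrow>
           \<not> (degree (lead R) = degree (lead A) + 1 \<and> pos_multiple (lead_coeff (lead R)) (lead_coeff (lead A))) \<longrightarrow>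
           q \<le> 2 * degree (lead A)) \<and>
        (degree (lead R) \<ge> degree (lead A) + 2 \<longrightarrow> q + 2 \<le> 2 * degree (lead R))
      else q + 2 \<le> 2 * degree (lead R))"

text \<open>
  What \<open>state_bound\<close> for the component over \<open>c\<close> amounts to in terms of the orders at \<open>c\<close>.
\<close>

definition class_bound :: "nat \<Rightarrow> complex poly fps \<Rightarrow> complex poly fps \<Rightarrow> complex \<Rightarrow> nat" where
  "class_bound \<rho> A R c =
     (if R = 0 \<or> subdegree R > subdegree A then 2 * order c (lead A)
      else if subdegree R = subdegree A then
        2 * min (order c (lead R) - 1) (order c (lead A)) + (if node_at (lead A) (lead R) c then \<rho> else 0)
      else 2 * (order c (lead R) - 1))"

lemma lead_nonzero [simp]: "G \<noteq> 0 \<Longrightarrow> lead G \<noteq> 0"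
  by (simp add: lead_def)

lemma subdegree_leadI: "(\<And>k. k < n \<Longrightarrow> G $ k = 0) \<Longrightarrow> G $ n \<noteq> 0 \<Longrightarrow> subdegree G = n \<and> lead G = G $ n"
  by (simp add: subdegreeI lead_def)

text \<open>
  The key step. If \<open>A\<close> or \<open>R\<close> loses degree when passing to the child, there is room in the bound;
  if it does not, the top coefficients are the lowest Taylor coefficients at \<open>c\<close>, so that the sign of
  the ratio at infinity of the child decides whether \<open>c\<close> is a node.
\<close>

lemma state_bound_child:
  assumes \<rho>: "\<rho> \<le> 2" and A: "A \<noteq> 0" 
    and zero: "R \<noteq> 0 \<Longrightarrow> subdegree R \<le> subdegree A \<Longrightarrow> order c (lead R) \<ge> 1"
    and bound: "state_bound \<rho> (child_A c A) (child_R c A R) q"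
  shows "q \<le> class_bound \<rho> A R c"
proof -
  define \<alpha> where "\<alpha> = order c (lead A)"
  define vA where "vA = subdegree A"
  obtain wA where bA: "blow c A \<noteq> 0" "subdegree (blow c A) = vA + wA" "wA \<le> \<alpha>"
    "degree (lead (blow c A)) \<le> wA" "coeff (lead (blow c A)) wA = coeff (taylor c (lead A)) wA" 
    "\<alpha> \<ge> 1 \<Longrightarrow> wA \<ge> 1"
    using blow_leading[OF A, of c] unfolding lead_def vA_def \<alpha>_def by blast
  define A' where "A' = lead (blow c A)"
  define dA where "dA = degree A'"
  have A'0: "A' \<noteq> 0" using bA by (simp add: A'_def)
  have dA: "dA \<le> wA" using bA by (simp add: dA_def A'_def)
  have dA_lt: "dA < wA" if "wA < \<alpha>"
  proof -
    have "coeff A' wA = 0" using bA(5) coeff_pcompose_order(1)[of "lead A" wA c] that A by (simp add: A'_def \<alpha>_def)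
    moreover have "wA \<ge> 1" using that bA(6) by simp
    ultimately show ?thesis using dA A'0 by (metis dA_def leading_coeff_0_iff le_neq_implies_less)
  qed
  have top_A: "lead_coeff A' = lowest c (lead A)" if "dA = wA"
  proof -
    have "wA = \<alpha>" using dA_lt that bA(3) by fastforce
    then show ?thesis using bA(5) that by (simp add: lowest_def A'_def[symmetric] dA_def \<alpha>_def)
  qed
  have cA: "child_A c A \<noteq> 0" "subdegree (child_A c A) = Suc (vA + wA)" "lead (child_A c A) = A'"
    using bA by (simp_all add: child_A_def A'_def lead_def)
  have cA_low: "child_A c A $ k = 0" if "k < Suc (vA + wA)" for k
    using that cA by (simp add: nth_less_subdegree_zero)
  define B where "B = zvar * child_A c A"
  have B_low: "B $ k = 0" if "k < Suc (vA + wA)" for k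
    using cA_low[OF that] by (simp add: B_def)
  have B_lead: "B $ Suc (vA + wA) = [:0, 1:] * A'"
    using cA by (simp add: B_def lead_def)
  have degB: "degree ([:0, 1:] * A') = dA + 1" "lead_coeff ([:0, 1:] * A') = lead_coeff A'"
    using A'0 by (simp_all add: degree_mult_eq dA_def)
  have cR: "child_R c A R = blow c R - B" by (simp add: child_R_def B_def)
  have blow0: "blow c 0 = 0" by (intro fps_ext poly_eqI) (simp add: coeff_blow)
  have neg: "lead_coeff (- ([:0, 1:] * A')) = - lead_coeff A'" "degree (- ([:0, 1:] * A')) = dA + 1"
    using A'0 by (simp_all add: dA_def)
  have not_pos: "\<not> pos_multiple (- a) a" if "a \<noteq> 0" for a
  proof
    assume "pos_multiple (- a) a"
    then obtain r :: real where r: "r > 0" "- a = of_real r * a" by (auto simp: pos_multiple_def)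
    then have "a + of_real r * a = 0" by (metis add.right_inverse)
    then have "of_real (1 + r) * a = 0" by (simp add: distrib_right)
    then have "(of_real (1 + r) :: complex) = 0" using that by (simp only: mult_eq_0_iff) simp
    then have "1 + r = 0" by (simp only: of_real_eq_0_iff)
    then show False using r by simp
  qed
  \<comment> \<open>the case where the term \<open>- z A\<close> dominates\<close>
  have dominated: "q \<le> 2 * dA" if "\<And>k. k \<le> Suc (vA + wA) \<Longrightarrow> blow c R $ k = 0"
  proof -
    have "child_R c A R $ k = 0" if "k < Suc (vA + wA)" for k
      using \<open>\<And>k. k \<le> Suc (vA + wA) \<Longrightarrow> blow c R $ k = 0\<close> that B_low by (simp add: cR)
    moreover have n: "child_R c A R $ Suc (vA + wA) = - ([:0, 1:] * A')"
      using that B_lead by (simp add: cR)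
    ultimately have s: "subdegree (child_R c A R) = Suc (vA + wA)" "lead (child_R c A R) = - ([:0, 1:] * A')"
      using subdegree_leadI[of "Suc (vA + wA)" "child_R c A R"] A'0 by auto
    then have "child_R c A R \<noteq> 0" by auto
    then have "\<not> (degree (lead (child_R c A R)) = degree A' + 1 \<and> pos_multiple (lead_coeff (lead (child_R c A R))) (lead_coeff A')) \<longrightarrow>
           q \<le> 2 * degree A'"
      using bound cA s neg dA_def by (simp add: state_bound_def)
    then show ?thesis unfolding s(2) neg(1) using not_pos[of "lead_coeff A'"] A'0 by (simp add: dA_def)
  qed
  show ?thesis
  proof (cases "R = 0")
    case True
    then have "q \<le> 2 * dA" by (intro dominated) (simp add: blow0)
    then show ?thesis using True dA bA by (simp add: class_bound_def \<alpha>_def)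
  next
    case R: False
    define \<mu> where "\<mu> = order c (lead R)"
    define vR where "vR = subdegree R"
    obtain wR where bR: "blow c R \<noteq> 0" "subdegree (blow c R) = vR + wR" "wR \<le> \<mu>"
      "degree (lead (blow c R)) \<le> wR" "coeff (lead (blow c R)) wR = coeff (taylor c (lead R)) wR"
      using blow_leading[OF R, of c] unfolding lead_def vR_def \<mu>_def by blast
    define R' where "R' = lead (blow c R)"
    have R'0: "R' \<noteq> 0" and dR': "degree R' \<le> wR" using bR by (simp_all add: R'_def)
    have bR_low: "blow c R $ k = 0" if "k < vR + wR" for k using that bR by (simp add: nth_less_subdegree_zero)
    have bR_lead: "blow c R $ (vR + wR) = R'" using bR by (simp add: R'_def lead_def)
    have top_R: "wR = \<mu> \<and> lowest c (lead R) = coeff R' wR" if "coeff R' wR \<noteq> 0"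
    proof -
      have "\<not> wR < \<mu>" using that bR(5) coeff_pcompose_order(1)[of "lead R" wR c] R by (auto simp: R'_def \<mu>_def)
      then have "wR = \<mu>" using bR(3) by simp
      then show ?thesis using bR(5) by (simp add: R'_def lowest_def \<mu>_def)
    qed
    define \<kappa> where "\<kappa> = min (\<mu> - 1) \<alpha>"
    have cb: "class_bound \<rho> A R c = (if vR > vA then 2 * \<alpha> else if vR = vA then 2 * \<kappa> + (if node_at (lead A) (lead R) c then \<rho> else 0)
        else 2 * (\<mu> - 1))"
      using R by (simp add: class_bound_def vR_def vA_def \<alpha>_def \<mu>_def \<kappa>_def)
    \<comment> \<open>the orders in \<open>x\<close> of the two terms of \<open>R(x, c + x z) - z x A(x, c + x z)\<close> are compared; in case III the
        lowest coefficients cancel, and the new component is not invariant\<close>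
    consider (I) "vR + wR < Suc (vA + wA)" | (IV) "vR + wR > Suc (vA + wA)" 
      | (II) "vR + wR = Suc (vA + wA)" "R' \<noteq> [:0, 1:] * A'" | (III) "vR + wR = Suc (vA + wA)" "R' = [:0, 1:] * A'"
      by linarith
    then show ?thesis
    proof cases
      case I
      then have "subdegree (child_R c A R) = vR + wR \<and> lead (child_R c A R) = child_R c A R $ (vR + wR)"
        using bR_low B_low bR_lead R'0 by (intro subdegree_leadI) (auto simp: cR)
      moreover have "child_R c A R $ (vR + wR) = R'" using I B_low bR_lead by (simp add: cR)
      ultimately have s: "subdegree (child_R c A R) = vR + wR" "lead (child_R c A R) = R'" by auto
      then have "child_R c A R \<noteq> 0" using R'0 by (auto simp: lead_def)
      then have "q + 2 \<le> 2 * degree R'" using bound I s cA by (simp add: state_bound_def)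
      then have q: "q + 2 \<le> 2 * wR" using dR' by simp
      have "q \<le> 2 * (\<mu> - 1)" using q bR(3) by simp
      moreover have "q \<le> 2 * \<alpha>" if "vR \<ge> vA" using q that I bA(3) by simp
      ultimately show ?thesis unfolding cb \<kappa>_def by (auto simp: min_def)
    next
      case IV
      then have "q \<le> 2 * dA" by (intro dominated bR_low) simp
      then have q: "q \<le> 2 * wA" using dA by simp
      show ?thesis unfolding cb \<kappa>_def using q IV bA(3) bR(3) by (auto simp: min_def)
    next
      case II
      have "subdegree (child_R c A R) = vR + wR \<and> lead (child_R c A R) = child_R c A R $ (vR + wR)"
        using bR_low B_low bR_lead B_lead II by (intro subdegree_leadI) (auto simp: cR)
      moreover have "child_R c A R $ (vR + wR) = R' - [:0, 1:] * A'" using II B_lead bR_lead by (simp add: cR)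
      ultimately have s: "subdegree (child_R c A R) = vR + wR" "lead (child_R c A R) = R' - [:0, 1:] * A'" by auto
      define S where "S = R' - [:0, 1:] * A'"
      have S0: "S \<noteq> 0" using II by (simp add: S_def)
      then have "child_R c A R \<noteq> 0" using s by (auto simp: lead_def S_def)
      then have b1: "degree S \<le> dA + 1 \<Longrightarrow> q \<le> 2 * dA + \<rho>" 
        and b2: "degree S \<le> dA + 1 \<Longrightarrow> \<not> (degree S = dA + 1 \<and> pos_multiple (lead_coeff S) (lead_coeff A')) \<Longrightarrow> q \<le> 2 * dA"
        and b3: "degree S \<ge> dA + 2 \<Longrightarrow> q + 2 \<le> 2 * degree S"
        using bound II s(1) cA unfolding s(2) S_def[symmetric] dA_def state_bound_def by auto
      have dS: "degree S \<le> max wR (dA + 1)" unfolding S_def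
        using degB(1) dR' by (intro degree_diff_le) auto
      have coS: "coeff S (dA + 1) = coeff R' (dA + 1) - lead_coeff A'"
        by (simp add: S_def dA_def)
      consider (big) "degree S \<ge> dA + 2" | (room) "degree S \<le> dA + 1" "dA < wA" | (tight) "degree S \<le> dA + 1" "dA = wA"
        using dA by linarith
      then show ?thesis
      proof cases
        case big
        then have "q + 2 \<le> 2 * wR" using b3 dS by simp
        then have q: "q + 2 \<le> 2 * wR" .
        have "q \<le> 2 * (\<mu> - 1)" using q bR(3) by simp
        moreover have "q \<le> 2 * \<alpha>" if "vR \<ge> vA" using q that II bA(3) by simp
        ultimately show ?thesis unfolding cb \<kappa>_def by (auto simp: min_def)
      next
        case room
        then have q: "q \<le> 2 * wA" using b1 \<rho> by simp
        show ?thesis unfolding cb \<kappa>_def using q II bA(3) bR(3) by (auto simp: min_def)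
      next
        case tight
        have \<alpha>: "wA = \<alpha>" using tight dA_lt bA(3) by fastforce
        consider "vR < vA" | "vR > vA" | "vR = vA" by linarith
        then show ?thesis
        proof cases
          assume e: "vR < vA"
          have "q \<le> 2 * wA + 2" using b1 tight \<rho> by simp
          then show ?thesis unfolding cb using e II(1) bR(3) by simp
        next
          assume e: "vR > vA"
          then have "wR \<le> wA" using II(1) by simp
          then have "coeff R' (dA + 1) = 0" using tight dR' by (intro coeff_eq_0) simp
          then have cS: "coeff S (dA + 1) = - lead_coeff A'" using coS by simp
          then have "degree S = dA + 1" using A'0 tight by (intro antisym le_degree) auto
          then have "q \<le> 2 * dA" using b2 not_pos[of "lead_coeff A'"] A'0 cS by simp
          then show ?thesis unfolding cb using e tight \<alpha> by simp
        next
          assume e: "vR = vA"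
          then have wR: "wR = dA + 1" using II(1) tight by simp
          show ?thesis
          proof (cases "degree S = dA + 1 \<and> pos_multiple (lead_coeff S) (lead_coeff A')")
            case True
            then obtain r :: real where r: "r > 0" "coeff S (dA + 1) = of_real r * lead_coeff A'"
              by (auto simp: pos_multiple_def)
            then have coR: "coeff R' wR = of_real (r + 1) * lead_coeff A'" using coS wR by (simp add: algebra_simps)
            have "coeff R' wR \<noteq> 0"
            proof
              assume "coeff R' wR = 0"
              then have "(of_real (r + 1) :: complex) = 0" using coR A'0 by (metis leading_coeff_0_iff mult_eq_0_iff)
              then show False using r(1) by (simp only: of_real_eq_0_iff)
            qed
            then have top: "wR = \<mu>" "lowest c (lead R) = coeff R' wR" using top_R by auto
            have "pos_multiple (lowest c (lead R)) (lowest c (lead A))"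
              unfolding top(2) coR pos_multiple_def using r(1) top_A[OF tight(2)] by (intro exI[of _ "r + 1"]) simp
            then have "node_at (lead A) (lead R) c"
              using wR top(1) tight \<alpha> by (simp add: node_at_def \<mu>_def \<alpha>_def)
            then show ?thesis unfolding cb using e b1 tight \<alpha> wR top(1) by (simp add: \<kappa>_def)
          next
            case False
            then have "q \<le> 2 * dA" using b2 tight by simp
            then show ?thesis unfolding cb using e tight \<alpha> wR bR(3) by (simp add: \<kappa>_def)
          qed
        qed
      qed
    next
      case III
      have dA_wR: "dA + 1 \<le> wR" using dR' degB(1) III(2) by simp
      have "child_R c A R = 0 \<or> subdegree (child_R c A R) > Suc (vA + wA)"
      proof (cases "child_R c A R = 0")
        case False
        have "child_R c A R $ k = 0" if "k \<le> Suc (vA + wA)" for k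
          using that III bR_low B_low bR_lead B_lead by (cases "k = Suc (vA + wA)") (auto simp: cR)
        then show ?thesis using False by (metis less_eq_Suc_le not_less nth_subdegree_nonzero)
      qed simp
      then have q: "q \<le> 2 * dA + \<rho>" using bound cA by (auto simp: state_bound_def dA_def)
      show ?thesis
      proof (cases "dA < wA")
        case True
        then have "q \<le> 2 * wA" using q \<rho> by simp
        then show ?thesis unfolding cb \<kappa>_def using III(1) bA(3) bR(3) by (auto simp: min_def)
      next
        case False
        then have tight: "dA = wA" using dA by simp
        then have \<alpha>: "wA = \<alpha>" using dA_lt bA(3) by fastforce
        consider "vR < vA" | "vR > vA" | "vR = vA" by linarith
        then show ?thesis
        proof cases
          assume e: "vR < vA"
          have "q \<le> 2 * wA + 2" using q tight \<rho> by simp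
          then show ?thesis unfolding cb using e III(1) bR(3) by simp
        next
          assume "vR > vA"
          then have "wR \<le> wA" using III(1) by simp
          then show ?thesis using dA_wR tight by simp
        next
          assume e: "vR = vA"
          then have wR: "wR = dA + 1" using III(1) tight by simp
          have coR: "coeff R' wR = lead_coeff A'" unfolding III(2) wR by (simp add: dA_def)
          then have top: "wR = \<mu>" "lowest c (lead R) = coeff R' wR" using top_R A'0 by auto
          have "pos_multiple (lowest c (lead R)) (lowest c (lead A))"
            unfolding top(2) coR pos_multiple_def using top_A[OF tight] by (intro exI[of _ "1"]) simp
          then have "node_at (lead A) (lead R) c"
            using wR top(1) tight \<alpha> by (simp add: node_at_def \<mu>_def \<alpha>_def)
          then show ?thesis unfolding cb using e q tight \<alpha> wR top(1) by (simp add: \<kappa>_def)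
        qed
      qed
    qed
  qed
qed

section \<open>Solutions and their tree\<close>

text \<open>
  Values at a series \<open>z(x)\<close>: \<open>evp P z\<close> is \<open>P(z(x))\<close>, and \<open>ev G z\<close> is \<open>G(x, z(x))\<close>.
\<close>

definition evp :: "complex poly \<Rightarrow> complex fps \<Rightarrow> complex fps" where
  "evp P z = poly (map_poly fps_const P) z"

lemma evp_0 [simp]: "evp 0 z = 0"
  by (simp add: evp_def)

lemma evp_pCons [simp]: "evp (pCons a P) z = fps_const a + z * evp P z"
  by (cases "a = 0 \<and> P = 0") (auto simp: evp_def map_poly_pCons)

lemma evp_add: "evp (P + Q) z = evp P z + evp Q z"
  by (induction P Q rule: poly_induct2) (simp_all add: algebra_simps flip: fps_const_add)

lemma evp_smult: "evp (smult a P) z = fps_const a * evp P z"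
  by (induction P) (simp_all add: algebra_simps flip: fps_const_mult)

lemma evp_minus: "evp (- P) z = - evp P z"
  using evp_add[of P "- P" z] by (simp add: add_eq_0_iff)

lemma evp_diff: "evp (P - Q) z = evp P z - evp Q z"
  using evp_add[of P "- Q" z] by (simp add: evp_minus)

lemma evp_sum: "evp (\<Sum>a\<in>A. F a) z = (\<Sum>a\<in>A. evp (F a) z)"
  by (induction A rule: infinite_finite_induct) (auto simp: evp_add)

lemma evp_monom: "evp (monom a n) z = fps_const a * z ^ n"
  by (induction n) (simp_all add: monom_0 monom_Suc mult_ac)

lemma evp_nth_0: "evp P z $ 0 = poly P (z $ 0)"
  by (induction P) simp_all

lemma evp_taylor: "evp P (fps_const c + z) = evp (taylor c P) z"
  by (induction P) (simp_all add: pcompose_pCons evp_add evp_smult algebra_simps)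

lemma evp_X_mult_nth: "evp P (fps_X * z) $ n = (\<Sum>j\<le>n. coeff P j * (z ^ j) $ (n - j))"
proof -
  have "evp P (fps_X * z) = (\<Sum>j\<le>degree P. fps_const (coeff P j) * (fps_X * z) ^ j)"
    by (subst poly_as_sum_of_monoms[of P, symmetric]) (simp only: evp_sum evp_monom)
  then have "evp P (fps_X * z) $ n = (\<Sum>j\<le>degree P. coeff P j * (if n < j then 0 else (z ^ j) $ (n - j)))"
    by (simp add: fps_sum_nth power_mult_distrib fps_X_power_mult_nth)
  also have "\<dots> = (\<Sum>j\<le>max n (degree P). coeff P j * (if n < j then 0 else (z ^ j) $ (n - j)))"
    by (intro sum.mono_neutral_left) (auto simp: coeff_eq_0)
  also have "\<dots> = (\<Sum>j\<le>n. coeff P j * (if n < j then 0 else (z ^ j) $ (n - j)))"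
    by (intro sum.mono_neutral_right) auto
  finally show ?thesis by simp
qed

definition ev :: "complex poly fps \<Rightarrow> complex fps \<Rightarrow> complex fps" where
  "ev G z = Abs_fps (\<lambda>m. \<Sum>k\<le>m. evp (G $ k) z $ (m - k))"

lemma ev_nth: "ev G z $ m = (\<Sum>k\<le>m. evp (G $ k) z $ (m - k))"
  by (simp add: ev_def)

lemma ev_diff: "ev (G - H) z = ev G z - ev H z"
  by (rule fps_ext) (simp add: ev_nth evp_diff sum_subtractf)

lemma ev_X_mult: "ev (fps_X * G) z = fps_X * ev G z"
proof (rule fps_ext)
  fix m
  show "ev (fps_X * G) z $ m = (fps_X * ev G z) $ m"
  proof (cases m)
    case (Suc n)
    have "(\<Sum>k\<le>Suc n. evp ((fps_X * G) $ k) z $ (Suc n - k)) = (\<Sum>k\<le>n. evp (G $ k) z $ (n - k))"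
      by (subst sum.atMost_Suc_shift) simp
    then show ?thesis using Suc by (simp add: ev_nth)
  qed (simp add: ev_nth)
qed

lemma ev_truncate: "m \<le> N \<Longrightarrow> ev G z $ m = (\<Sum>k\<le>N. fps_X ^ k * evp (G $ k) z) $ m"
proof -
  assume "m \<le> N"
  have "(\<Sum>k\<le>N. fps_X ^ k * evp (G $ k) z) $ m = (\<Sum>k\<le>N. if m < k then 0 else evp (G $ k) z $ (m - k))"
    by (simp add: fps_sum_nth fps_X_power_mult_nth)
  also have "\<dots> = (\<Sum>k\<le>m. if m < k then 0 else evp (G $ k) z $ (m - k))"
    using \<open>m \<le> N\<close> by (intro sum.mono_neutral_right) auto
  finally show ?thesis by (simp add: ev_nth)
qed

lemma ev_zvar_mult: "ev (zvar * G) z = z * ev G z"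
proof (rule fps_ext)
  fix m
  define S where "S = (\<Sum>k\<le>m. fps_X ^ k * evp (G $ k) z)"
  have "ev (zvar * G) z $ m = (\<Sum>k\<le>m. fps_X ^ k * (z * evp (G $ k) z)) $ m"
    by (subst ev_truncate[of m m]) simp_all
  also have "(\<Sum>k\<le>m. fps_X ^ k * (z * evp (G $ k) z)) = z * S"
    by (simp add: S_def sum_distrib_left mult_ac)
  also have "(z * S) $ m = (\<Sum>i=0..m. z $ i * ev G z $ (m - i))"
    unfolding fps_mult_nth by (intro sum.cong refl) (simp add: S_def ev_truncate[of _ m])
  also have "\<dots> = (z * ev G z) $ m" by (simp add: fps_mult_nth)
  finally show "ev (zvar * G) z $ m = (z * ev G z) $ m" .
qed

lemma ev_blow: "ev (blow c G) z = ev G (fps_const c + fps_X * z)"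
proof (rule fps_ext)
  fix m
  define g where "g = (\<lambda>k j. coeff (taylor c (G $ k)) j * (z ^ j) $ (m - k - j))"
  have "evp (blow c G $ w) z $ (m - w) = (\<Sum>j\<le>w. g (w - j) j)" if "w \<le> m" for w
    unfolding blow_def g_def using that by (simp add: evp_sum evp_monom fps_sum_nth)
  then have "ev (blow c G) z $ m = (\<Sum>w\<le>m. \<Sum>j\<le>w. g (w - j) j)"
    unfolding ev_nth by (intro sum.cong) auto
  also have "\<dots> = (\<Sum>(j, k)\<in>{(j, k). j + k \<le> m}. g k j)"
    by (rule sum.triangle_reindex_eq[symmetric])
  also have "\<dots> = (\<Sum>(k, j)\<in>Sigma {..m} (\<lambda>k. {..m - k}). g k j)"
    by (rule sum.reindex_bij_witness[where i = "\<lambda>(k, j). (j, k)" and j = "\<lambda>(j, k). (k, j)"]) auto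
  also have "\<dots> = (\<Sum>k\<le>m. \<Sum>j\<le>m - k. g k j)" by (simp add: sum.Sigma)
  also have "\<dots> = ev G (fps_const c + fps_X * z) $ m"
    unfolding ev_nth evp_taylor evp_X_mult_nth g_def ..
  finally show "ev (blow c G) z $ m = ev G (fps_const c + fps_X * z) $ m" .
qed

definition solution :: "complex poly fps \<Rightarrow> complex poly fps \<Rightarrow> complex fps \<Rightarrow> bool" where
  "solution A R z \<longleftrightarrow> fps_X * ev A z * fps_deriv z = ev R z"

lemma solution_child:
  assumes "solution A R (fps_const c + fps_X * z)"
  shows "solution (child_A c A) (child_R c A R) z"
proof -
  define a where "a = ev A (fps_const c + fps_X * z)"
  have "fps_X * a * (z + fps_X * fps_deriv z) = ev R (fps_const c + fps_X * z)"
    using assms unfolding solution_def a_def by (simp add: add.commute)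
  then have "fps_X * (fps_X * a) * fps_deriv z = ev R (fps_const c + fps_X * z) - z * (fps_X * a)"
    by (simp add: algebra_simps)
  then show ?thesis
    by (simp add: solution_def child_A_def child_R_def ev_diff ev_zvar_mult ev_X_mult ev_blow a_def)
qed

text \<open>
  The left-hand side has no term of order \<open>subdegree R\<close>, because of the factor \<open>x\<close>.
\<close>

lemma solution_zero:
  assumes A: "A \<noteq> 0" and R: "R \<noteq> 0" "subdegree R \<le> subdegree A" and z: "solution A R z"
  shows "order (z $ 0) (lead R) \<ge> 1"
proof -
  have low: "ev A z $ m = 0" if "m < subdegree R" for m
    unfolding ev_nth
  proof (intro sum.neutral ballI)
    fix k assume "k \<in> {..m}"
    then have "A $ k = 0" using that R(2) by (intro nth_less_subdegree_zero) simp
    then show "evp (A $ k) z $ (m - k) = 0" by simp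
  qed
  have "(\<Sum>k\<le>subdegree R. evp (R $ k) z $ (subdegree R - k)) = 
      (\<Sum>k\<in>{subdegree R}. evp (R $ k) z $ (subdegree R - k))"
  proof (intro sum.mono_neutral_right ballI)
    fix k assume "k \<in> {..subdegree R} - {subdegree R}"
    then have "R $ k = 0" by (intro nth_less_subdegree_zero) auto
    then show "evp (R $ k) z $ (subdegree R - k) = 0" by simp
  qed auto
  also have "\<dots> = evp (lead R) z $ 0" by (simp add: lead_def)
  finally have "ev R z $ subdegree R = evp (lead R) z $ 0" by (simp only: ev_nth)
  then have "poly (lead R) (z $ 0) = ev R z $ subdegree R" by (simp add: evp_nth_0)
  also have "\<dots> = (fps_X * (ev A z * fps_deriv z)) $ subdegree R" using z by (simp add: solution_def mult.assoc)
  also have "\<dots> = 0"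
  proof (cases "subdegree R")
    case (Suc v)
    then have "(fps_X * (ev A z * fps_deriv z)) $ subdegree R = (\<Sum>i=0..v. ev A z $ i * fps_deriv z $ (v - i))"
      by (simp add: fps_mult_nth[of "ev A z"])
    also have "\<dots> = 0" using low Suc by (intro sum.neutral) simp
    finally show ?thesis .
  qed simp
  finally show ?thesis using R by (simp add: order_root Suc_le_eq)
qed

definition child :: "complex fps set \<Rightarrow> complex \<Rightarrow> complex fps set" where
  "child Z c = {z. fps_const c + fps_X * z \<in> Z}"

lemma fps_split_0: "fps_const (z $ 0) + fps_X * fps_shift 1 z = (z :: complex fps)"
proof (rule fps_ext)
  fix n
  show "(fps_const (z $ 0) + fps_X * fps_shift 1 z) $ n = z $ n" by (cases n) simp_all
qed

lemma child_in: "z \<in> Z \<Longrightarrow> fps_shift 1 z \<in> child Z (z $ 0)"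
  by (simp add: child_def fps_split_0[simplified])

lemma follows_child: "follows (d # l) (fps_const c + fps_X * z) \<longleftrightarrow> d = c \<and> follows l z"
proof -
  have "fps_shift 1 (fps_const c + fps_X * z) = z" by (rule fps_ext) simp
  then show ?thesis by (auto simp: follows_Cons)
qed

lemma ex_follows_child: "(\<exists>z\<in>Z. follows (c # l) z) \<longleftrightarrow> (\<exists>z\<in>child Z c. follows l z)"
proof
  assume "\<exists>z\<in>Z. follows (c # l) z"
  then obtain z where z: "z \<in> Z" "follows (c # l) z" by blast
  then have "fps_shift 1 z \<in> child Z c" "follows l (fps_shift 1 z)" using child_in[of z Z] by (auto simp: follows_Cons)
  then show "\<exists>z\<in>child Z c. follows l z" by blast
next
  assume "\<exists>z\<in>child Z c. follows l z"
  then obtain z where "fps_const c + fps_X * z \<in> Z" "follows l z" by (auto simp: child_def)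
  moreover from this have "follows (c # l) (fps_const c + fps_X * z)" by (simp only: follows_child)
  ultimately show "\<exists>z\<in>Z. follows (c # l) z" by blast
qed

lemma Cons_in_nodes: "c # l \<in> nodes Z \<longleftrightarrow> l \<in> nodes (child Z c)"
proof
  assume "c # l \<in> nodes Z"
  then obtain z z' where z: "z \<in> Z" "z' \<in> Z" "z \<noteq> z'" "follows (c # l) z" "follows (c # l) z'"
    unfolding nodes_def by blast
  then have c: "z $ 0 = c" "z' $ 0 = c" "follows l (fps_shift 1 z)" "follows l (fps_shift 1 z')"
    by (simp_all add: follows_Cons)
  have "fps_shift 1 z \<noteq> fps_shift 1 z'"
  proof
    assume eq: "fps_shift 1 z = fps_shift 1 z'"
    have "z = fps_const (z $ 0) + fps_X * fps_shift 1 z" by (rule fps_split_0[symmetric])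
    also have "\<dots> = fps_const (z' $ 0) + fps_X * fps_shift 1 z'" unfolding c(1,2) eq ..
    also have "\<dots> = z'" by (rule fps_split_0)
    finally show False using z(3) by simp
  qed
  moreover have "fps_shift 1 z \<in> child Z c" "fps_shift 1 z' \<in> child Z c"
    using child_in[OF z(1)] child_in[OF z(2)] unfolding c(1,2) by auto
  ultimately show "l \<in> nodes (child Z c)" unfolding nodes_def using c(3,4) by blast
next
  assume "l \<in> nodes (child Z c)"
  then obtain z z' where z: "fps_const c + fps_X * z \<in> Z" "fps_const c + fps_X * z' \<in> Z" "z \<noteq> z'" "follows l z" "follows l z'"
    unfolding nodes_def child_def by blast
  then have "fps_const c + fps_X * z \<noteq> fps_const c + fps_X * z'" by simp
  moreover have "follows (c # l) (fps_const c + fps_X * z)" "follows (c # l) (fps_const c + fps_X * z')"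
    using z(4,5) by (simp_all only: follows_child)
  ultimately show "c # l \<in> nodes Z" unfolding nodes_def using z(1,2) by blast
qed

definition first_points :: "complex fps set \<Rightarrow> complex set" where
  "first_points Z = (\<lambda>z. z $ 0) ` Z"

definition multiple_points :: "complex fps set \<Rightarrow> complex set" where
  "multiple_points Z = {c. [] \<in> nodes (child Z c)}"

lemma finite_child: "finite Z \<Longrightarrow> finite (child Z c)"
proof -
  assume "finite Z"
  moreover have "child Z c \<subseteq> fps_shift 1 ` Z"
  proof
    fix z assume "z \<in> child Z c"
    moreover have "z = fps_shift 1 (fps_const c + fps_X * z)" by (rule fps_ext) simp
    ultimately show "z \<in> fps_shift 1 ` Z" unfolding child_def by blast
  qed
  ultimately show ?thesis by (meson finite_imageI finite_subset)
qed

lemma multiple_points_subset: "multiple_points Z \<subseteq> first_points Z"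
proof
  fix c assume "c \<in> multiple_points Z"
  then obtain z where "fps_const c + fps_X * z \<in> Z" by (auto simp: multiple_points_def nodes_def child_def)
  then show "c \<in> first_points Z" by (force simp: first_points_def)
qed

text \<open>
  The alternative needed for counting: the branches go through a common point, or through two points at least.
\<close>

lemma several_points:
  assumes Z: "finite Z" and nil: "[] \<in> nodes Z"
  shows "multiple_points Z = first_points Z \<and> multiple_points Z \<noteq> {} \<or> card (first_points Z) \<ge> 2"
proof -
  obtain z z' where z: "z \<in> Z" "z' \<in> Z" "z \<noteq> z'" using nil by (auto simp: nodes_def)
  have fin: "finite (first_points Z)" using Z by (simp add: first_points_def)
  show ?thesis
  proof (cases "first_points Z = {z $ 0}")
    case True
    then have "z' $ 0 = z $ 0" using z by (auto simp: first_points_def)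
    then have "[z $ 0] \<in> nodes Z" unfolding nodes_def using z by (auto simp: follows_Cons)
    then have "z $ 0 \<in> multiple_points Z" by (simp add: multiple_points_def Cons_in_nodes)
    then show ?thesis using True multiple_points_subset[of Z] by auto
  next
    case False
    have "z $ 0 \<in> first_points Z" using z by (simp add: first_points_def)
    then obtain d where "d \<in> first_points Z" "d \<noteq> z $ 0" using False by blast
    then have "{z $ 0, d} \<subseteq> first_points Z" "card {z $ 0, d} = 2" using \<open>z $ 0 \<in> first_points Z\<close> by auto
    then show ?thesis using card_mono[OF fin] by metis
  qed
qed

definition tree_count :: "nat \<Rightarrow> complex fps set \<Rightarrow> nat" where
  "tree_count \<rho> Z = (if \<rho> = 1 then card (divisorial_nodes Z) else 2 * card (terminal_nodes Z))"

lemma card_tree_recursion: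
  assumes fin: "finite (W Z)" "finite M" "\<And>c. finite (W (child Z c))"
    and W: "\<And>c l. c # l \<in> W Z \<longleftrightarrow> l \<in> W (child Z c)" and M: "\<And>c. c \<notin> M \<Longrightarrow> W (child Z c) = {}"
  shows "card (W Z) = (if [] \<in> W Z then 1 else 0) + (\<Sum>c\<in>M. card (W (child Z c)))"
proof -
  define U where "U = (\<Union>c\<in>M. (#) c ` W (child Z c))"
  have "l \<in> W Z \<longleftrightarrow> l \<in> (if [] \<in> W Z then {[]} else {}) \<union> U" for l
  proof (cases l)
    case (Cons c l')
    then show ?thesis using W[of c l'] M[of c] by (cases "c \<in> M") (auto simp: U_def)
  qed (auto simp: U_def)
  then have WZ: "W Z = (if [] \<in> W Z then {[]} else {}) \<union> U" by blast
  have U: "finite U" "[] \<notin> U" using fin by (auto simp: U_def)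
  have "card (W Z) = (if [] \<in> W Z then 1 else 0) + card U"
  proof (cases "[] \<in> W Z")
    case True
    then have "W Z = insert [] U" using WZ by simp
    then show ?thesis using U True by simp
  next
    case False
    then have "W Z = U" using WZ by simp
    then show ?thesis using False by simp
  qed
  also have "card U = (\<Sum>c\<in>M. card ((#) c ` W (child Z c)))"
    unfolding U_def using fin by (intro card_UN_disjoint) auto
  also have "\<dots> = (\<Sum>c\<in>M. card (W (child Z c)))" by (intro sum.cong refl card_image) simp
  finally show ?thesis .
qed

lemma tree_count_recursion:
  assumes Z: "finite Z" and nil: "[] \<in> nodes Z" and \<rho>: "\<rho> = 1 \<or> \<rho> = 2"
  shows "tree_count \<rho> Z = own_count \<rho> (first_points Z) (multiple_points Z) + 
    (\<Sum>c\<in>multiple_points Z. tree_count \<rho> (child Z c))"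
proof -
  define M where "M = multiple_points Z"
  have finM: "finite M" using Z multiple_points_subset[of Z] finite_subset unfolding M_def first_points_def by blast
  have fin: "finite (nodes (child Z c))" "finite (nodes Z)" for c using Z by (auto intro: finite_nodes finite_child)
  have empty: "nodes (child Z c) = {}" if "c \<notin> M" for c
  proof -
    have "[] \<notin> nodes (child Z c)" using that by (simp add: M_def multiple_points_def)
    then show ?thesis by (auto simp: nodes_def)
  qed
  have c1: "[c] \<in> nodes Z \<longleftrightarrow> c \<in> M" for c by (simp add: Cons_in_nodes M_def multiple_points_def)
  show ?thesis
  proof (cases "\<rho> = 1")
    case True
    have "card (divisorial_nodes Z) = (if [] \<in> divisorial_nodes Z then 1 else 0) + (\<Sum>c\<in>M. card (divisorial_nodes (child Z c)))"
      by (rule card_tree_recursion) (use fin finM empty in \<open>auto simp: divisorial_nodes_def Cons_in_nodes ex_follows_child\<close>)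
    moreover have "[] \<in> divisorial_nodes Z \<longleftrightarrow> first_points Z - M \<noteq> {}"
      using nil by (auto simp: divisorial_nodes_def c1 first_points_def follows_Cons)
    ultimately show ?thesis using True by (simp add: tree_count_def own_count_def M_def)
  next
    case False
    have "card (terminal_nodes Z) = (if [] \<in> terminal_nodes Z then 1 else 0) + (\<Sum>c\<in>M. card (terminal_nodes (child Z c)))"
      by (rule card_tree_recursion) (use fin finM empty in \<open>auto simp: terminal_nodes_def Cons_in_nodes\<close>)
    moreover have "[] \<in> terminal_nodes Z \<longleftrightarrow> M = {}"
      using nil by (auto simp: terminal_nodes_def c1)
    ultimately show ?thesis using False by (simp add: tree_count_def own_count_def M_def sum_distrib_left)
  qed
qed

text \<open>
  By induction on the tree: the bounds at the points where several branches pass come from the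
  children, and are then added up on the component.
\<close>

lemma tree_bound:
  assumes \<rho>: "\<rho> = 1 \<or> \<rho> = 2"
  shows "finite Z \<Longrightarrow> [] \<in> nodes Z \<Longrightarrow> A \<noteq> 0 \<Longrightarrow> (\<And>z. z \<in> Z \<Longrightarrow> solution A R z) \<Longrightarrow>
    state_bound \<rho> A R (tree_count \<rho> Z)"
proof (induction "card (nodes Z)" arbitrary: Z A R rule: less_induct)
  case less
  note Z = less.prems(1) and nil = less.prems(2) and A = less.prems(3) and sol = less.prems(4)
  define C M where "C = first_points Z" and "M = multiple_points Z"
  interpret component_count \<rho> C M
    using \<rho> Z multiple_points_subset[of Z] several_points[OF Z nil]
    by unfold_locales (auto simp: C_def M_def first_points_def)
  have zero: "order c (lead R) \<ge> 1" if "c \<in> C" "R \<noteq> 0" "subdegree R \<le> subdegree A" for c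
    using that solution_zero[OF A that(2,3) sol] by (auto simp: C_def first_points_def)
  have classes: "tree_count \<rho> (child Z c) \<le> class_bound \<rho> A R c" if c: "c \<in> M" for c
  proof (rule state_bound_child)
    show "state_bound \<rho> (child_A c A) (child_R c A R) (tree_count \<rho> (child Z c))"
    proof (rule less.hyps)
      have "(#) c ` nodes (child Z c) \<subseteq> nodes Z - {[]}" using Cons_in_nodes by auto
      then have "card ((#) c ` nodes (child Z c)) \<le> card (nodes Z - {[]})"
        using finite_nodes[OF Z] by (intro card_mono) auto
      moreover have "card ((#) c ` nodes (child Z c)) = card (nodes (child Z c))" by (rule card_image) simp
      moreover have "card (nodes Z - {[]}) < card (nodes Z)"
        using nil finite_nodes[OF Z] by (intro psubset_card_mono) auto
      ultimately show "card (nodes (child Z c)) < card (nodes Z)" by simp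
      show "finite (child Z c)" by (rule finite_child[OF Z])
      show "[] \<in> nodes (child Z c)" using c by (simp add: M_def multiple_points_def)
      show "child_A c A \<noteq> 0" using blow_leading[OF A, of c] by (auto simp: child_A_def)
      show "solution (child_A c A) (child_R c A R) z" if "z \<in> child Z c" for z
        using that sol by (intro solution_child) (simp add: child_def)
    qed
    show "order c (lead R) \<ge> 1" if "R \<noteq> 0" "subdegree R \<le> subdegree A"
      using zero[OF _ that] c M by blast
  qed (use \<rho> A in auto)
  have "tree_count \<rho> Z = own_count \<rho> C M + (\<Sum>c\<in>M. tree_count \<rho> (child Z c))"
    unfolding C_def M_def by (rule tree_count_recursion[OF Z nil \<rho>])
  note total = this
  consider (dicritical) "R = 0 \<or> subdegree R > subdegree A" | (regular) "R \<noteq> 0" "subdegree R = subdegree A"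
    | (irregular) "R \<noteq> 0" "subdegree R < subdegree A" by linarith
  then show ?case
  proof cases
    case dicritical
    have "own_count \<rho> C M + (\<Sum>c\<in>M. tree_count \<rho> (child Z c)) \<le> \<rho> + 2 * degree (lead A)"
      using classes dicritical A by (intro count_dicritical) (auto simp: class_bound_def)
    then show ?thesis using dicritical by (simp add: total state_bound_def)
  next
    case regular
    have q: "tree_count \<rho> (child Z c) \<le> 2 * min (order c (lead R) - 1) (order c (lead A)) +
        (if node_at (lead A) (lead R) c then \<rho> else 0)" if "c \<in> M" for c
      using classes[OF that] regular by (simp add: class_bound_def)
    have z: "order c (lead R) \<ge> 1" if "c \<in> C" for c using zero[OF that] regular by simp
    show ?thesis
      using count_regular[OF lead_nonzero[OF A] lead_nonzero[OF regular(1)] z q] regular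
      unfolding total state_bound_def by simp
  next
    case irregular
    have "own_count \<rho> C M + (\<Sum>c\<in>M. tree_count \<rho> (child Z c)) + 2 \<le> 2 * degree (lead R)"
      using classes irregular zero by (intro count_irregular) (auto simp: class_bound_def)
    then show ?thesis using irregular by (simp add: total state_bound_def)
  qed
qed

section \<open>Orders under a change of coordinates\<close>

lemma ord_ge_Suc_iff: "ord_ge f (Suc d) \<longleftrightarrow> vanishes f \<and> ord_ge (dX f) d \<and> ord_ge (dY f) d"
proof
  assume "vanishes f \<and> ord_ge (dX f) d \<and> ord_ge (dY f) d"
  then have v: "vanishes f" and x: "ord_ge (dX f) d" and y: "ord_ge (dY f) d" by auto
  show "ord_ge f (Suc d)" unfolding ord_ge_def
  proof (intro allI impI)
    fix i j assume ij: "i + j < Suc d"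
    consider "i = 0" "j = 0" | k where "i = Suc k" | k where "j = Suc k" by (cases i; cases j) auto
    then show "gcoeff f i j = 0"
    proof cases
      case 1
      then show ?thesis using v by (simp add: vanishes_def)
    next
      case 2
      then have "of_nat (Suc k) * gcoeff f (Suc k) j = 0"
        using ord_geD[OF x, of k j] ij by (simp only: gcoeff_dX)
      then show ?thesis using 2 by (simp only: mult_eq_0_iff of_nat_eq_0_iff) simp
    next
      case 3
      then have "of_nat (Suc k) * gcoeff f i (Suc k) = 0"
        using ord_geD[OF y, of i k] ij by (simp only: gcoeff_dY)
      then show ?thesis using 3 by (simp only: mult_eq_0_iff of_nat_eq_0_iff) simp
    qed
  qed
qed (auto simp: ord_ge_def vanishes_def gcoeff_dX gcoeff_dY)

lemma ord_ge_unit_mult: "\<not> vanishes u \<Longrightarrow> ord_ge (u * f) d \<longleftrightarrow> ord_ge f d"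
proof
  assume u: "\<not> vanishes u" and uf: "ord_ge (u * f) d"
  obtain v where v: "1 = u * v" using u by (auto simp: is_unit_germ_iff[symmetric] dvd_def)
  have "ord_ge ((u * f) * v) d" by (rule ord_ge_mult_left[OF uf])
  also have "(u * f) * v = f" using v by (metis mult.commute mult.left_commute mult_1_right)
  finally show "ord_ge f d" .
next
  assume "ord_ge f d"
  then show "ord_ge (u * f) d" using ord_ge_mult_left[of f d u] by (simp add: mult.commute)
qed

text \<open>By induction on the order, differentiating: the Jacobian matrix is invertible.\<close>

lemma ord_ge_coordinate_change:
  assumes \<phi>: "coordinate_change (p, q)"
  shows "ord_ge (gsubst f p q) d \<longleftrightarrow> ord_ge f d"
proof
  have v: "vanishes p" "vanishes q" and J: "\<not> vanishes (jacobian p q)"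
    using \<phi> by (auto simp: coordinate_change_def)
  show "ord_ge (gsubst f p q) d \<Longrightarrow> ord_ge f d"
  proof (induction d arbitrary: f)
    case (Suc d)
    define A B where "A = gsubst (dX f) p q" and "B = gsubst (dY f) p q"
    have "vanishes f" "ord_ge (dX (gsubst f p q)) d" "ord_ge (dY (gsubst f p q)) d"
      using Suc.prems v by (auto simp: ord_ge_Suc_iff)
    then have x: "ord_ge (A * dX p + B * dX q) d" and y: "ord_ge (A * dY p + B * dY q) d"
      using v by (simp_all add: dX_gsubst dY_gsubst A_def B_def)
    have "ord_ge ((A * dX p + B * dX q) * dY q - (A * dY p + B * dY q) * dX q) d"
      "ord_ge ((A * dY p + B * dY q) * dX p - (A * dX p + B * dX q) * dY p) d"
      by (intro ord_ge_diff ord_ge_mult_left x y)+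
    moreover have "(A * dX p + B * dX q) * dY q - (A * dY p + B * dY q) * dX q = jacobian p q * A"
      "(A * dY p + B * dY q) * dX p - (A * dX p + B * dX q) * dY p = jacobian p q * B"
      by (simp_all add: jacobian_def algebra_simps)
    ultimately have "ord_ge A d" "ord_ge B d" using ord_ge_unit_mult[OF J] by auto
    then have "ord_ge (dX f) d" "ord_ge (dY f) d" unfolding A_def B_def by (auto intro: Suc.IH)
    then show ?case using \<open>vanishes f\<close> by (simp add: ord_ge_Suc_iff)
  qed simp
  show "ord_ge f d \<Longrightarrow> ord_ge (gsubst f p q) d" by (rule ord_ge_gsubst[OF v])
qed

lemma gsubst_coordinate_change_eq_0:
  assumes "coordinate_change (p, q)" shows "gsubst f p q = 0 \<longleftrightarrow> f = 0"
proof
  assume "gsubst f p q = 0"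
  then have "ord_ge f d" for d using ord_ge_coordinate_change[OF assms, of f d] by simp
  then show "f = 0" by (rule eq_0_if_ord_ge)
qed (use assms in \<open>auto simp: coordinate_change_def\<close>)

lemma fol_mult_leI: "\<not> (ord_ge (fst V) (Suc d) \<and> ord_ge (snd V) (Suc d)) \<Longrightarrow> fol_mult V \<le> d"
proof -
  assume "\<not> (ord_ge (fst V) (Suc d) \<and> ord_ge (snd V) (Suc d))"
  then have "\<not> enat (Suc d) \<le> min (gorder (fst V)) (gorder (snd V))" by (simp add: ord_ge_iff_gorder)
  then have "min (gorder (fst V)) (gorder (snd V)) \<le> enat d" by (simp only: Suc_ile_eq not_less)
  then show ?thesis unfolding fol_mult_def by (metis enat_ile enat_ord_simps(1) the_enat.simps)
qed

lemma fol_mult_order: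
  assumes "V \<noteq> (0, 0)"
  shows "ord_ge (fst V) (fol_mult V)" "ord_ge (snd V) (fol_mult V)"
    "\<not> (ord_ge (fst V) (Suc (fol_mult V)) \<and> ord_ge (snd V) (Suc (fol_mult V)))"
proof -
  define m where "m = min (gorder (fst V)) (gorder (snd V))"
  have "m \<noteq> \<infinity>"
  proof
    assume "m = \<infinity>"
    then have "ord_ge (fst V) d \<and> ord_ge (snd V) d" for d by (simp add: ord_ge_iff_gorder m_def min_def split: if_splits)
    then have "fst V = 0" "snd V = 0" using eq_0_if_ord_ge by blast+
    then show False using assms by (cases V) auto
  qed
  then obtain k where k: "m = enat k" by auto
  then have fm: "fol_mult V = k" by (simp add: fol_mult_def m_def)
  have *: "ord_ge (fst V) d \<and> ord_ge (snd V) d \<longleftrightarrow> d \<le> k" for d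
    using k unfolding m_def ord_ge_iff_gorder by (metis enat_ord_simps(1) min.bounded_iff)
  show "ord_ge (fst V) (fol_mult V)" "ord_ge (snd V) (fol_mult V)" using *[of k] fm by auto
  show "\<not> (ord_ge (fst V) (Suc (fol_mult V)) \<and> ord_ge (snd V) (Suc (fol_mult V)))" using *[of "Suc k"] fm by auto
qed

text \<open>
  By Cramer's rule, the field composed with \<open>\<phi>\<close> and multiplied by the Jacobian is a combination of the components of its pull-back.
\<close>

lemma fol_mult_pullback:
  assumes V: "V \<noteq> (0, 0)" and \<phi>: "coordinate_change (p, q)"
  shows "fol_mult (pullback_field (p, q) V) \<le> fol_mult V" "pullback_field (p, q) V \<noteq> (0, 0)"
proof -
  have v: "vanishes p" "vanishes q" and J: "\<not> vanishes (jacobian p q)"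
    using \<phi> by (auto simp: coordinate_change_def)
  define A B where "A = gsubst (fst V) p q" and "B = gsubst (snd V) p q"
  define a b where "a = A * dY q - B * dY p" and "b = B * dX p - A * dX q"
  have pb: "pullback_field (p, q) V = (a, b)"
    by (simp add: pullback_field_def a_def b_def A_def B_def Let_def)
  have eq: "a * dX p + b * dY p = jacobian p q * A" "a * dX q + b * dY q = jacobian p q * B"
    by (simp_all add: a_def b_def jacobian_def algebra_simps)
  have n: "\<not> (ord_ge a (Suc (fol_mult V)) \<and> ord_ge b (Suc (fol_mult V)))"
  proof
    assume "ord_ge a (Suc (fol_mult V)) \<and> ord_ge b (Suc (fol_mult V))"
    then have "ord_ge (a * dX p + b * dY p) (Suc (fol_mult V))" "ord_ge (a * dX q + b * dY q) (Suc (fol_mult V))"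
      by (auto intro!: ord_ge_add ord_ge_mult_left)
    then have "ord_ge A (Suc (fol_mult V))" "ord_ge B (Suc (fol_mult V))"
      unfolding eq using ord_ge_unit_mult[OF J] by auto
    then show False using fol_mult_order(3)[OF V] unfolding A_def B_def ord_ge_coordinate_change[OF \<phi>] by blast
  qed
  then show "fol_mult (pullback_field (p, q) V) \<le> fol_mult V" unfolding pb by (intro fol_mult_leI) simp
  show "pullback_field (p, q) V \<noteq> (0, 0)" using n unfolding pb by auto
qed

lemma invariant_pullback:
  assumes "invariant_curve V f" and v: "vanishes p" "vanishes q"
  shows "invariant_curve (pullback_field (p, q) V) (gsubst f p q)"
proof -
  define A B where "A = gsubst (fst V) p q" and "B = gsubst (snd V) p q"
  have "gsubst f p q dvd gsubst (fst V * dX f + snd V * dY f) p q"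
    using assms by (intro gsubst_dvd) (auto simp: invariant_curve_def)
  also have "\<dots> = A * gsubst (dX f) p q + B * gsubst (dY f) p q"
    using v by (simp add: gsubst_add gsubst_mult A_def B_def)
  also have "\<dots> dvd (A * dY q - B * dY p) * dX (gsubst f p q) + (B * dX p - A * dX q) * dY (gsubst f p q)"
  proof -
    have "(A * dY q - B * dY p) * dX (gsubst f p q) + (B * dX p - A * dX q) * dY (gsubst f p q) =
       (A * gsubst (dX f) p q + B * gsubst (dY f) p q) * jacobian p q"
      using v by (simp add: dX_gsubst dY_gsubst jacobian_def algebra_simps)
    then show ?thesis by simp
  qed
  finally show ?thesis by (simp add: invariant_curve_def pullback_field_def A_def B_def Let_def)
qed

lemma defines_foliation_nonzero: "defines_foliation V \<Longrightarrow> V \<noteq> (0, 0)"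
proof
  assume "defines_foliation V" "V = (0, 0)"
  then obtain \<epsilon> :: real where \<epsilon>: "\<epsilon> > 0"
    "\<And>x y. norm x < \<epsilon> \<Longrightarrow> norm y < \<epsilon> \<Longrightarrow> geval 0 x y = 0 \<Longrightarrow> x = 0"
    unfolding defines_foliation_def by auto
  moreover have "geval 0 x y = 0" for x y by (simp add: geval_def case_prod_unfold)
  ultimately have "complex_of_real (\<epsilon> / 2) = 0" by (metis \<epsilon>(2) norm_of_real abs_of_pos half_gt_zero field_sum_of_halves less_add_same_cancel1)
  then show False using \<epsilon>(1) by simp
qed

section \<open>Branches of an invariant curve\<close>

lemma prime_power_split:
  assumes P: "prime_elem P" "vanishes P" and f: "f \<noteq> 0"
  shows "\<exists>k Q. f = P ^ k * Q \<and> \<not> P dvd Q"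
  using f
proof (induction "gmult f" arbitrary: f rule: less_induct)
  case less
  show ?case
  proof (cases "P dvd f")
    case True
    then obtain g where g: "f = P * g" by (auto simp: dvd_def)
    have nz: "P \<noteq> 0" "g \<noteq> 0" using g less.prems by auto
    then have "gmult g < gmult f" using vanishes_iff_gmult[of P] P by (simp add: g gmult_mult)
    then obtain k Q where "g = P ^ k * Q" "\<not> P dvd Q" using less.hyps nz by blast
    then show ?thesis by (intro exI[of _ "Suc k"] exI[of _ Q]) (simp add: g mult_ac)
  qed (auto intro!: exI[of _ 0] exI[of _ f])
qed

text \<open>
  If \<open>P^k\<close> is the exact power of a prime \<open>P\<close> in an invariant curve, then
  \<open>X(P^k Q) = k P^(k-1) Q X(P) + P^k X(Q)\<close> shows that \<open>P\<close> is invariant.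
\<close>

lemma invariant_prime_factor:
  assumes P: "prime_elem P" "vanishes P" and F: "F \<noteq> 0" "P dvd F" and inv: "F dvd A * dX F + B * dY F"
  shows "P dvd A * dX P + B * dY P"
proof -
  obtain k Q where Q: "F = P ^ k * Q" "\<not> P dvd Q" using prime_power_split[OF P F(1)] by blast
  have "k \<noteq> 0" using Q F by (intro notI) simp
  then obtain l where l: "k = Suc l" by (cases k) auto
  have P0: "P \<noteq> 0" using P by auto
  have "A * dX F + B * dY F = P ^ l * (of_nat k * Q * (A * dX P + B * dY P) + P * (A * dX Q + B * dY Q))"
    unfolding Q l by (simp only: dX_mult dY_mult dX_power dY_power diff_Suc_1) (simp add: algebra_simps)
  moreover have "P ^ l * P dvd F" by (simp add: Q l mult_ac)
  ultimately have "P ^ l * P dvd P ^ l * (of_nat k * Q * (A * dX P + B * dY P) + P * (A * dX Q + B * dY Q))"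
    using inv dvd_trans by metis
  then have "P dvd of_nat k * Q * (A * dX P + B * dY P) + P * (A * dX Q + B * dY Q)" using P0 by simp
  then have "P dvd of_nat k * Q * (A * dX P + B * dY P)" by (metis dvd_add_left_iff dvd_triv_left)
  moreover have "\<not> P dvd of_nat k"
  proof -
    have "(of_nat k :: germ) = gconst (of_nat k)" by (induction k) auto
    then have "(of_nat k :: germ) dvd 1" using \<open>k \<noteq> 0\<close> by (simp add: is_unit_germ_iff)
    then show ?thesis using P(1) by (metis dvd_trans prime_elem_not_unit)
  qed
  ultimately show ?thesis using P(1) Q(2) by (simp add: prime_elem_dvd_mult_iff)
qed

text \<open>
  After ramification \<open>y - s\<close> is a prime factor of the equation of the curve, hence invariant by the ramified field
  \<open>(a, e x^(e-1) b)\<close>: this is the differential equation for \<open>s\<close>.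
\<close>

lemma root_ode:
  assumes g: "g \<noteq> 0" "invariant_curve (a, b) g" and e: "e \<ge> 1" and s: "xonly s" "vanishes s" "gsubst g (gX ^ e) s = 0"
  shows "gsubst a (gX ^ e) s * dX s = of_nat e * gX ^ (e - 1) * gsubst b (gX ^ e) s"
proof -
  define F where "F = ramify e g"
  define A B where "A = ramify e a" and "B = of_nat e * gX ^ (e - 1) * ramify e b"
  have v: "vanishes (gX ^ e)" "vanishes gY" using e by auto
  have at_s: "gsubst (ramify e h) gX s = gsubst h (gX ^ e) s" for h
    using v s by (simp add: gsubst_gsubst gsubst_power)
  have "F \<noteq> 0" using g ramify_eq_iff[OF e, of g 0] v by (simp add: F_def)
  have dF: "dX F = of_nat e * gX ^ (e - 1) * ramify e (dX g)" "dY F = ramify e (dY g)"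
    using v by (simp_all add: F_def dX_gsubst dY_gsubst dX_power dY_power)
  have "F dvd ramify e (a * dX g + b * dY g)"
    unfolding F_def using g(2) by (intro gsubst_dvd v) (simp add: invariant_curve_def)
  then have "F dvd of_nat e * gX ^ (e - 1) * ramify e (a * dX g + b * dY g)" by (rule dvd_mult)
  also have "of_nat e * gX ^ (e - 1) * ramify e (a * dX g + b * dY g) = A * dX F + B * dY F"
    using v by (simp add: dF A_def B_def gsubst_add gsubst_mult algebra_simps)
  finally have inv: "F dvd A * dX F + B * dY F" .
  have "gY - s dvd F" using s by (simp add: branch_dvd_iff F_def at_s)
  moreover have "vanishes (gY - s)" using s by (intro vanishes_diff) auto
  ultimately have "gY - s dvd A * dX (gY - s) + B * dY (gY - s)"
    using invariant_prime_factor[OF prime_elem_branch[OF s(1,2)] _ \<open>F \<noteq> 0\<close> _ inv] by blast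
  then have "gY - s dvd B - A * dX s" using s by (simp add: dX_diff dY_diff xonly_def)
  then have "gsubst (B - A * dX s) gX s = 0" using s by (simp add: branch_dvd_iff)
  moreover have "xonly (dX s)" using s by (simp add: xonly_iff gcoeff_dX)
  moreover have "gsubst B gX s = of_nat e * gX ^ (e - 1) * gsubst b (gX ^ e) s"
    using s by (simp add: B_def gsubst_mult gsubst_power gsubst_of_nat at_s)
  ultimately show ?thesis using s by (simp add: A_def gsubst_diff gsubst_mult at_s)
qed

lemma ord_ge_decompose:
  "ord_ge f (Suc m) \<Longrightarrow> \<exists>f1 f2. f = gX * f1 + gY * f2 \<and> ord_ge f1 m \<and> ord_ge f2 m"
proof (intro exI conjI)
  assume f: "ord_ge f (Suc m)"
  show "f = gX * shiftX f + gY * shiftY (gsubst f 0 gY)"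
  proof (rule germ_eqI)
    fix i j
    have "gcoeff f 0 0 = 0" using f by (simp add: ord_ge_def)
    then show "gcoeff f i j = gcoeff (gX * shiftX f + gY * shiftY (gsubst f 0 gY)) i j"
      by (cases i; cases j) (auto simp: gcoeff_gX_mult gcoeff_gY_mult gcoeff_gsubst_0_gY)
  qed
  show "ord_ge (shiftX f) m" "ord_ge (shiftY (gsubst f 0 gY)) m"
    using f by (auto simp: ord_ge_def gcoeff_gsubst_0_gY)
qed

lemma power_dvd_gsubst:
  assumes v: "vanishes p" "vanishes q" and t: "t dvd p" "t dvd q" and f: "ord_ge f m"
  shows "t ^ m dvd gsubst f p q"
  using f
proof (induction m arbitrary: f)
  case (Suc m)
  then obtain f1 f2 where f: "f = gX * f1 + gY * f2" "ord_ge f1 m" "ord_ge f2 m" using ord_ge_decompose by blast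
  have "t * t ^ m dvd p * gsubst f1 p q" "t * t ^ m dvd q * gsubst f2 p q"
    using Suc.IH[OF f(2)] Suc.IH[OF f(3)] t by (auto intro: mult_dvd_mono)
  then show ?case using v by (simp add: f(1) gsubst_add gsubst_mult)
qed simp

text \<open>
  Comparison of orders in \<open>a(t^e, s) s' = e t^(e-1) b(t^e, s)\<close>: if \<open>s\<close> had order \<open>m < e\<close>, the term
  \<open>y^\<nu>\<close> would dominate in \<open>a\<close> and the left side would have order exactly \<open>m \<nu> + m - 1\<close>.
\<close>

lemma branch_order:
  assumes a: "ord_ge a \<nu>" "gcoeff a 0 \<nu> \<noteq> 0" and b: "ord_ge b \<nu>" and e: "e \<ge> 1"
    and s: "xonly s" "vanishes s" and ode: "gsubst a (gX ^ e) s * dX s = of_nat e * gX ^ (e - 1) * gsubst b (gX ^ e) s"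
  shows "gX ^ e dvd s"
proof (rule ccontr)
  assume nd: "\<not> gX ^ e dvd s"
  then have "s \<noteq> 0" by auto
  then obtain m \<sigma> where \<sigma>: "s = gX ^ m * \<sigma>" "xonly \<sigma>" "\<not> vanishes \<sigma>" using xonly_gX_power s by blast
  have m: "m \<ge> 1" using s \<sigma> by (cases m) auto
  have me: "m < e" using nd \<sigma>(1) le_imp_power_dvd[of e m gX] by (metis dvd_mult2 not_less)
  have v: "vanishes (gX ^ e)" "vanishes s" using e s by auto
  have t: "gX ^ m dvd gX ^ e" "gX ^ m dvd s" using me \<sigma> by (auto intro: le_imp_power_dvd)
  obtain B where B: "gsubst b (gX ^ e) s = gX ^ (m * \<nu>) * B"
    using power_dvd_gsubst[OF v t b] by (auto simp: dvd_def power_mult)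
  define a1 where "a1 = shiftX a"
  define a2 where "a2 = gsubst ((shiftY ^^ \<nu>) a) 0 gY"
  have split: "a = gX * a1 + gY ^ \<nu> * a2"
  proof (rule germ_eqI)
    fix i j
    show "gcoeff a i j = gcoeff (gX * a1 + gY ^ \<nu> * a2) i j"
      using ord_geD[OF a(1), of 0 j]
      by (cases i) (auto simp: a1_def a2_def gcoeff_gX_mult gcoeff_gY_power_mult gcoeff_gsubst_0_gY gcoeff_shiftY_funpow)
  qed
  have "ord_ge a1 (\<nu> - 1)" using a(1) by (auto simp: ord_ge_def a1_def)
  then obtain a1' where a1': "gsubst a1 (gX ^ e) s = gX ^ (m * (\<nu> - 1)) * a1'"
    using power_dvd_gsubst[OF v t] by (auto simp: dvd_def power_mult)
  have exps: "e + m * (\<nu> - 1) = m * \<nu> + Suc (e + m * (\<nu> - 1) - Suc (m * \<nu>))"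
    using me by (cases \<nu>) auto
  define U where "U = gX * (gX ^ (e + m * (\<nu> - 1) - Suc (m * \<nu>)) * a1') + \<sigma> ^ \<nu> * gsubst a2 (gX ^ e) s"
  have "gsubst a (gX ^ e) s = gX ^ e * gsubst a1 (gX ^ e) s + s ^ \<nu> * gsubst a2 (gX ^ e) s"
    using v by (simp add: split gsubst_add gsubst_mult gsubst_power)
  also have "s ^ \<nu> = gX ^ (m * \<nu>) * \<sigma> ^ \<nu>" by (simp only: \<sigma>(1) power_mult_distrib power_mult)
  also have "gX ^ e * gsubst a1 (gX ^ e) s = gX ^ (e + m * (\<nu> - 1)) * a1'" by (simp only: a1' power_add mult.assoc)
  also have "gX ^ (e + m * (\<nu> - 1)) * a1' + gX ^ (m * \<nu>) * \<sigma> ^ \<nu> * gsubst a2 (gX ^ e) s =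
      gX ^ (e + m * (\<nu> - 1)) * a1' + gX ^ (m * \<nu>) * (\<sigma> ^ \<nu> * gsubst a2 (gX ^ e) s)"
    by (simp only: mult.assoc)
  also have "\<dots> = gX ^ (m * \<nu>) * U"
    by (subst exps) (simp add: U_def power_add distrib_left mult_ac)
  finally have A: "gsubst a (gX ^ e) s = gX ^ (m * \<nu>) * U" .
  have "gcoeff a2 0 0 = gcoeff a 0 \<nu>" by (simp add: a2_def gcoeff_gsubst_0_gY gcoeff_shiftY_funpow)
  then have "\<not> vanishes a2" using a(2) by (simp add: vanishes_def)
  then have "\<not> vanishes (\<sigma> ^ \<nu> * gsubst a2 (gX ^ e) s)" using v \<sigma>(3) by (simp add: vanishes_gsubst)
  then have U: "\<not> vanishes U" by (simp add: U_def vanishes_def gcoeff_gX_mult)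
  define T where "T = of_nat m * \<sigma> + gX * dX \<sigma>"
  have ds: "dX s = gX ^ (m - 1) * T"
  proof -
    have "dX s = of_nat m * gX ^ (m - 1) * \<sigma> + gX ^ m * dX \<sigma>"
      by (simp only: \<sigma>(1) dX_mult dX_power d_simps mult_1_right)
    also have "gX ^ m = gX ^ (m - 1) * gX" using m by (cases m) auto
    finally show ?thesis by (simp add: T_def distrib_left mult_ac)
  qed
  have "\<not> vanishes T"
  proof -
    have "gcoeff (of_nat m * \<sigma>) 0 0 = of_nat m * gcoeff \<sigma> 0 0" by (induction m) (simp_all add: distrib_right)
    then show ?thesis using m \<sigma>(3) by (simp add: T_def vanishes_def gcoeff_gX_mult)
  qed
  have e1: "gX ^ (e - 1) = gX ^ (m - 1) * gX * gX ^ (e - m - 1)"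
    using me m by (simp add: power_add[symmetric] power_Suc2[symmetric] del: power_Suc)
  have "gX ^ (m * \<nu>) * gX ^ (m - 1) * (U * T) = gX ^ (m * \<nu>) * gX ^ (m - 1) * (gX * (of_nat e * gX ^ (e - m - 1) * B))"
    using ode unfolding A ds B e1 by (simp only: mult_ac)
  then have "U * T = gX * (of_nat e * gX ^ (e - m - 1) * B)" by simp
  then have "vanishes (U * T)" by simp
  then show False using U \<open>\<not> vanishes T\<close> by simp
qed

section \<open>Dicritical foliations\<close>

text \<open>A common divisor of largest multiplicity is a greatest common divisor, up to units.\<close>

lemma saturate_spec:
  assumes "u \<noteq> 0 \<or> v \<noteq> 0"
  shows "\<exists>h. h \<noteq> 0 \<and> u = h * fst (saturate (u, v)) \<and> v = h * snd (saturate (u, v))"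
proof -
  obtain z where z: "z \<noteq> 0" "z = u \<or> z = v" using assms by auto
  define P where "P = (\<lambda>n. \<exists>h. h dvd u \<and> h dvd v \<and> gmult h = n)"
  have "P (gmult 1)" unfolding P_def by (intro exI[of _ 1]) auto
  moreover have "n \<le> gmult z" if "P n" for n
  proof -
    obtain h where h: "h dvd z" "gmult h = n" using \<open>P n\<close> z(2) by (auto simp: P_def)
    then obtain k where "z = h * k" by (auto simp: dvd_def)
    then show ?thesis using z(1) h by (auto simp: gmult_mult)
  qed
  ultimately have "P (Greatest P)" and max: "\<And>n. P n \<Longrightarrow> n \<le> Greatest P"
    using GreatestI_nat[of P "gmult 1" "gmult z"] Greatest_le_nat[of P _ "gmult z"] by blast+
  then obtain h where h: "h dvd u" "h dvd v" "gmult h = Greatest P" by (auto simp: P_def)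
  obtain u' v' where uv: "u = h * u'" "v = h * v'" using h by (auto simp: dvd_def)
  have h0: "h \<noteq> 0" using uv z by auto
  have "coprime u' v'"
  proof (rule coprimeI)
    fix d assume d: "d dvd u'" "d dvd v'"
    then have "h * d dvd u" "h * d dvd v" unfolding uv by (auto intro: mult_dvd_mono)
    then have "gmult (h * d) \<le> gmult h" using max[of "gmult (h * d)"] h(3) by (auto simp: P_def)
    moreover have d0: "d \<noteq> 0" using d uv z by auto
    ultimately have "gmult d = 0" using h0 by (simp add: gmult_mult)
    then have "\<not> vanishes d" using d0 by (simp add: vanishes_iff_gmult)
    then show "d dvd 1" by (simp add: is_unit_germ_iff)
  qed
  then have "\<exists>W. coprime (fst W) (snd W) \<and> (\<exists>h. h \<noteq> 0 \<and> fst (u, v) = h * fst W \<and> snd (u, v) = h * snd W)"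
    using uv h0 by (intro exI[of _ "(u', v')"]) auto
  from someI_ex[OF this] show ?thesis unfolding saturate_def by auto
qed

text \<open>
  Division by common factors does not change which of the two coefficients has the larger order along \<open>t\<close>.
\<close>

lemma saturate_dvd_fst:
  assumes t: "prime_elem t" and u: "u = t ^ k * (t * u')" and v: "v = t ^ k * v'" and nd: "\<not> t dvd v'"
  shows "t dvd fst (saturate (u, v))"
proof -
  have t0: "t \<noteq> 0" using t by auto
  have "v \<noteq> 0" using nd t0 v by auto
  then obtain h where h: "h \<noteq> 0" "u = h * fst (saturate (u, v))" "v = h * snd (saturate (u, v))"
    using saturate_spec[of u v] by blast
  define a b where "a = fst (saturate (u, v))" and "b = snd (saturate (u, v))"
  have ab: "u = h * a" "v = h * b" using h by (simp_all add: a_def b_def)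
  have "h * t ^ k * (a * v') = (h * a) * (t ^ k * v')" by (simp add: mult_ac)
  also have "\<dots> = u * v" using ab v by simp
  also have "\<dots> = h * t ^ k * (t * (u' * b))" unfolding u by (subst ab(2)) (simp add: mult_ac)
  finally have "a * v' = t * (u' * b)" using h(1) t0 by simp
  then have "t dvd a * v'" by simp
  then have "t dvd a" using t nd by (simp add: prime_elem_dvd_mult_iff)
  then show ?thesis by (simp add: a_def)
qed

lemma saturate_swap_dvd_snd:
  assumes t: "prime_elem t" and v: "v = t ^ k * (t * v')" and u: "u = t ^ k * u'" and nd: "\<not> t dvd u'"
  shows "t dvd snd (saturate (u, v))"
proof -
  have t0: "t \<noteq> 0" using t by auto
  have "u \<noteq> 0" using nd t0 u by auto
  then obtain h where h: "h \<noteq> 0" "u = h * fst (saturate (u, v))" "v = h * snd (saturate (u, v))"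
    using saturate_spec[of u v] by blast
  define a b where "a = fst (saturate (u, v))" and "b = snd (saturate (u, v))"
  have ab: "u = h * a" "v = h * b" using h by (simp_all add: a_def b_def)
  have "h * t ^ k * (b * u') = (h * b) * (t ^ k * u')" by (simp add: mult_ac)
  also have "\<dots> = v * u" using ab u by simp
  also have "\<dots> = h * t ^ k * (t * (v' * a))" unfolding v by (subst ab(1)) (simp add: mult_ac)
  finally have "b * u' = t * (v' * a)" using h(1) t0 by simp
  then have "t dvd b * u'" by simp
  then have "t dvd b" using t nd by (simp add: prime_elem_dvd_mult_iff)
  then show ?thesis by (simp add: b_def)
qed

text \<open>The order of a germ is the order of its total transform along the exceptional divisor.\<close>

lemma ord_ge_if_gX_dvd_blowup:
  assumes "gX ^ d dvd gsubst f gX (gX * (gY + gconst c))"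
  shows "ord_ge f d"
proof -
  define h where "h = gsubst f gX (gY + gconst c * gX)"
  have v: "vanishes (gY + gconst c * gX)" "vanishes (gX * gY)" by (auto intro: vanishes_add)
  have "gsubst h gX (gX * gY) = gsubst f gX (gX * (gY + gconst c))"
    using v by (simp add: h_def gsubst_gsubst gsubst_add gsubst_mult algebra_simps)
  then have d: "gX ^ d dvd gsubst h gX (gX * gY)" using assms by simp
  have "ord_ge h d" unfolding ord_ge_def
  proof (intro allI impI)
    fix i j assume "i + j < d"
    then have "gcoeff (gsubst h gX (gX * gY)) (i + j) j = 0" using d by (auto simp: gX_power_dvd_iff)
    then show "gcoeff h i j = 0" using gcoeff_gsubst_monomial[of 1 h 1 "i + j" j] by simp
  qed
  moreover have "coordinate_change (gX, gY + gconst c * gX)"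
    using v by (simp add: coordinate_change_def jacobian_def dY_add dY_mult)
  ultimately show ?thesis using ord_ge_coordinate_change unfolding h_def by blast
qed

lemma coordinate_change_swap: "coordinate_change (gY, gX)"
  by (simp add: coordinate_change_def jacobian_def)

lemma ord_ge_if_gY_dvd_blowup:
  assumes "gY ^ d dvd gsubst f (gX * gY) gY"
  shows "ord_ge f d"
proof -
  define h where "h = gsubst f gY gX"
  have "gsubst (gY ^ d) gY gX dvd gsubst (gsubst f (gX * gY) gY) gY gX"
    by (intro gsubst_dvd assms) auto
  then have "gX ^ d dvd gsubst h gX (gX * (gY + gconst 0))"
    by (simp add: h_def gsubst_gsubst gsubst_mult gsubst_power mult.commute)
  then have "ord_ge h d" by (rule ord_ge_if_gX_dvd_blowup)
  then show ?thesis using ord_ge_coordinate_change[OF coordinate_change_swap] by (simp add: h_def)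
qed

lemma prime_elem_gY: "prime_elem gY"
  using prime_elem_branch[of 0] by simp

text \<open>
  If the form \<open>x b - y a\<close> does not vanish at the order \<open>\<nu> + 1\<close>, it cuts the exceptional divisor in
  finitely many points, and the divisor is invariant.
\<close>

lemma dicritical_radial:
  assumes V: "(a, b) \<noteq> (0, 0)" and di: "dicritical1 (a, b)"
  shows "ord_ge (gX * b - gY * a) (fol_mult (a, b) + 2)"
proof (rule ccontr)
  define \<nu> where "\<nu> = fol_mult (a, b)"
  define r where "r = gX * b - gY * a"
  assume "\<not> ?thesis"
  then have nr: "\<not> ord_ge r (\<nu> + 2)" by (simp add: r_def \<nu>_def)
  have a: "ord_ge a \<nu>" and b: "ord_ge b \<nu>" using fol_mult_order[OF V] by (simp_all add: \<nu>_def)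
  have "invariant_curve (fol_transform d (a, b)) (exc_eq d)" for d
  proof (cases d)
    case (Slope c)
    define C where "C = gX * (gY + gconst c)"
    have v: "vanishes gX" "vanishes C" by (auto simp: C_def)
    obtain a' b' where ab: "gsubst a gX C = gX ^ \<nu> * a'" "gsubst b gX C = gX ^ \<nu> * b'"
      using power_dvd_gsubst[OF v _ _ a, of gX] power_dvd_gsubst[OF v _ _ b, of gX] by (auto simp: dvd_def C_def)
    define r' where "r' = b' - (gY + gconst c) * a'"
    have "gsubst r gX C = gX * (gX ^ \<nu> * b') - C * (gX ^ \<nu> * a')"
      using v by (simp add: r_def gsubst_diff gsubst_mult ab)
    also have "\<dots> = gX ^ (\<nu> + 1) * r'" by (simp add: r'_def C_def algebra_simps)
    finally have rC: "gsubst r gX C = gX ^ (\<nu> + 1) * r'" .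
    have nd: "\<not> gX dvd r'"
    proof
      assume "gX dvd r'"
      then have "gX ^ (\<nu> + 1) * gX dvd gsubst r gX C" unfolding rC by (intro mult_dvd_mono) auto
      then have "gX ^ (\<nu> + 2) dvd gsubst r gX (gX * (gY + gconst c))" by (simp add: C_def mult_ac)
      then show False using nr ord_ge_if_gX_dvd_blowup by blast
    qed
    have "pullback_field (gX, C) (a, b) = (gX ^ \<nu> * (gX * a'), gX ^ \<nu> * r')"
      by (simp add: pullback_field_def Let_def ab) (simp add: C_def r'_def dX_mult dY_mult dX_add dY_add algebra_simps)
    then have "gX dvd fst (saturate (pullback_field (gX, C) (a, b)))"
      using saturate_dvd_fst[OF prime_elem_gX refl refl nd] by simp
    then show ?thesis by (simp add: Slope fol_transform_def invariant_curve_def C_def)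
  next
    case Vertical
    define C where "C = gX * gY"
    have v: "vanishes C" "vanishes gY" by (auto simp: C_def)
    obtain a' b' where ab: "gsubst a C gY = gY ^ \<nu> * a'" "gsubst b C gY = gY ^ \<nu> * b'"
      using power_dvd_gsubst[OF v _ _ a, of gY] power_dvd_gsubst[OF v _ _ b, of gY] by (auto simp: dvd_def C_def)
    define r' where "r' = a' - gX * b'"
    have "gsubst r C gY = C * (gY ^ \<nu> * b') - gY * (gY ^ \<nu> * a')"
      using v by (simp add: r_def gsubst_diff gsubst_mult ab)
    also have "\<dots> = gY ^ (\<nu> + 1) * (- r')" by (simp add: r'_def C_def algebra_simps)
    finally have rC: "gsubst r C gY = gY ^ (\<nu> + 1) * (- r')" .
    have nd: "\<not> gY dvd r'"
    proof
      assume "gY dvd r'"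
      then have "gY ^ (\<nu> + 1) * gY dvd gsubst r C gY" unfolding rC by (intro mult_dvd_mono) auto
      then have "gY ^ (\<nu> + 2) dvd gsubst r (gX * gY) gY" by (simp add: C_def mult_ac)
      then show False using nr ord_ge_if_gY_dvd_blowup by blast
    qed
    have "pullback_field (C, gY) (a, b) = (gY ^ \<nu> * r', gY ^ \<nu> * (gY * b'))"
      by (simp add: pullback_field_def Let_def ab) (simp add: C_def r'_def dX_mult dY_mult algebra_simps)
    then have "gY dvd snd (saturate (pullback_field (C, gY) (a, b)))"
      using saturate_swap_dvd_snd[OF prime_elem_gY refl refl nd] by simp
    then show ?thesis by (simp add: Vertical fol_transform_def invariant_curve_def C_def)
  qed
  then show False using di by (simp add: dicritical1_def)
qed

section \<open>A regular foliation has no singular invariant curve\<close>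

text \<open>
  For two solutions of \<open>y' = P(x,y)\<close> the difference divides its own derivative, which has a smaller order unless it
  is zero.
\<close>

lemma regular_unique_solution:
  assumes a: "\<not> vanishes a" and e: "e \<ge> 1"
    and s: "xonly s" "vanishes s" "gsubst a (gX ^ e) s * dX s = of_nat e * gX ^ (e - 1) * gsubst b (gX ^ e) s"
    and t: "xonly t" "vanishes t" "gsubst a (gX ^ e) t * dX t = of_nat e * gX ^ (e - 1) * gsubst b (gX ^ e) t"
  shows "s = t"
proof (rule ccontr)
  assume "s \<noteq> t"
  obtain a' where a': "1 = a * a'" using a by (auto simp: is_unit_germ_iff[symmetric] dvd_def)
  define P where "P = of_nat e * gX ^ (e - 1) * ramify e (a' * b)"
  have v: "vanishes (gX ^ e)" using e by simp
  have ode: "dX s = gsubst P gX s" if s: "xonly s" "vanishes s" 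
      "gsubst a (gX ^ e) s * dX s = of_nat e * gX ^ (e - 1) * gsubst b (gX ^ e) s" for s
  proof -
    have "gsubst P gX s = of_nat e * gX ^ (e - 1) * (gsubst a' (gX ^ e) s * gsubst b (gX ^ e) s)"
      using v s by (simp add: P_def gsubst_mult gsubst_power gsubst_of_nat gsubst_gsubst)
    also have "\<dots> = gsubst (a * a') (gX ^ e) s * dX s" using v s by (simp add: gsubst_mult mult_ac)
    also have "\<dots> = dX s" using v s(2) by (simp add: a'[symmetric])
    finally show ?thesis ..
  qed
  have "dX s = gsubst P gX s" "dX t = gsubst P gX t" using ode s t by blast+
  moreover have "xonly (s - t)" "s - t \<noteq> 0" using s t \<open>s \<noteq> t\<close> by (auto intro: xonly_closed)
  then obtain m \<sigma> where \<sigma>: "s - t = gX ^ m * \<sigma>" "xonly \<sigma>" "\<not> vanishes \<sigma>" using xonly_gX_power by blast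
  moreover have "s - t dvd gsubst P gX s - gsubst P gX t"
  proof -
    define H where "H = gsubst P gX (gY + t)"
    have vt: "vanishes (gY + t)" "vanishes (s - t)" using s t by (auto intro: vanishes_add vanishes_diff)
    have "gY dvd H - gsubst H gX 0" by (simp add: gY_dvd_iff gcoeff_gsubst_gX_0)
    then have "gsubst gY gX (s - t) dvd gsubst (H - gsubst H gX 0) gX (s - t)" using vt by (intro gsubst_dvd) auto
    moreover have "xonly (gsubst H gX 0)" by (auto simp: xonly_iff gcoeff_gsubst_gX_0)
    moreover have "gsubst H gX (s - t) = gsubst P gX s" "gsubst H gX 0 = gsubst P gX t"
      using t s vt by (simp_all add: H_def gsubst_gsubst gsubst_add)
    ultimately show ?thesis using vt by (simp add: gsubst_diff)
  qed
  ultimately have "gX ^ m * \<sigma> dvd dX (gX ^ m * \<sigma>)" by (metis dX_diff)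
  then have d: "gX ^ m dvd dX (gX ^ m * \<sigma>)" by (rule dvd_mult_left)
  have m: "m \<noteq> 0"
  proof
    assume "m = 0"
    then have "vanishes \<sigma>" using \<sigma>(1) vanishes_diff[OF s(2) t(2)] by simp
    then show False using \<sigma>(3) by simp
  qed
  have "gcoeff (dX (gX ^ m * \<sigma>)) (m - 1) 0 = of_nat m * gcoeff \<sigma> 0 0"
    using m by (simp add: gcoeff_dX gcoeff_gX_power_mult flip: of_nat_Suc)
  moreover have "gcoeff (dX (gX ^ m * \<sigma>)) (m - 1) 0 = 0" using d m by (simp add: gX_power_dvd_iff)
  ultimately show False using m \<sigma>(3) by (simp add: vanishes_def)
qed

text \<open>By uniqueness a Puiseux root of the curve is equal to its conjugates, so it is a series in \<open>x\<close>.\<close>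

lemma regular_invariant_curve:
  assumes a: "\<not> vanishes a" and f: "f \<noteq> 0" "vanishes f" "invariant_curve (a, b) f"
  obtains s where "xonly s" "vanishes s" "gY - s dvd f" "gsubst a gX s * dX s = gsubst b gX s"
proof -
  have "\<not> gX dvd f"
  proof
    assume "gX dvd f"
    then have "gX dvd a * dX gX + b * dY gX"
      using invariant_prime_factor[OF prime_elem_gX _ f(1)] f(3) by (simp add: invariant_curve_def)
    then show False using a vanishes_dvd[of gX a] by simp
  qed
  then obtain N where "N \<ge> 1" "\<And>j. j < N \<Longrightarrow> gcoeff f 0 j = 0" "gcoeff f 0 N \<noteq> 0"
    by (rule regular_in_y[OF _ f(2)]) blast
  then obtain e s where e: "e \<ge> 1" and s: "xonly s" "vanishes s" "gsubst f (gX ^ e) s = 0"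
    using puiseux_root by blast
  have tw: "twist \<zeta> s = s" if \<zeta>: "\<zeta> ^ e = 1" for \<zeta>
  proof (rule regular_unique_solution[OF a e, of _ b])
    have "twist \<zeta> (gX ^ e) = gX ^ e"
      using \<zeta> by (simp add: gsubst_power power_mult_distrib gconst_power[symmetric])
    moreover have "twist \<zeta> (gsubst f (gX ^ e) s) = gsubst f (twist \<zeta> (gX ^ e)) (twist \<zeta> s)"
      by (subst gsubst_gsubst) (use e s(2) in auto)
    ultimately have "gsubst f (gX ^ e) (twist \<zeta> s) = 0" using s(3) by simp
    then show "gsubst a (gX ^ e) (twist \<zeta> s) * dX (twist \<zeta> s) = of_nat e * gX ^ (e - 1) * gsubst b (gX ^ e) (twist \<zeta> s)"
      using s by (intro root_ode[OF f(1,3) e] xonly_twist) auto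
    show "gsubst a (gX ^ e) s * dX s = of_nat e * gX ^ (e - 1) * gsubst b (gX ^ e) s"
      by (rule root_ode[OF f(1,3) e s])
  qed (use s in \<open>auto intro: xonly_twist\<close>)
  obtain \<sigma> where \<sigma>: "s = ramify e \<sigma>" using descend_if_twist_invariant[OF e tw] by blast
  have c: "gcoeff \<sigma> i j = gcoeff s (e * i) j" for i j using e by (simp add: \<sigma> gcoeff_ramify)
  have \<sigma>x: "xonly \<sigma>" "vanishes \<sigma>" using s by (auto simp: xonly_iff vanishes_def c)
  have "ramify e (gsubst f gX \<sigma>) = gsubst f (gX ^ e) s" using e \<sigma>x by (simp add: gsubst_gsubst \<sigma>)
  also have "\<dots> = ramify e 0" using s e by simp
  finally have root: "gsubst f gX \<sigma> = 0" using e by (subst (asm) ramify_eq_iff) auto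
  then have "gsubst a (gX ^ 1) \<sigma> * dX \<sigma> = of_nat 1 * gX ^ (1 - 1) * gsubst b (gX ^ 1) \<sigma>"
    using \<sigma>x by (intro root_ode[OF f(1,3)]) auto
  then show ?thesis using that[of \<sigma>] \<sigma>x root by (simp add: branch_dvd_iff)
qed

lemma squarefree_nonzero: "squarefree (f :: germ) \<Longrightarrow> f \<noteq> 0"
proof
  assume "squarefree f" "f = 0"
  then have "gX dvd 1" unfolding squarefree_def by auto
  then show False by (simp add: is_unit_germ_iff)
qed

text \<open>
  The solution through the origin divides the equation of the curve. If a curve remains after division, it is again invariant and
  contains the same solution, which would be a multiple component.
\<close>

lemma transversal_field_no_singular_curve:
  assumes a: "\<not> vanishes a" and f: "squarefree f" "vanishes f" "gmult f \<ge> 2" "invariant_curve (a, b) f"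
  shows False
proof -
  have f0: "f \<noteq> 0" using f(1) by (rule squarefree_nonzero)
  obtain s where s: "xonly s" "vanishes s" "gY - s dvd f" "gsubst a gX s * dX s = gsubst b gX s"
    using regular_invariant_curve[OF a f0 f(2,4)] by blast
  then obtain f1 where f1: "f = (gY - s) * f1" by (auto simp: dvd_def)
  have nz: "gY - s \<noteq> 0" "f1 \<noteq> 0" using f0 f1 by auto
  have "gmult f = 1 + gmult f1" using nz s by (simp add: f1 gmult_mult gmult_branch)
  then have v1: "vanishes f1" using f(3) nz by (simp add: vanishes_iff_gmult)
  have dy: "dX (gY - s) = - dX s" "dY (gY - s) = 1" using s(1) by (simp_all add: dX_diff dY_diff xonly_def)
  have "gY - s dvd a * dX (gY - s) + b * dY (gY - s)"
    using s by (simp add: branch_dvd_iff dy gsubst_diff gsubst_mult xonly_iff gcoeff_dX)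
  then obtain K where K: "a * dX (gY - s) + b * dY (gY - s) = (gY - s) * K" by (auto simp: dvd_def)
  have "a * dX f + b * dY f = (a * dX (gY - s) + b * dY (gY - s)) * f1 + (gY - s) * (a * dX f1 + b * dY f1)"
    unfolding f1 dX_mult dY_mult by (simp add: algebra_simps)
  also have "\<dots> = (gY - s) * (f1 * K + (a * dX f1 + b * dY f1))" unfolding K by (simp add: algebra_simps)
  finally have "(gY - s) * f1 dvd (gY - s) * (f1 * K + (a * dX f1 + b * dY f1))"
    using f(4) f1 by (simp add: invariant_curve_def)
  then have "f1 dvd f1 * K + (a * dX f1 + b * dY f1)" using nz by simp
  then have "invariant_curve (a, b) f1" by (simp add: invariant_curve_def dvd_add_right_iff)
  then obtain t where t: "xonly t" "vanishes t" "gY - t dvd f1" "gsubst a gX t * dX t = gsubst b gX t"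
    using regular_invariant_curve[OF a nz(2) v1] by blast
  have "s = t" by (rule regular_unique_solution[OF a, of 1 s b t]) (use s t in auto)
  then have "(gY - s) ^ 2 dvd f" using t(3) unfolding f1 power2_eq_square by (intro mult_dvd_mono) auto
  then have "\<not> vanishes (gY - s)" using f(1) by (auto simp: squarefree_def is_unit_germ_iff)
  then show False using s(2) vanishes_diff[of gY s] by simp
qed

lemma fol_mult_pos:
  assumes V: "V \<noteq> (0, 0)" and f: "squarefree f" "vanishes f" "gmult f \<ge> 2" "invariant_curve V f"
  shows "fol_mult V \<ge> 1"
proof (rule ccontr)
  assume "\<not> fol_mult V \<ge> 1"
  then have "fol_mult V = 0" by simp
  then have nv: "\<not> vanishes (fst V) \<or> \<not> vanishes (snd V)"
    using fol_mult_order(3)[OF V] by (simp add: vanishes_iff_ord_ge)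
  obtain a b where ab: "V = (a, b)" by (cases V)
  show False
  proof (cases "vanishes a")
    case False
    then show False using transversal_field_no_singular_curve f ab by blast
  next
    case True
    define h where "h = gsubst f gY gX"
    have f0: "f \<noteq> 0" using f(1) by (rule squarefree_nonzero)
    have swap: "gsubst (gsubst g gY gX) gY gX = g" for g by (simp add: gsubst_gsubst)
    have "squarefree h" unfolding squarefree_def
    proof (intro allI impI)
      fix x assume "x ^ 2 dvd h"
      then have "gsubst (x ^ 2) gY gX dvd gsubst h gY gX" by (intro gsubst_dvd) simp_all
      then have "gsubst x gY gX ^ 2 dvd f" using swap by (simp add: h_def gsubst_power)
      then have "gsubst x gY gX dvd 1" using f(1) by (auto simp: squarefree_def)
      then show "x dvd 1" by (simp add: is_unit_germ_iff)
    qed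
    moreover have "vanishes h" using f(2) by (simp add: h_def)
    moreover have "h \<noteq> 0" using f0 gsubst_coordinate_change_eq_0[OF coordinate_change_swap] by (simp add: h_def)
    then have "gmult h \<ge> 2"
      using f(3) f0 ord_ge_coordinate_change[OF coordinate_change_swap, of f 2] by (simp add: h_def ord_ge_le_gmult)
    moreover have "invariant_curve (pullback_field (gY, gX) V) h"
      unfolding h_def by (rule invariant_pullback[OF f(4)]) auto
    moreover have "pullback_field (gY, gX) V = (- gsubst b gY gX, - gsubst a gY gX)"
      by (simp add: pullback_field_def Let_def ab)
    moreover have "\<not> vanishes (gsubst b gY gX)" using True nv ab by simp
    then have "\<not> vanishes (- gsubst b gY gX)" unfolding vanishes_def by simp
    ultimately show False using transversal_field_no_singular_curve by metis
  qed
qed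

section \<open>The ramified foliation as a differential equation\<close>

text \<open>The restriction to the axis \<open>y = 0\<close>, as a univariate series.\<close>

definition axis_series :: "germ \<Rightarrow> complex fps" where
  "axis_series f = Abs_fps (\<lambda>i. gcoeff f i 0)"

lemma axis_series_nth [simp]: "axis_series f $ i = gcoeff f i 0"
  by (simp add: axis_series_def)

lemma axis_series_mult: "axis_series (f * g) = axis_series f * axis_series g"
  by (rule fps_ext) (simp add: gcoeff_mult fps_mult_nth atLeast0AtMost)

lemma axis_series_1 [simp]: "axis_series 1 = 1"
  by (rule fps_ext) (auto simp: gcoeff_1)

lemma axis_series_power: "axis_series (f ^ k) = axis_series f ^ k"
  by (induction k) (simp_all add: axis_series_mult)

lemma axis_series_gX [simp]: "axis_series gX = fps_X"
  by (rule fps_ext) (simp add: gcoeff_gX)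

lemma axis_series_of_nat [simp]: "axis_series (of_nat k) = of_nat k"
proof (induction k)
  case (Suc k)
  have "axis_series (1 + of_nat k) = 1 + axis_series (of_nat k)" by (rule fps_ext) (simp add: gcoeff_1)
  then show ?case using Suc by simp
qed (simp add: fps_eq_iff)

lemma axis_series_dX: "axis_series (dX f) = fps_deriv (axis_series f)"
  by (rule fps_ext) (simp add: gcoeff_dX)

text \<open>
  The strict transform of \<open>a(x^n, y)\<close> under \<open>y = x^n z\<close>, with \<open>x^(n \<nu>)\<close> divided out.
\<close>

definition ramified_transform :: "nat \<Rightarrow> nat \<Rightarrow> germ \<Rightarrow> complex poly fps" where
  "ramified_transform n \<nu> a = Abs_fps (\<lambda>w.
     if n dvd w then \<Sum>j\<le>\<nu> + w div n. monom (gcoeff a (\<nu> + w div n - j) j) j else 0)"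

text \<open>
  Both sides collect the terms of \<open>a\<close> by total degree \<open>d\<close>: in \<open>y = x^n z\<close> a term of degree \<open>d\<close> gets the factor
  \<open>x^(n d)\<close>.
\<close>

lemma ev_ramified_transform:
  assumes a: "ord_ge a \<nu>" and n: "n \<ge> 1" and s: "s = gX ^ n * \<zeta>"
  shows "axis_series (gsubst a (gX ^ n) s) = fps_X ^ (n * \<nu>) * ev (ramified_transform n \<nu> a) (axis_series \<zeta>)"
proof (rule fps_ext)
  fix M
  define z where "z = axis_series \<zeta>"
  define H where "H = (\<lambda>d. if n * d \<le> M then \<Sum>l\<le>d. gcoeff a (d - l) l * (z ^ l) $ (M - n * d) else 0)"
  have H0: "H d = 0" if "d < \<nu>" for d
    using that a by (auto simp: H_def ord_ge_def intro!: sum.neutral)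
  have HM: "H d = 0" if "\<not> n * d \<le> M" for d
    using that by (simp add: H_def)
  define g where "g = (\<lambda>l k. if n * (k + l) \<le> M then gcoeff a k l * (z ^ l) $ (M - n * (k + l)) else 0)"
  have v: "vanishes (gX ^ n)" "vanishes s" using n by (auto simp: s)
  have pw: "gcoeff ((gX ^ n) ^ k * s ^ l) M 0 = (if n * (k + l) \<le> M then (z ^ l) $ (M - n * (k + l)) else 0)" for k l
  proof -
    have "(gX ^ n) ^ k * s ^ l = gX ^ (n * (k + l)) * \<zeta> ^ l"
      by (simp add: s power_mult_distrib power_mult[symmetric] power_add distrib_left mult_ac)
    then show ?thesis by (simp add: gcoeff_gX_power_mult z_def flip: axis_series_power)
  qed
  have sub: "{(l, k). l + k \<le> M} \<subseteq> {..M} \<times> {..M}" by auto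
  have out: "g l k = 0" if "\<not> l + k \<le> M" for l k
  proof -
    have "k + l \<le> n * (k + l)" using n by simp
    then have "\<not> n * (k + l) \<le> M" using that by linarith
    then show ?thesis by (simp add: g_def)
  qed
  have "axis_series (gsubst a (gX ^ n) s) $ M = (\<Sum>k\<le>M. \<Sum>l\<le>M. g l k)"
    using v by (simp add: gcoeff_gsubst pw g_def if_distrib cong: if_cong sum.cong)
  also have "\<dots> = (\<Sum>(l, k)\<in>{..M} \<times> {..M}. g l k)" by (subst sum.swap) (simp add: sum.cartesian_product)
  also have "\<dots> = (\<Sum>(l, k)\<in>{(l, k). l + k \<le> M}. g l k)"
    using sub out by (intro sum.mono_neutral_right) auto
  also have "\<dots> = (\<Sum>d\<le>M. \<Sum>l\<le>d. g l (d - l))" by (rule sum.triangle_reindex_eq)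
  also have "\<dots> = (\<Sum>d\<le>M. H d)" by (intro sum.cong) (auto simp: H_def g_def)
  finally have L: "axis_series (gsubst a (gX ^ n) s) $ M = (\<Sum>d\<le>M. H d)" .
  have E: "evp (ramified_transform n \<nu> a $ w) z $ (M - (n * \<nu> + w)) = (if n dvd w then H (\<nu> + w div n) else 0)"
    if "n * \<nu> \<le> M" "w \<le> M - n * \<nu>" for w
  proof (cases "n dvd w")
    case True
    then have w: "n * (\<nu> + w div n) = n * \<nu> + w" by (simp add: distrib_left)
    have "M - (n * \<nu> + w) = M - n * (\<nu> + w div n)" "n * (\<nu> + w div n) \<le> M" using that unfolding w by auto
    then show ?thesis using True
      by (simp add: ramified_transform_def evp_sum evp_monom H_def fps_sum_nth)
  qed (simp add: ramified_transform_def)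
  have "(\<Sum>d\<le>M. H d) = (fps_X ^ (n * \<nu>) * ev (ramified_transform n \<nu> a) z) $ M"
  proof (cases "n * \<nu> \<le> M")
    case False
    have "H d = 0" for d
    proof (cases "d < \<nu>")
      case nd: False
      then have "n * \<nu> \<le> n * d" by (intro mult_le_mono2) simp
      then have "\<not> n * d \<le> M" using False by linarith
      then show ?thesis by (simp add: H_def)
    qed (rule H0)
    then show ?thesis using False by (simp add: fps_X_power_mult_nth)
  next
    case True
    have low: "n * (d - \<nu>) \<le> M - n * \<nu>" if "n * d \<le> M" for d
      using that by (simp add: diff_mult_distrib2 diff_le_mono)
    have "(fps_X ^ (n * \<nu>) * ev (ramified_transform n \<nu> a) z) $ M = (\<Sum>w\<le>M - n * \<nu>. if n dvd w then H (\<nu> + w div n) else 0)"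
      unfolding fps_X_power_mult_nth ev_nth using True by (auto intro!: sum.cong simp: E)
    also have "\<dots> = (\<Sum>w\<in>{w. w \<le> M - n * \<nu> \<and> n dvd w}. H (\<nu> + w div n))"
      by (rule sum.mono_neutral_cong_right) auto
    also have "\<dots> = (\<Sum>d\<in>{d. \<nu> \<le> d \<and> n * d \<le> M}. H d)"
      by (rule sum.reindex_bij_witness[of _ "\<lambda>d. n * (d - \<nu>)" "\<lambda>w. \<nu> + w div n"])
         (use True n low in \<open>auto simp: distrib_left\<close>)
    also have "\<dots> = (\<Sum>d\<le>M. H d)"
    proof (rule sum.mono_neutral_left)
      show "{d. \<nu> \<le> d \<and> n * d \<le> M} \<subseteq> {..M}"
      proof clarify
        fix d assume "n * d \<le> M"
        moreover have "1 * d \<le> n * d" by (intro mult_le_mono1 n)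
        ultimately show "d \<le> M" by linarith
      qed
      show "\<forall>d\<in>{..M} - {d. \<nu> \<le> d \<and> n * d \<le> M}. H d = 0"
        using H0 HM by (metis DiffE mem_Collect_eq not_le)
    qed simp
    finally show ?thesis ..
  qed
  then show "axis_series (gsubst a (gX ^ n) s) $ M = (fps_X ^ (n * \<nu>) * ev (ramified_transform n \<nu> a) (axis_series \<zeta>)) $ M"
    using L by (simp add: z_def)
qed

lemma ev_const_mult: "ev (fps_const [:c:] * G) z = fps_const c * ev G z"
  by (rule fps_ext) (simp add: ev_nth evp_smult sum_distrib_left)

text \<open>
  The right-hand side of the equation for \<open>z\<close> that follows from \<open>a y' = n x^(n-1) b\<close> and \<open>y = x^n z\<close>, where
  \<open>x y' = x^n (n z + x z')\<close>.
\<close>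

definition ramified_form :: "nat \<Rightarrow> nat \<Rightarrow> germ \<Rightarrow> germ \<Rightarrow> complex poly fps" where
  "ramified_form n \<nu> a b = fps_const [:of_nat n:] * (ramified_transform n \<nu> b - zvar * ramified_transform n \<nu> a)"

lemma ramified_solution:
  assumes a: "ord_ge a \<nu>" and b: "ord_ge b \<nu>" and n: "n \<ge> 1" and s: "s = gX ^ n * \<zeta>"
    and ode: "gsubst a (gX ^ n) s * dX s = of_nat n * gX ^ (n - 1) * gsubst b (gX ^ n) s"
  shows "solution (ramified_transform n \<nu> a) (ramified_form n \<nu> a b) (axis_series \<zeta>)"
proof -
  define z where "z = axis_series \<zeta>"
  define A B where "A = ev (ramified_transform n \<nu> a) z" and "B = ev (ramified_transform n \<nu> b) z"
  have "axis_series (dX s) = fps_X ^ (n - 1) * (of_nat n * z + fps_X * fps_deriv z)"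
  proof -
    have "axis_series (dX s) = fps_deriv (fps_X ^ n * z)" by (simp add: axis_series_dX s axis_series_mult axis_series_power z_def)
    also have "\<dots> = fps_X ^ (n - 1) * (of_nat n * z) + fps_X ^ n * fps_deriv z"
      by (simp add: fps_deriv_power' mult_ac)
    also have "fps_X ^ n = (fps_X ^ (n - 1) * fps_X :: complex fps)" using n by (cases n) simp_all
    finally show ?thesis by (simp add: distrib_left mult.assoc)
  qed
  then have "fps_X ^ (n * \<nu>) * A * (fps_X ^ (n - 1) * (of_nat n * z + fps_X * fps_deriv z)) =
      of_nat n * fps_X ^ (n - 1) * (fps_X ^ (n * \<nu>) * B)"
    using arg_cong[OF ode, of axis_series] ev_ramified_transform[OF a n s] ev_ramified_transform[OF b n s]
    by (simp add: axis_series_mult axis_series_power A_def B_def z_def)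
  then have "fps_X ^ (n * \<nu> + (n - 1)) * (A * (of_nat n * z + fps_X * fps_deriv z)) = fps_X ^ (n * \<nu> + (n - 1)) * (of_nat n * B)"
    by (simp add: power_add mult_ac)
  then have "A * (of_nat n * z + fps_X * fps_deriv z) = of_nat n * B" by simp
  then have "fps_X * A * fps_deriv z = of_nat n * (B - z * A)" by (simp add: algebra_simps)
  moreover have "of_nat n = fps_const (of_nat n :: complex)" by (simp add: fps_of_nat)
  ultimately show ?thesis
    by (simp add: solution_def ramified_form_def ev_const_mult ev_diff ev_zvar_mult A_def B_def z_def)
qed

lemma coeff_ramified_transform_0: "coeff (ramified_transform n \<nu> a $ 0) j = (if j \<le> \<nu> then gcoeff a (\<nu> - j) j else 0)"
proof -
  have "coeff (ramified_transform n \<nu> a $ 0) j = (\<Sum>i\<le>\<nu>. if i = j then gcoeff a (\<nu> - j) j else 0)"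
    unfolding ramified_transform_def by (auto simp: coeff_sum coeff_monom intro!: sum.cong)
  then show ?thesis by simp
qed

text \<open>
  On the first component this is \<open>n\<close> times the restriction of the form of the tangent cone.
\<close>

lemma coeff_ramified_form_0:
  "coeff (ramified_form n \<nu> a b $ 0) j = of_nat n * (if j \<le> Suc \<nu> then gcoeff (gX * b - gY * a) (Suc \<nu> - j) j else 0)"
  unfolding ramified_form_def
  by (cases j) (auto simp: coeff_ramified_transform_0 coeff_pCons gcoeff_gX_mult gcoeff_gY_mult Suc_diff_le)

lemma top_coefficient_nonzero:
  assumes "\<not> {(x, y). x = 0} \<subseteq> fol_tangent_cone V"
  shows "gcoeff (fst V) 0 (fol_mult V) \<noteq> 0"
proof
  assume z: "gcoeff (fst V) 0 (fol_mult V) = 0"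
  have "homog_part (fol_mult V) (fst V) 0 y = 0" for y
    unfolding homog_part_def
  proof (intro sum.neutral ballI)
    fix i assume "i \<in> {..fol_mult V}"
    show "gcoeff (fst V) i (fol_mult V - i) * 0 ^ i * y ^ (fol_mult V - i) = 0"
      using z by (cases i) auto
  qed
  then show False using assms by (auto simp: fol_tangent_cone_def)
qed

text \<open>
  The bound for the first divisor gives the theorem: at \<open>x = 0\<close> the equation has \<open>A\<close> of degree
  \<open>\<nu>\<close> and \<open>R = - n z A + \<dots>\<close> of negative ratio at infinity, or, in the dicritical case,
  \<open>R = 0\<close> and \<open>A\<close> of degree at most \<open>\<nu> - 1\<close>.
\<close>

lemma tree_count_le:
  assumes V: "V \<noteq> (0, 0)" "V = (a, b)" and n: "n \<ge> 1" and \<rho>: "\<rho> = 1 \<or> \<rho> = 2"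
    and cone: "\<not> dicritical1 V \<Longrightarrow> \<not> {(x, y). x = 0} \<subseteq> fol_tangent_cone V"
    and Z: "finite Z" "[] \<in> nodes Z" 
    and sol: "\<And>z. z \<in> Z \<Longrightarrow> solution (ramified_transform n (fol_mult V) a) (ramified_form n (fol_mult V) a b) z"
  shows "tree_count \<rho> Z \<le> 2 * fol_mult V"
proof -
  define \<nu> where "\<nu> = fol_mult V"
  define A R where "A = ramified_transform n \<nu> a" and "R = ramified_form n \<nu> a b"
  have cA: "coeff (A $ 0) j = (if j \<le> \<nu> then gcoeff a (\<nu> - j) j else 0)" for j
    by (simp add: A_def coeff_ramified_transform_0)
  have cR: "coeff (R $ 0) j = of_nat n * (if j \<le> Suc \<nu> then gcoeff (gX * b - gY * a) (Suc \<nu> - j) j else 0)" for j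
    by (simp add: R_def coeff_ramified_form_0)
  have ord: "ord_ge a \<nu>" "ord_ge b \<nu>" "\<not> (ord_ge a (Suc \<nu>) \<and> ord_ge b (Suc \<nu>))"
    using fol_mult_order[OF V(1)] by (simp_all add: \<nu>_def V(2))
  have bound: "state_bound \<rho> A R (tree_count \<rho> Z)" if "A $ 0 \<noteq> 0"
  proof (rule tree_bound[OF \<rho> Z])
    show "A \<noteq> 0" using that by auto
  qed (use sol in \<open>simp add: A_def R_def \<nu>_def\<close>)
  have leadA: "subdegree A = 0" "lead A = A $ 0" if "A $ 0 \<noteq> 0"
    using that subdegree_leadI[of 0 A] by auto
  show ?thesis
  proof (cases "dicritical1 V")
    case False
    then have t: "gcoeff a 0 \<nu> \<noteq> 0" using cone[OF False] top_coefficient_nonzero[of V] by (simp add: V(2) \<nu>_def)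
    have dA: "degree (A $ 0) = \<nu>" using t by (intro antisym degree_le le_degree) (auto simp: cA)
    have top: "coeff (R $ 0) (Suc \<nu>) = - of_nat n * gcoeff a 0 \<nu>"
      by (simp add: cR gcoeff_gX_mult gcoeff_gY_mult)
    have dR: "degree (R $ 0) = Suc \<nu>" using t top n by (intro antisym degree_le le_degree) (auto simp: cR)
    have A0: "A $ 0 \<noteq> 0" using t cA[of \<nu>] by auto
    have R0: "R $ 0 \<noteq> 0" using dR by auto
    then have Rne: "R \<noteq> 0" by auto
    have leadR: "subdegree R = 0" "lead R = R $ 0" using R0 subdegree_leadI[of 0 R] by auto
    have "lead_coeff (A $ 0) = gcoeff a 0 \<nu>" by (simp add: dA cA)
    moreover have "lead_coeff (R $ 0) = - of_nat n * gcoeff a 0 \<nu>" using top by (simp add: dR)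
    moreover have "\<not> pos_multiple (- of_nat n * gcoeff a 0 \<nu>) (gcoeff a 0 \<nu>)"
    proof
      assume "pos_multiple (- of_nat n * gcoeff a 0 \<nu>) (gcoeff a 0 \<nu>)"
      then obtain r :: real where r: "r > 0" "- of_nat n * gcoeff a 0 \<nu> = of_real r * gcoeff a 0 \<nu>"
        by (auto simp: pos_multiple_def)
      then have "- of_nat n * gcoeff a 0 \<nu> = of_real r * gcoeff a 0 \<nu>" by blast
      then have "- of_nat n = (of_real r :: complex)" using t mult_right_cancel by blast
      then have "- real n = r" by (metis of_real_eq_iff of_real_minus of_real_of_nat_eq)
      then show False using r(1) by simp
    qed
    ultimately have np: "\<not> pos_multiple (lead_coeff (R $ 0)) (lead_coeff (A $ 0))" by presburger
    have "degree (R $ 0) = degree (A $ 0) + 1" using dA dR by simp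
    then have "tree_count \<rho> Z \<le> 2 * degree (lead A)"
      using bound[OF A0] Rne np unfolding state_bound_def leadA[OF A0] leadR by auto
    then show ?thesis using leadA[OF A0] dA by (simp add: \<nu>_def)
  next
    case True
    then have r: "ord_ge (gX * b - gY * a) (\<nu> + 2)" using dicritical_radial[of a b] V by (simp add: \<nu>_def)
    then have rc: "gcoeff (gX * b - gY * a) i j = 0" if "i + j = Suc \<nu>" for i j
      using that by (auto simp: ord_ge_def)
    have "R $ 0 = 0"
    proof (rule poly_eqI)
      fix j
      show "coeff (R $ 0) j = coeff 0 j"
        by (cases "j \<le> Suc \<nu>") (simp_all only: cR if_True if_False rc le_add_diff_inverse2 mult_zero_right coeff_0)
    qed
    have a0: "gcoeff a 0 \<nu> = 0" using rc[of 0 "Suc \<nu>"] by (simp add: gcoeff_gX_mult gcoeff_gY_mult)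
    have A0: "A $ 0 \<noteq> 0"
    proof
      assume z: "A $ 0 = 0"
      have az: "gcoeff a i j = 0" if "i + j = \<nu>" for i j
        using that cA[of j] by (simp add: z) (metis add_diff_cancel_right' le_add2)
      have bz: "gcoeff b i j = 0" if "i + j = \<nu>" for i j
        using that rc[of "Suc i" j] az[of "Suc i" "j - 1"] by (cases j) (auto simp: gcoeff_gX_mult gcoeff_gY_mult)
      have "ord_ge a (Suc \<nu>)" "ord_ge b (Suc \<nu>)"
        unfolding ord_ge_def using ord(1,2) az bz by (auto simp: less_Suc_eq ord_ge_def)
      then show False using ord(3) by blast
    qed
    have "degree (A $ 0) \<noteq> \<nu>" using a0 A0 cA[of \<nu>] by (metis diff_self_eq_0 leading_coeff_0_iff order_refl)
    moreover have "degree (A $ 0) \<le> \<nu>" by (intro degree_le) (auto simp: cA)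
    ultimately have "degree (lead A) + 1 \<le> \<nu>" using leadA[OF A0] by simp
    moreover have "R = 0 \<or> subdegree R > subdegree A"
      using \<open>R $ 0 = 0\<close> leadA[OF A0] by (metis nth_subdegree_nonzero gr0I)
    then have "tree_count \<rho> Z \<le> 2 * degree (lead A) + \<rho>" using bound[OF A0] by (simp add: state_bound_def)
    ultimately show ?thesis using \<rho> by (auto simp: \<nu>_def)
  qed
qed

lemma nil_nodes_iff: "[] \<in> nodes Z \<longleftrightarrow> (\<exists>z\<in>Z. \<exists>z'\<in>Z. z \<noteq> z')"
  unfolding nodes_def by auto

section \<open>Shifting the tree\<close>

text \<open>
  The series \<open>s / x^n\<close> have been counted instead of \<open>s / x\<close>. Multiplication by \<open>x\<close> adds a vertex below
  the tree, which has exactly one successor and is not counted.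
\<close>

lemma child_shift:
  "child ((\<lambda>z. fps_X * z) ` Z) c = (if c = 0 then Z else {})"
proof -
  have "fps_const c + fps_X * z = fps_X * z' \<longleftrightarrow> c = 0 \<and> z = z'" for z z' :: "complex fps"
  proof
    assume eq: "fps_const c + fps_X * z = fps_X * z'"
    from arg_cong[OF this, of "\<lambda>f. f $ 0"] have "c = 0" by simp
    then show "c = 0 \<and> z = z'" using eq by simp
  qed simp
  then show ?thesis unfolding child_def by auto
qed

lemma tree_count_shift:
  assumes Z: "finite Z" "[] \<in> nodes Z" and \<rho>: "\<rho> = 1 \<or> \<rho> = 2"
  shows "tree_count \<rho> ((\<lambda>z. fps_X * z) ` Z) = tree_count \<rho> Z" "[] \<in> nodes ((\<lambda>z. fps_X * z) ` Z)"
proof -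
  define Y where "Y = (\<lambda>z. fps_X * z) ` Z"
  show nil: "[] \<in> nodes Y"
  proof -
    obtain z z' where z: "z \<in> Z" "z' \<in> Z" "z \<noteq> z'" using Z(2) by (auto simp: nil_nodes_iff)
    then have "fps_X * z \<in> Y" "fps_X * z' \<in> Y" "fps_X * z \<noteq> fps_X * z'" by (auto simp: Y_def)
    then show ?thesis unfolding nil_nodes_iff by blast
  qed
  have empty: "nodes {} = {}" by (simp add: nodes_def)
  have child: "child Y c = (if c = 0 then Z else {})" for c by (simp add: Y_def child_shift)
  have "multiple_points Y = {0}" using Z(2) by (auto simp: multiple_points_def child empty)
  moreover have "first_points Y = {0}"
    using Z(2) by (auto simp: first_points_def Y_def nil_nodes_iff image_iff)
  moreover have "own_count \<rho> {0} {0} = 0" by (simp add: own_count_def)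
  ultimately show "tree_count \<rho> Y = tree_count \<rho> Z"
    using tree_count_recursion[OF _ nil \<rho>] Z(1) by (simp add: Y_def[symmetric] child) (simp add: Y_def)
qed

lemma tree_count_shift_power:
  assumes Z: "finite Z" "[] \<in> nodes Z" and \<rho>: "\<rho> = 1 \<or> \<rho> = 2"
  shows "tree_count \<rho> ((\<lambda>z. fps_X ^ k * z) ` Z) = tree_count \<rho> Z \<and> [] \<in> nodes ((\<lambda>z. fps_X ^ k * z) ` Z)"
proof (induction k)
  case (Suc k)
  have "(\<lambda>z. fps_X ^ Suc k * z) ` Z = (\<lambda>z. fps_X * z) ` (\<lambda>z. fps_X ^ k * z) ` Z"
    by (simp add: image_image mult.assoc)
  then show ?case using tree_count_shift[OF _ conjunct2[OF Suc.IH] \<rho>] Suc.IH Z(1) by simp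
qed (use Z in simp)

section \<open>The inequality for the virtual multiplicities\<close>

theorem theorem1p1:
  fixes V :: vfield and f :: germ and \<phi> :: "germ \<times> germ"
  assumes "defines_foliation V"
    and "curve_equation f" and "gmult f \<ge> 2"
    and "invariant_curve V f"
    and "coordinate_change \<phi>"
    and "adapted_coordinates (pullback_field \<phi> V) (gsubst f (fst \<phi>) (snd \<phi>))"
  shows "real (fol_mult V) \<ge>
           max (real (mu_T (gsubst f (fst \<phi>) (snd \<phi>))))
               (real (mu_D (gsubst f (fst \<phi>) (snd \<phi>))) / 2)"
proof -
  obtain p q where \<phi>: "\<phi> = (p, q)" by (cases \<phi>)
  have cc: "coordinate_change (p, q)" using assms(5) \<phi> by simp
  have pq: "vanishes p" "vanishes q" using cc by (auto simp: coordinate_change_def)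
  have V0: "V \<noteq> (0, 0)" using assms(1) by (rule defines_foliation_nonzero)
  have f: "squarefree f" "vanishes f" using assms(2) by (auto simp: curve_equation_def)
  have f0: "f \<noteq> 0" using f(1) by (rule squarefree_nonzero)
  define g where "g = gsubst f p q"
  obtain a b where ab: "pullback_field (p, q) V = (a, b)" by (cases "pullback_field (p, q) V")
  define \<nu> where "\<nu> = fol_mult (a, b)"
  have le: "\<nu> \<le> fol_mult V" and ab0: "(a, b) \<noteq> (0, 0)"
    using fol_mult_pullback[OF V0 cc] by (simp_all add: ab \<nu>_def)
  have pos: "fol_mult V \<ge> 1" by (rule fol_mult_pos[OF V0 f assms(3,4)])
  have g0: "g \<noteq> 0" using f0 gsubst_coordinate_change_eq_0[OF cc] by (simp add: g_def)
  have gv: "vanishes g" using f pq by (simp add: g_def)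
  have ginv: "invariant_curve (a, b) g" using invariant_pullback[OF assms(4) pq] by (simp add: ab g_def)
  have adapted: "adapted_coordinates (a, b) g" using assms(6) by (simp add: \<phi> ab g_def)
  have ord: "ord_ge a \<nu>" "ord_ge b \<nu>" using fol_mult_order[OF ab0] by (simp_all add: \<nu>_def)
  define n where "n = ramification_index g"
  have n: "n \<ge> 1" using ramification_index_pos[OF g0] by (simp add: n_def)
  have "\<exists>v ss. \<not> vanishes v \<and> (\<forall>s\<in>set ss. xonly s \<and> gX ^ n dvd s) \<and> ramify n g = branch_prod v ss"
  proof (rule ramified_branches[OF g0 n])
    fix h assume h: "component h g"
    have hn: "gmult h dvd n" unfolding n_def ramification_index_def using h by (intro dvd_Lcm) auto
    have hg: "h dvd g" and irr: "irreducible h" using h by (auto simp: component_def)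
    show "\<not> gX dvd h \<and> gmult h dvd n \<and>
        (\<forall>e s u. e \<ge> 1 \<and> xonly s \<and> vanishes s \<and> \<not> vanishes u \<and> gsubst h (gX ^ e) s = 0 \<and>
          ramify e h = u * (\<Prod>\<zeta> | \<zeta> ^ e = 1. gY - twist \<zeta> s) \<longrightarrow> gX ^ e dvd s)"
    proof (cases "dicritical1 (a, b)")
      case False
      then have "\<not> {(x, y). x = 0} \<subseteq> fol_tangent_cone (a, b)" using adapted by (simp add: adapted_coordinates_def)
      then have t: "gcoeff a 0 \<nu> \<noteq> 0" using top_coefficient_nonzero[of "(a, b)"] by (simp add: \<nu>_def)
      have "\<not> gX dvd h"
      proof
        assume "gX dvd h"
        then have "gX dvd g" using hg by (rule dvd_trans)
        then have "gX dvd a * dX gX + b * dY gX"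
          using invariant_prime_factor[OF prime_elem_gX _ g0] ginv by (simp add: invariant_curve_def)
        moreover have "gX dvd a * dX gX + b * dY gX \<Longrightarrow> gX dvd a" by simp
        ultimately show False using t by (simp add: gX_dvd_iff)
      qed
      moreover have "gX ^ e dvd s" if e: "e \<ge> 1" and s: "xonly s" "vanishes s" "gsubst h (gX ^ e) s = 0" for e s
      proof -
        have "gsubst h (gX ^ e) s dvd gsubst g (gX ^ e) s" using hg e s by (intro gsubst_dvd) auto
        then have "gsubst g (gX ^ e) s = 0" using s by simp
        then show ?thesis using branch_order[OF ord(1) t ord(2) e s(1,2)] root_ode[OF g0 ginv e s(1,2)] by blast
      qed
      ultimately show ?thesis using hn by blast
    next
      case True
      then have cone: "tangent_cone h \<noteq> {(x, y). x = 0}" using adapted h by (simp add: adapted_coordinates_def)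
      have "\<not> gX dvd h"
      proof
        assume "gX dvd h"
        then obtain u where u: "h = gX * u" by (auto simp: dvd_def)
        then have "u dvd 1" using irr prime_elem_gX by (auto dest!: irreducibleD)
        then have nv: "gcoeff u 0 0 \<noteq> 0" by (simp add: is_unit_germ_iff vanishes_def)
        then have "u \<noteq> 0" by auto
        then have m1: "gmult h = 1" using \<open>u dvd 1\<close> by (simp add: u gmult_mult gmult_unit)
        have "homog_part 1 h x y = gcoeff u 0 0 * x" for x y
          by (simp add: homog_part_def u gcoeff_gX_mult)
        then have "tangent_cone h = {(x, y). x = 0}" using nv by (simp add: tangent_cone_def m1)
        then show False using cone by simp
      qed
      then show ?thesis using cone hn split_tangent_cone by blast
    qed
  qed
  then obtain v ss where v: "\<not> vanishes v" and ss: "\<And>s. s \<in> set ss \<Longrightarrow> xonly s \<and> gX ^ n dvd s"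
    and split: "ramify n g = branch_prod v ss" by blast
  have ssv: "\<forall>s\<in>set ss. xonly s \<and> vanishes s"
  proof
    fix s assume "s \<in> set ss"
    then have "xonly s" "gX ^ n dvd s" using ss by auto
    then show "xonly s \<and> vanishes s" using n vanishes_dvd[of "gX ^ n" s] by auto
  qed
  have F: "ramified_curve g = branch_prod v ss" using split by (simp add: ramified_curve_def n_def)
  have ne: "ss \<noteq> []"
  proof
    assume "ss = []"
    then have "\<not> vanishes (ramify n g)" using v split by (simp add: branch_prod_def)
    then show False using gv n by simp
  qed
  define Z where "Z = slope_coeffs ` set ss"
  show ?thesis
  proof (cases "[] \<in> nodes Z")
    case False
    then have "mu_T g \<le> 1" "mu_D g \<le> 1"
      using virtual_multiplicities_single[OF v ssv F Z_def ne] by (simp_all add: mu_T_def mu_D_def Let_def)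
    then show ?thesis using pos by (simp add: \<phi> g_def)
  next
    case True
    have mu: "mu_T g = card (terminal_nodes Z)" "mu_D g = card (divisorial_nodes Z)"
      using virtual_multiplicities_nodes[OF v ssv F Z_def ne True] by (simp_all add: mu_T_def mu_D_def Let_def)
    \<comment> \<open>the series \<open>s / x^n\<close>, which solve the differential equation\<close>
    define \<zeta> where "\<zeta> = (\<lambda>s. SOME t. s = gX ^ n * t)"
    have \<zeta>: "s = gX ^ n * \<zeta> s" if "s \<in> set ss" for s
    proof -
      have "\<exists>t. s = gX ^ n * t" using ss[OF that] by (meson dvdE)
      then show ?thesis unfolding \<zeta>_def by (rule someI_ex)
    qed
    define Y where "Y = (\<lambda>s. axis_series (\<zeta> s)) ` set ss"
    have "slope_coeffs s = fps_X ^ (n - 1) * axis_series (\<zeta> s)" if s: "s \<in> set ss" for s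
    proof (rule fps_ext)
      fix i
      have "gcoeff s (Suc i) 0 = (if Suc i < n then 0 else gcoeff (\<zeta> s) (Suc i - n) 0)"
        using arg_cong[OF \<zeta>[OF s], of "\<lambda>t. gcoeff t (Suc i) 0"] by (simp add: gcoeff_gX_power_mult)
      then show "slope_coeffs s $ i = (fps_X ^ (n - 1) * axis_series (\<zeta> s)) $ i"
        using n by (auto simp: slope_coeffs_def fps_X_power_mult_nth not_less Suc_diff_le)
    qed
    then have ZY: "Z = (\<lambda>z. fps_X ^ (n - 1) * z) ` Y"
      unfolding Z_def Y_def image_image by (intro image_cong refl)
    have nilY: "[] \<in> nodes Y"
    proof -
      obtain y y' where "y \<in> Y" "y' \<in> Y" "fps_X ^ (n - 1) * y \<noteq> fps_X ^ (n - 1) * y'"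
        using True unfolding nil_nodes_iff ZY by blast
      then show ?thesis unfolding nil_nodes_iff by (intro bexI[of _ y] bexI[of _ y']) auto
    qed
    have finY: "finite Y" by (simp add: Y_def)
    have sol: "solution (ramified_transform n \<nu> a) (ramified_form n \<nu> a b) z" if zY: "z \<in> Y" for z
    proof -
      obtain s where s: "s \<in> set ss" "z = axis_series (\<zeta> s)" using zY by (auto simp: Y_def)
      have sv: "xonly s" "vanishes s" using ssv s(1) by auto
      have "gsubst (ramify n g) gX s = 0" using v ssv s(1) by (simp add: split root_branch_prod_iff)
      then have "gsubst g (gX ^ n) s = 0" using sv n by (simp add: gsubst_gsubst gsubst_power)
      then show ?thesis
        unfolding s(2) by (intro ramified_solution[OF ord n \<zeta>[OF s(1)]] root_ode[OF g0 ginv n sv])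
    qed
    have bound: "tree_count \<rho> Z \<le> 2 * \<nu>" if \<rho>: "\<rho> = 1 \<or> \<rho> = 2" for \<rho>
    proof -
      have cone: "\<not> {(x, y). x = 0} \<subseteq> fol_tangent_cone (a, b)" if "\<not> dicritical1 (a, b)"
        using adapted that by (simp add: adapted_coordinates_def)
      have "tree_count \<rho> Y \<le> 2 * \<nu>"
        unfolding \<nu>_def by (rule tree_count_le[OF ab0 refl n \<rho> cone finY nilY sol[unfolded \<nu>_def]])
      then show ?thesis using tree_count_shift_power[OF finY nilY \<rho>, of "n - 1"] by (simp add: ZY)
    qed
    have "2 * mu_T g \<le> 2 * \<nu>" using bound[of 2] by (simp add: tree_count_def mu)
    moreover have "mu_D g \<le> 2 * \<nu>" using bound[of 1] by (simp add: tree_count_def mu)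
    ultimately have "real (mu_T g) \<le> real (fol_mult V)" "real (mu_D g) / 2 \<le> real (fol_mult V)"
      using le by linarith+
    then show ?thesis by (simp add: \<phi> g_def)
  qed
qed

end
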